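(* Let $\Gamma\subset\mathbb{R}^n$ be the attractor of an iterated function system $\{s_1,\dots,s_M\}$ of contracting similarities, suppose that $\Gamma_1,\dots,\Gamma_M$ are disjoint (i.e. $\Gamma$ is disjoint), where $\Gamma_m=s_m(\Gamma)$, and let $J\in\mathbb{N}$. Then there exists $c_I>0$ such that, for every $0<h\le\mathrm{diam}(\Gamma)$ and every $\psi_h\in\mathbb{Y}_h$, $$\|\psi_h\|_{\mathbb{L}_2(\Gamma)}\le c_I\,h^{-t}\|\psi_h\|_{\mathbb{H}^{-t}(\Gamma)},\qquad0<t\le J.$$
   Context: IFS attractors. $M\ge2$ and $s_1,\dots,s_M:\mathbb{R}^n\to\mathbb{R}^n$ satisfy $|s_m(x)-s_m(y)|=\rho_m|x-y|$ with $\rho_m\in(0,1)$. The attractor is the unique non-empty compact $\Gamma$ with $\Gamma=\bigcup_ms_m(\Gamma)$. A disjoint attractor is a $d$-set, where $d=\dim_{\mathrm H}(\Gamma)\in(0,n)$ solves $\sum_m\rho_m^d=1$; a closed set is a $d$-set if $c_1r^d\le\mathcal{H}^d(\Gamma\cap B_r(x))\le c_2r^d$ for all $x\in\Gamma$, $0<r\le1$, some $c_1,c_2>0$ ($\mathcal{H}^d$ Hausdorff measure). Function spaces. $H^s(\mathbb{R}^n)$ has norm $\|\varphi\|^2_{H^s(\mathbb{R}^n)}=\int(1+|\xi|^2)^s|\widehat\varphi(\xi)|^2\,d\xi$ (unitary Fourier transform). $\mathbb{L}_2(\Gamma)$ is the complex $L_2$ space with respect to $\mathcal{H}^d|_\Gamma$.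 For $t>0$ and $s=t+(n-d)/2$, $\mathrm{tr}_\Gamma:H^s(\mathbb{R}^n)\to\mathbb{L}_2(\Gamma)$ is the continuous extension of $\varphi\mapsto\varphi|_\Gamma$, $\varphi\in C_0^\infty(\mathbb{R}^n)$; $\mathbb{H}^t(\Gamma):=\mathrm{tr}_\Gamma(H^s(\mathbb{R}^n))$ with norm $\|f\|_{\mathbb{H}^t(\Gamma)}=\inf\{\|\varphi\|_{H^s(\mathbb{R}^n)}:\mathrm{tr}_\Gamma\varphi=f\}$; $\mathbb{H}^{-t}(\Gamma):=(\mathbb{H}^t(\Gamma))^*$ (antilinear functionals, dual norm), with $\mathbb{L}_2(\Gamma)$ embedded via $f\mapsto(f,\cdot)_{\mathbb{L}_2(\Gamma)}$. Approximation spaces. $I_{\mathbb{N}}=\bigcup_{\ell\ge1}\{1,\dots,M\}^\ell$; $\Gamma_0=\Gamma$, $\Gamma_{\boldsymbol m}=s_{m_1}\circ\cdots\circ s_{m_\ell}(\Gamma)$; $\boldsymbol m_-=(m_1,\dots,m_{\ell-1})$ if $\ell\ge2$, $\boldsymbol m_-=0$ if $\ell=1$. $\chi_{\boldsymbol m}=\mathcal{H}^d(\Gamma_{\boldsymbol m})^{-1/2}$ on $\Gamma_{\boldsymbol m}$, $0$ elsewhere. For $0<h\le\mathrm{diam}(\Gamma)$: $L_h=\{0\}$ if $h=\mathrm{diam}(\Gamma)$, otherwise $L_h=\{\boldsymbol m\in I_{\mathbb{N}}:\mathrm{diam}(\Gamma_{\boldsymbol m})\le h,\ \mathrm{diam}(\Gamma_{\boldsymbol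 m_-})>h\}$. $\mathbb{Y}_h=\mathrm{span}\{\chi_{\boldsymbol m}:\boldsymbol m\in L_h\}$. *)

theory Defs
  imports "HOL-Analysis.Analysis"
begin

section \<open>Iterated function systems and their attractors\<close>

definition contracting_similarity :: "('a::metric_space \<Rightarrow> 'a) \<Rightarrow> real \<Rightarrow> bool" where
  "contracting_similarity f \<rho> \<longleftrightarrow>
     0 < \<rho> \<and> \<rho> < 1 \<and> (\<forall>x y. dist (f x) (f y) = \<rho> * dist x y)"

definition is_attractor :: "nat \<Rightarrow> (nat \<Rightarrow> 'a::metric_space \<Rightarrow> 'a) \<Rightarrow> 'a set \<Rightarrow> bool" where
  "is_attractor M s \<Gamma> \<longleftrightarrow> \<Gamma> \<noteq> {} \<and> compact \<Gamma> \<and> \<Gamma> = (\<Union>m\<in>{1..M}. s m ` \<Gamma>)"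

text \<open>Words \<open>(m\<^sub>1,\<dots>,m\<^sub>l)\<close> are lists; the empty list plays the role of the index \<open>0\<close>,
  so that \<open>butlast\<close> is the map taking \<open>m\<close> to \<open>m_-\<close>.\<close>

fun word_map :: "(nat \<Rightarrow> 'a \<Rightarrow> 'a) \<Rightarrow> nat list \<Rightarrow> 'a \<Rightarrow> 'a" where
  "word_map s [] = id"
| "word_map s (m # w) = s m \<circ> word_map s w"

definition piece :: "(nat \<Rightarrow> 'a \<Rightarrow> 'a) \<Rightarrow> 'a set \<Rightarrow> nat list \<Rightarrow> 'a set" where
  "piece s \<Gamma> w = word_map s w ` \<Gamma>"


section \<open>Hausdorff measure and dimension\<close>

text \<open>The case distinction fixes the conventions \<open>0\<^sup>0 = 1\<close> for the diameter of a single point and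
  weight \<open>0\<close> for the empty set (note that \<open>0 powr 0 = 0\<close>). There is no normalising constant.\<close>

definition hausdorff_weight :: "real \<Rightarrow> 'a::metric_space set \<Rightarrow> real" where
  "hausdorff_weight d U = (if U = {} then 0 else if d = 0 then 1 else diameter U powr d)"

text \<open>Boundedness of the covering sets is explicit because \<open>diameter\<close> is real-valued and
  unspecified on unbounded sets.\<close>

definition hausdorff_pre :: "real \<Rightarrow> real \<Rightarrow> 'a::metric_space set \<Rightarrow> ennreal" where
  "hausdorff_pre d \<delta> A =
     (INF C \<in> {C :: nat \<Rightarrow> 'a set. A \<subseteq> (\<Union>i. C i) \<and> (\<forall>i. bounded (C i) \<and> diameter (C i) \<le> \<delta>)}.
        (\<Sum>i. ennreal (hausdorff_weight d (C i))))"

definition hausdorff_outer :: "real \<Rightarrow> 'a::metric_space set \<Rightarrow> ennreal" where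
  "hausdorff_outer d A = (SUP \<delta>\<in>{0<..}. hausdorff_pre d \<delta> A)"

text \<open>\<open>hausdorff_outer d\<close> is a metric outer measure for \<open>d \<ge> 0\<close>, hence countably additive on the
  Borel sets, so \<open>measure_of\<close> does not fall back to the null measure.\<close>

definition hausdorff_measure :: "real \<Rightarrow> 'a::metric_space measure" where
  "hausdorff_measure d = measure_of UNIV (sets borel) (hausdorff_outer d)"

definition hausdorff_dim :: "'a::metric_space set \<Rightarrow> real" where
  "hausdorff_dim A = Inf {d. 0 \<le> d \<and> hausdorff_outer d A = 0}"

definition hausdorff_on :: "'a::metric_space set \<Rightarrow> 'a measure" where
  "hausdorff_on \<Gamma> = restrict_space (hausdorff_measure (hausdorff_dim \<Gamma>)) \<Gamma>"


section \<open>Complex \<open>L\<^sub>2\<close> spaces\<close>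

text \<open>Elements are functions rather than equivalence classes; the norms, the convergence and the
  inner product are invariant under changes on null sets.\<close>

definition L2_space :: "'a measure \<Rightarrow> ('a \<Rightarrow> complex) set" where
  "L2_space \<mu> = {f \<in> borel_measurable \<mu>. integrable \<mu> (\<lambda>x. (cmod (f x))\<^sup>2)}"

definition L2_norm :: "'a measure \<Rightarrow> ('a \<Rightarrow> complex) \<Rightarrow> real" where
  "L2_norm \<mu> f = sqrt (LINT x|\<mu>. (cmod (f x))\<^sup>2)"

definition L2_inner :: "'a measure \<Rightarrow> ('a \<Rightarrow> complex) \<Rightarrow> ('a \<Rightarrow> complex) \<Rightarrow> complex" where
  "L2_inner \<mu> f g = (LINT x|\<mu>. f x * cnj (g x))"

definition L2_tendsto :: "'a measure \<Rightarrow> (nat \<Rightarrow> 'a \<Rightarrow> complex) \<Rightarrow> ('a \<Rightarrow> complex) \<Rightarrow> bool" where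
  "L2_tendsto \<mu> f g \<longleftrightarrow>
     (\<forall>k. f k \<in> L2_space \<mu>) \<and> g \<in> L2_space \<mu> \<and> (\<lambda>k. L2_norm \<mu> (\<lambda>x. f k x - g x)) \<longlonglongrightarrow> 0"


section \<open>Fourier transform and Sobolev spaces on the whole space\<close>

fun Ck_function :: "nat \<Rightarrow> ('a::euclidean_space \<Rightarrow> complex) \<Rightarrow> bool" where
  "Ck_function 0 f \<longleftrightarrow> continuous_on UNIV f"
| "Ck_function (Suc k) f \<longleftrightarrow>
     (\<forall>x. f differentiable (at x)) \<and> (\<forall>v. Ck_function k (\<lambda>x. frechet_derivative f (at x) v))"

definition test_function :: "('a::euclidean_space \<Rightarrow> complex) \<Rightarrow> bool" where
  "test_function \<phi> \<longleftrightarrow> (\<forall>k. Ck_function k \<phi>) \<and> compact (closure {x. \<phi> x \<noteq> 0})"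

definition fourier_L1 :: "('a::euclidean_space \<Rightarrow> complex) \<Rightarrow> 'a \<Rightarrow> complex" where
  "fourier_L1 \<phi> \<xi> = complex_of_real ((2 * pi) powr (- real DIM('a) / 2)) *
     (LINT x|lborel. cis (- (\<xi> \<bullet> x)) * \<phi> x)"

text \<open>The unitary Fourier transform on \<open>L\<^sub>2\<close>, by continuous extension from the intersection of
  \<open>L\<^sub>1\<close> and \<open>L\<^sub>2\<close>; \<open>g\<close> is determined by \<open>\<phi>\<close> up to a null set.\<close>

definition is_fourier_L2 :: "('a::euclidean_space \<Rightarrow> complex) \<Rightarrow> ('a \<Rightarrow> complex) \<Rightarrow> bool" where
  "is_fourier_L2 \<phi> g \<longleftrightarrow>
     (\<exists>f. (\<forall>k. integrable lborel (f k)) \<and> L2_tendsto lborel f \<phi> \<and>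
          L2_tendsto lborel (\<lambda>k. fourier_L1 (f k)) g)"

definition fourier_L2 :: "('a::euclidean_space \<Rightarrow> complex) \<Rightarrow> 'a \<Rightarrow> complex" where
  "fourier_L2 \<phi> = (SOME g. is_fourier_L2 \<phi> g)"

text \<open>Meant for \<open>s \<ge> 0\<close>, where the Sobolev space consists of \<open>L\<^sub>2\<close> functions.\<close>

definition sobolev_space :: "real \<Rightarrow> ('a::euclidean_space \<Rightarrow> complex) set" where
  "sobolev_space s = {\<phi> \<in> L2_space lborel.
     integrable lborel (\<lambda>\<xi>. (1 + (norm \<xi>)\<^sup>2) powr s * (cmod (fourier_L2 \<phi> \<xi>))\<^sup>2)}"

definition sobolev_norm :: "real \<Rightarrow> ('a::euclidean_space \<Rightarrow> complex) \<Rightarrow> real" where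
  "sobolev_norm s \<phi> =
     sqrt (LINT \<xi>|lborel. (1 + (norm \<xi>)\<^sup>2) powr s * (cmod (fourier_L2 \<phi> \<xi>))\<^sup>2)"


section \<open>Trace spaces on \<open>\<Gamma>\<close> and their duals\<close>

text \<open>\<open>is_trace \<Gamma> s \<phi> u\<close> says that \<open>u\<close> is the trace of \<open>\<phi>\<close>: the graph of the trace operator is the
  closure of the graph of restriction to \<open>\<Gamma>\<close> on test functions.\<close>

definition is_trace ::
    "'a::euclidean_space set \<Rightarrow> real \<Rightarrow> ('a \<Rightarrow> complex) \<Rightarrow> ('a \<Rightarrow> complex) \<Rightarrow> bool" where
  "is_trace \<Gamma> s \<phi> u \<longleftrightarrow> \<phi> \<in> sobolev_space s \<and>
     (\<exists>f. (\<forall>k. test_function (f k)) \<and>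
          (\<lambda>k. sobolev_norm s (\<lambda>x. f k x - \<phi> x)) \<longlonglongrightarrow> 0 \<and>
          L2_tendsto (hausdorff_on \<Gamma>) f u)"

definition ambient_order :: "'a::euclidean_space set \<Rightarrow> real \<Rightarrow> real" where
  "ambient_order \<Gamma> t = t + (real DIM('a) - hausdorff_dim \<Gamma>) / 2"

definition trace_space :: "'a::euclidean_space set \<Rightarrow> real \<Rightarrow> ('a \<Rightarrow> complex) set" where
  "trace_space \<Gamma> t = {f. \<exists>\<phi>. is_trace \<Gamma> (ambient_order \<Gamma> t) \<phi> f}"

definition trace_space_norm :: "'a::euclidean_space set \<Rightarrow> real \<Rightarrow> ('a \<Rightarrow> complex) \<Rightarrow> real" where
  "trace_space_norm \<Gamma> t f =
     Inf {sobolev_norm (ambient_order \<Gamma> t) \<phi> | \<phi>. is_trace \<Gamma> (ambient_order \<Gamma> t) \<phi> f}"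

text \<open>The operator norm of an antilinear functional \<open>F\<close> on the trace space of order \<open>t\<close>, with
  values in \<open>[0,\<infinity>]\<close>: it is finite iff \<open>F\<close> is continuous, i.e. belongs to the dual space.\<close>

definition dual_trace_norm ::
    "'a::euclidean_space set \<Rightarrow> real \<Rightarrow> (('a \<Rightarrow> complex) \<Rightarrow> complex) \<Rightarrow> ennreal" where
  "dual_trace_norm \<Gamma> t F =
     (SUP g \<in> {g \<in> trace_space \<Gamma> t. trace_space_norm \<Gamma> t g \<le> 1}. ennreal (cmod (F g)))"

definition L2_embedding ::
    "'a::euclidean_space set \<Rightarrow> ('a \<Rightarrow> complex) \<Rightarrow> ('a \<Rightarrow> complex) \<Rightarrow> complex" where
  "L2_embedding \<Gamma> f = (\<lambda>g. L2_inner (hausdorff_on \<Gamma>) f g)"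


section \<open>Piecewise constant approximation spaces\<close>

definition word_chi ::
    "(nat \<Rightarrow> 'a::metric_space \<Rightarrow> 'a) \<Rightarrow> 'a set \<Rightarrow> nat list \<Rightarrow> 'a \<Rightarrow> complex" where
  "word_chi s \<Gamma> w x = (if x \<in> piece s \<Gamma> w
     then complex_of_real (measure (hausdorff_on \<Gamma>) (piece s \<Gamma> w) powr (- 1 / 2)) else 0)"

definition mesh_words ::
    "nat \<Rightarrow> (nat \<Rightarrow> 'a::metric_space \<Rightarrow> 'a) \<Rightarrow> 'a set \<Rightarrow> real \<Rightarrow> nat list set" where
  "mesh_words M s \<Gamma> h = (if h = diameter \<Gamma> then {[]}
     else {w. w \<noteq> [] \<and> set w \<subseteq> {1..M} \<and>
              diameter (piece s \<Gamma> w) \<le> h \<and> h < diameter (piece s \<Gamma> (butlast w))})"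

definition approx_space ::
    "nat \<Rightarrow> (nat \<Rightarrow> 'a::metric_space \<Rightarrow> 'a) \<Rightarrow> 'a set \<Rightarrow> real \<Rightarrow> ('a \<Rightarrow> complex) set" where
  "approx_space M s \<Gamma> h = {\<psi>. \<exists>W c. finite W \<and> W \<subseteq> mesh_words M s \<Gamma> h \<and>
     \<psi> = (\<lambda>x. \<Sum>w\<in>W. c w * word_chi s \<Gamma> w x)}"

end

(* Proof idea. With x_w a point well inside the piece Gamma_w, a word w of the mesh h is tested by a
   smooth bump of radius r = kappa * h around x_w. Since dist (Gamma_w, Gamma - Gamma_w) is at least
   of order h, the bumps are disjoint and meet Gamma only inside their own pieces. For
   psi = sum_w c_w chi_w put g = sum_w c_w H^d(Gamma_w)^(-1/2) bump_w. Then (psi, g) is at least a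
   constant times ||psi||^2, because the bump exceeds a constant on a subpiece Gamma_wv with v fixed.
   Conversely, with s = t + (n-d)/2, the H^s norm of g is at most C h^(-t) ||psi||: the weight
   (1+|xi|^2)^s is dominated by C h^(-2s) (1 + sum_b (h xi_b)^(2K)) for an integer K >= s, so only
   the L_2 norms of g and of its pure K-th derivatives matter; these decouple by disjointness of
   supports, and H^d(Gamma_w) is of order h^d. Only the inequality ||F f|| <= ||f|| of Plancherel's
   theorem is needed; it follows from a Gaussian regularisation of the Fourier integral. *)

theory Submission
  imports Defs "HOL-Probability.Characteristic_Functions"
begin

section \<open>The Plancherel inequality\<close>

text \<open>A single constant has to serve all t in (0,J]. Therefore K is fixed as J + n before t is
  chosen, and the constant in the weight estimate depends on K but not on s; this is where the bound
  t \<le> J enters. The power of h is a balance of three effects: -2s from the weight, n from the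
  volume of a bump, and -d from the normalisation of chi_w. With 2s = 2t + n - d they add up to -2t.

  The centres are x_w = s_w(x_0) for one point x_0 of Gamma_v, so the share of Gamma_w on which its
  bump is large is the same for all words and all h, by the scaling of the Hausdorff measure under
  similarities.

  The L_2 Fourier transform, and with it every Sobolev norm, is given by an arbitrary choice among
  admissible limits. The Plancherel inequality has a second task here: it shows that for integrable
  L_2 functions the choice agrees almost everywhere with the Fourier integral, which makes the norms
  computable.\<close>

lemma measurable_cis_inner [measurable]:
  assumes [measurable]: "f \<in> borel_measurable M" "g \<in> borel_measurable M"
  shows "(\<lambda>x. cis (- (f x \<bullet> (g x :: 'a::euclidean_space)))) \<in> borel_measurable M"
proof -
  have "cis \<in> borel_measurable borel"
    by (intro borel_measurable_continuous_onI continuous_intros)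
  then show ?thesis by measurable
qed

section \<open>Fourier integrals of Gaussians\<close>

lemma
  fixes f :: "'a::euclidean_space \<Rightarrow> real \<Rightarrow> complex"
  assumes f: "\<And>b. b \<in> Basis \<Longrightarrow> integrable lborel (f b)"
  shows integrable_lborel_prod: "integrable lborel (\<lambda>x::'a. \<Prod>b\<in>Basis. f b (x \<bullet> b))"
    and integral_lborel_prod:
      "(LINT x|lborel. (\<Prod>b\<in>Basis. f b (x \<bullet> b))) = (\<Prod>b\<in>Basis. LINT x|lborel. f b x)"
proof -
  interpret product_sigma_finite "\<lambda>_::'a. lborel :: real measure" ..
  have [measurable]: "b \<in> Basis \<Longrightarrow> f b \<in> borel_measurable borel" for b
    using f[of b] by auto
  have eq: "(\<Prod>b\<in>Basis. f b ((\<Sum>b\<in>Basis. x b *\<^sub>R b) \<bullet> b)) = (\<Prod>b\<in>Basis. f b (x b))" for x :: "'a \<Rightarrow> real"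
    by (intro prod.cong) auto
  have *: "integrable (\<Pi>\<^sub>M b\<in>(Basis::'a set). lborel) (\<lambda>x. \<Prod>b\<in>Basis. f b (x b))"
    by (intro product_integrable_prod f) auto
  show "integrable lborel (\<lambda>x::'a. \<Prod>b\<in>Basis. f b (x \<bullet> b))"
    by (subst lborel_eq, subst integrable_distr_eq) (use * in \<open>simp_all add: eq\<close>)
  show "(LINT x|lborel. (\<Prod>b\<in>Basis. f b (x \<bullet> b))) = (\<Prod>b\<in>Basis. LINT x|lborel. f b x)"
    by (subst lborel_eq, subst integral_distr)
       (use product_integral_prod[OF _ f] in \<open>simp_all add: eq\<close>)
qed

text \<open>The substitution u = \<epsilon> x turns the integral into the characteristic function of
  the standard normal distribution at - a / \<epsilon>. The value, sqrt (2 pi) / \<epsilon> times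
  exp (- a^2 / (2 \<epsilon>^2)), is written as a multiple of a normal density so that its total
  mass 2 pi is visibly independent of \<epsilon>.\<close>

lemma
  assumes e: "0 < \<epsilon>"
  shows integrable_gaussian_cis:
      "integrable lborel (\<lambda>x. cis (- (x * a)) * complex_of_real (exp (- (\<epsilon> * x)\<^sup>2 / 2)))"
    and integral_gaussian_cis:
      "(LINT x|lborel. cis (- (x * a)) * complex_of_real (exp (- (\<epsilon> * x)\<^sup>2 / 2)))
         = complex_of_real (2 * pi * normal_density 0 \<epsilon> a)"
proof -
  let ?g = "\<lambda>x. cis (- (x * a)) * complex_of_real (exp (- (\<epsilon> * x)\<^sup>2 / 2))"
  let ?h = "\<lambda>u. std_normal_density u *\<^sub>R iexp ((- a / \<epsilon>) * u)"
  have h: "integrable lborel ?h"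
  proof (rule Bochner_Integration.integrable_bound[OF integrable_std_normal_moment[of 0]])
    show "?h \<in> borel_measurable lborel" by measurable
  qed (auto simp: norm_mult)
  have "(CLINT u|std_normal_distribution. iexp ((- a / \<epsilon>) * u)) = exp (- (- a / \<epsilon>)\<^sup>2 / 2)"
    using fun_cong[OF char_std_normal_distribution, of "- a / \<epsilon>"] unfolding char_def .
  then have hv: "(LINT u|lborel. ?h u) = complex_of_real (exp (- (a / \<epsilon>)\<^sup>2 / 2))"
    by (subst (asm) integral_density) auto
  have gh: "?g x = sqrt (2 * pi) *\<^sub>R ?h (0 + \<epsilon> * x)" for x
    using e by (simp add: std_normal_density_def cis_conv_exp scaleR_conv_of_real exp_minus divide_simps mult_ac)
  show "integrable lborel ?g"
    unfolding gh using e by (intro integrable_scaleR_right lborel_integrable_real_affine h) auto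
  have "(LINT x|lborel. ?g x) = sqrt (2 * pi) *\<^sub>R (LINT x|lborel. ?h (0 + \<epsilon> * x))"
    unfolding gh by (rule integral_scaleR_right)
  also have "(LINT x|lborel. ?h (0 + \<epsilon> * x)) = (LINT u|lborel. ?h u) /\<^sub>R \<epsilon>"
    using e by (subst lborel_integral_real_affine[of \<epsilon> ?h 0]) auto
  finally show "(LINT x|lborel. ?g x) = complex_of_real (2 * pi * normal_density 0 \<epsilon> a)"
    unfolding hv using e
    by (simp add: normal_density_def real_sqrt_mult scaleR_conv_of_real power_divide field_simps
             flip: of_real_mult of_real_divide)
qed

text \<open>This is exp (- \<epsilon>^2 |x|^2 / 2), kept as a product over the coordinates so that
  its Fourier integral factorises. It tends to 1 pointwise as \<epsilon> tends to 0.\<close>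

definition gaussian :: "real \<Rightarrow> 'a::euclidean_space \<Rightarrow> real" where
  "gaussian \<epsilon> x = (\<Prod>b\<in>Basis. exp (- (\<epsilon> * (x \<bullet> b))\<^sup>2 / 2))"

text \<open>For \<epsilon> > 0, the unnormalised Fourier transform of \<open>gaussian\<close>: a
  nonnegative kernel that concentrates at 0 as \<epsilon> tends to 0 while its mass stays
  fixed.\<close>

definition gaussian_hat :: "real \<Rightarrow> 'a::euclidean_space \<Rightarrow> real" where
  "gaussian_hat \<epsilon> x = (\<Prod>b\<in>Basis. 2 * pi * normal_density 0 \<epsilon> (x \<bullet> b))"

lemma measurable_gaussian [measurable]: "gaussian \<epsilon> \<in> borel_measurable borel"
  and measurable_gaussian_hat [measurable]: "gaussian_hat \<epsilon> \<in> borel_measurable borel"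
  unfolding gaussian_def gaussian_hat_def by measurable

lemma gaussian_nonneg [simp]: "0 \<le> gaussian \<epsilon> x"
  and gaussian_hat_nonneg [simp]: "0 \<le> gaussian_hat \<epsilon> x"
  unfolding gaussian_def gaussian_hat_def by (auto intro!: prod_nonneg)

lemma cis_inner_prod:
  fixes x \<xi> :: "'a::euclidean_space"
  shows "cis (- (\<xi> \<bullet> x)) = (\<Prod>b\<in>Basis. cis (- ((\<xi> \<bullet> b) * (x \<bullet> b))))"
  by (subst euclidean_inner) (simp add: cis_conv_exp exp_sum[symmetric] sum_negf sum_distrib_left)

lemma
  assumes e: "0 < \<epsilon>"
  shows integrable_cis_gaussian:
      "integrable lborel (\<lambda>\<xi>::'a::euclidean_space. cis (- (\<xi> \<bullet> x)) * complex_of_real (gaussian \<epsilon> \<xi>))"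
    and integral_cis_gaussian:
      "(LINT \<xi>|lborel. cis (- (\<xi> \<bullet> x)) * complex_of_real (gaussian \<epsilon> (\<xi>::'a)))
         = complex_of_real (gaussian_hat \<epsilon> x)"
proof -
  have eq: "cis (- (\<xi> \<bullet> x)) * complex_of_real (gaussian \<epsilon> \<xi>) =
    (\<Prod>b\<in>Basis. cis (- ((\<xi> \<bullet> b) * (x \<bullet> b))) * complex_of_real (exp (- (\<epsilon> * (\<xi> \<bullet> b))\<^sup>2 / 2)))" for \<xi>
    by (simp add: gaussian_def cis_inner_prod prod.distrib)
  show "integrable lborel (\<lambda>\<xi>::'a. cis (- (\<xi> \<bullet> x)) * complex_of_real (gaussian \<epsilon> \<xi>))"
    unfolding eq by (intro integrable_lborel_prod integrable_gaussian_cis e)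
  show "(LINT \<xi>|lborel. cis (- (\<xi> \<bullet> x)) * complex_of_real (gaussian \<epsilon> (\<xi>::'a)))
         = complex_of_real (gaussian_hat \<epsilon> x)"
    unfolding eq gaussian_hat_def of_real_prod
    by (subst integral_lborel_prod, intro integrable_gaussian_cis e)
       (intro prod.cong refl integral_gaussian_cis e)
qed

lemma integrable_gaussian:
  assumes e: "0 < \<epsilon>"
  shows "integrable lborel (gaussian \<epsilon> :: 'a::euclidean_space \<Rightarrow> real)"
proof -
  have "integrable lborel (\<lambda>\<xi>::'a. complex_of_real (gaussian \<epsilon> \<xi>))"
    using integrable_cis_gaussian[OF e, of "0::'a"] by simp
  then show ?thesis using integrable_Re by fastforce
qed

lemma nn_integral_gaussian_hat:
  assumes e: "0 < \<epsilon>"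
  shows "(\<integral>\<^sup>+x. gaussian_hat \<epsilon> (x - (y::'a::euclidean_space)) \<partial>lborel) = ennreal ((2 * pi) ^ DIM('a))"
proof -
  have 1: "(\<integral>\<^sup>+x. ennreal (2 * pi * normal_density 0 \<epsilon> (x - c)) \<partial>lborel) = 2 * pi" for c
  proof -
    have "(\<integral>\<^sup>+x. ennreal (2 * pi * normal_density 0 \<epsilon> (x - c)) \<partial>lborel)
        = (\<integral>\<^sup>+x. ennreal (2 * pi * normal_density c \<epsilon> x) \<partial>lborel)"
      by (simp add: normal_density_def)
    also have "\<dots> = ennreal (LINT x|lborel. 2 * pi * normal_density c \<epsilon> x)"
      using e by (intro nn_integral_eq_integral integrable_mult_right integrable_normal_density) auto
    also have "\<dots> = 2 * pi"
      using e integral_normal_density[of \<epsilon> c] by simp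
    finally show ?thesis .
  qed
  have "(\<integral>\<^sup>+x. gaussian_hat \<epsilon> (x - y) \<partial>lborel)
      = (\<integral>\<^sup>+x. (\<Prod>b\<in>Basis. ennreal (2 * pi * normal_density 0 \<epsilon> (x \<bullet> b - y \<bullet> b))) \<partial>lborel)"
    by (simp add: gaussian_hat_def inner_diff_left prod_ennreal)
  also have "\<dots> = (\<Prod>b\<in>(Basis::'a set). (\<integral>\<^sup>+x. ennreal (2 * pi * normal_density 0 \<epsilon> (x - y \<bullet> b)) \<partial>lborel))"
    by (rule nn_integral_lborel_prod[of "\<lambda>b x. ennreal (2 * pi * normal_density 0 \<epsilon> (x - y \<bullet> b))"]) auto
  also have "\<dots> = ennreal ((2 * pi) ^ DIM('a))"
    unfolding 1 by (simp add: ennreal_power)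
  finally show ?thesis .
qed

section \<open>Gaussian regularisation and the passage to the limit\<close>

definition fourier_raw :: "('a::euclidean_space \<Rightarrow> complex) \<Rightarrow> 'a \<Rightarrow> complex" where
  "fourier_raw f \<xi> = (LINT x|lborel. cis (- (\<xi> \<bullet> x)) * f x)"

lemma measurable_fourier_raw [measurable]:
  assumes [measurable]: "f \<in> borel_measurable borel"
  shows "fourier_raw f \<in> borel_measurable borel"
  unfolding fourier_raw_def by measurable

lemma integrable_cis_mult:
  assumes f: "integrable lborel f"
  shows "integrable lborel (\<lambda>x. cis (- (\<xi> \<bullet> x)) * f x)"
proof (rule Bochner_Integration.integrable_bound[OF f])
  have [measurable]: "f \<in> borel_measurable borel" using f by auto
  show "(\<lambda>x. cis (- (\<xi> \<bullet> x)) * f x) \<in> borel_measurable lborel" by measurable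
qed (auto simp: norm_mult)

lemma integrable_tensor:
  fixes f :: "'a::euclidean_space \<Rightarrow> complex" and g :: "'b::euclidean_space \<Rightarrow> complex"
  assumes f: "integrable lborel f" and g: "integrable lborel g"
  shows "integrable (lborel \<Otimes>\<^sub>M lborel) (\<lambda>p. f (fst p) * g (snd p))"
proof (rule lborel_pair.Fubini_integrable)
  have [measurable]: "f \<in> borel_measurable borel" "g \<in> borel_measurable borel"
    using f g by auto
  show "(\<lambda>p. f (fst p) * g (snd p)) \<in> borel_measurable (lborel \<Otimes>\<^sub>M lborel)"
    by measurable
  show "integrable lborel (\<lambda>x. LINT y|lborel. cmod (f (fst (x, y)) * g (snd (x, y))))"
    using f by (simp add: norm_mult)
qed (use g in simp)

text \<open>Multiplying the integral by its conjugate leaves \<xi> in one exponential of the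
  difference \<open>fst p - snd p\<close>, ready to be integrated out against a Gaussian.\<close>

lemma fourier_raw_mult_cnj:
  assumes f: "integrable lborel f"
  shows "complex_of_real ((cmod (fourier_raw f \<xi>))\<^sup>2) =
    (LINT p|lborel. cis (- (\<xi> \<bullet> (fst p - snd p))) * (f (fst p) * cnj (f (snd p))))"
proof -
  let ?g = "\<lambda>x. cis (- (\<xi> \<bullet> x)) * f x"
  have g: "integrable lborel ?g" by (rule integrable_cis_mult[OF f])
  have cg: "integrable lborel (\<lambda>x. cnj (?g x))" using g by (rule integrable_cnj)
  have "complex_of_real ((cmod (fourier_raw f \<xi>))\<^sup>2) = fourier_raw f \<xi> * cnj (fourier_raw f \<xi>)"
    by (rule complex_norm_square)
  also have "\<dots> = (LINT x|lborel. LINT y|lborel. ?g (fst (x,y)) * cnj (?g (snd (x,y))))"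
    using g cg unfolding fourier_raw_def by (simp add: integral_cnj[symmetric] del: complex_cnj_mult)
  also have "\<dots> = (LINT p|(lborel \<Otimes>\<^sub>M lborel). ?g (fst p) * cnj (?g (snd p)))"
    by (rule lborel_pair.integral_fst') (rule integrable_tensor[OF g cg])
  also have "\<dots> = (LINT p|lborel. cis (- (\<xi> \<bullet> (fst p - snd p))) * (f (fst p) * cnj (f (snd p))))"
  proof (unfold lborel_prod, intro Bochner_Integration.integral_cong refl)
    fix p :: "'a \<times> 'a"
    have "cis (- (\<xi> \<bullet> (fst p - snd p))) = cis (- (\<xi> \<bullet> fst p)) * cnj (cis (- (\<xi> \<bullet> snd p)))"
      by (simp add: cis_cnj cis_mult inner_diff_right)
    then show "?g (fst p) * cnj (?g (snd p)) = cis (- (\<xi> \<bullet> (fst p - snd p))) * (f (fst p) * cnj (f (snd p)))"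
      by (simp only: complex_cnj_mult mult_ac)
  qed
  finally show ?thesis .
qed

text \<open>The factor \<open>gaussian\<close> makes the integrand absolutely integrable jointly in
  \<xi> and p; without it the modulus would be constant in \<xi>. Fubini then allows the
  \<xi>-integral to be evaluated, which leaves the kernel \<open>gaussian_hat\<close>.\<close>

lemma
  assumes f: "integrable lborel (f :: 'a::euclidean_space \<Rightarrow> complex)" and e: "0 < \<epsilon>"
  shows integrable_gaussian_fourier_raw:
      "integrable lborel (\<lambda>\<xi>. gaussian \<epsilon> \<xi> * (cmod (fourier_raw f \<xi>))\<^sup>2)"
    and integral_gaussian_fourier_raw:
      "complex_of_real (LINT \<xi>|lborel. gaussian \<epsilon> \<xi> * (cmod (fourier_raw f \<xi>))\<^sup>2)
         = (LINT p|lborel. f (fst p) * cnj (f (snd p)) * complex_of_real (gaussian_hat \<epsilon> (fst p - snd p)))"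
proof -
  let ?F = "\<lambda>p::'a\<times>'a. f (fst p) * cnj (f (snd p))"
  let ?k = "\<lambda>\<xi>. complex_of_real (gaussian \<epsilon> (\<xi>::'a))"
  let ?G = "\<lambda>\<xi> p. ?k \<xi> * (cis (- (\<xi> \<bullet> (fst p - snd p))) * ?F p)"
  have [measurable]: "f \<in> borel_measurable borel" using f by auto
  have [measurable]: "(\<lambda>x. cnj (f x)) \<in> borel_measurable borel"
    using borel_measurable_integrable[OF integrable_cnj[OF f]] by simp
  have F: "integrable lborel ?F"
    using integrable_tensor[OF f integrable_cnj[OF f]] by (simp add: lborel_prod)
  have FG: "integrable (lborel \<Otimes>\<^sub>M lborel) (\<lambda>q. ?k (fst q) * ?F (snd q))"
    by (rule integrable_tensor[OF integrable_of_real[OF integrable_gaussian[OF e]] F])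
  have G: "integrable (lborel \<Otimes>\<^sub>M lborel) (case_prod ?G)"
  proof (rule Bochner_Integration.integrable_bound[OF FG])
    show "case_prod ?G \<in> borel_measurable (lborel \<Otimes>\<^sub>M lborel)"
      unfolding lborel_prod[symmetric, where 'a='a and 'b='a] by measurable
  qed (auto simp: norm_mult)
  have inner: "(LINT p|lborel. ?G \<xi> p) = complex_of_real (gaussian \<epsilon> \<xi> * (cmod (fourier_raw f \<xi>))\<^sup>2)" for \<xi>
    unfolding of_real_mult fourier_raw_mult_cnj[OF f] by (rule integral_mult_right_zero)
  have "integrable lborel (\<lambda>\<xi>. complex_of_real (gaussian \<epsilon> \<xi> * (cmod (fourier_raw f \<xi>))\<^sup>2))"
    using lborel_pair.integrable_fst'[OF G] unfolding inner[symmetric] by simp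
  then show "integrable lborel (\<lambda>\<xi>. gaussian \<epsilon> \<xi> * (cmod (fourier_raw f \<xi>))\<^sup>2)"
    using integrable_Re by fastforce
  have "complex_of_real (LINT \<xi>|lborel. gaussian \<epsilon> \<xi> * (cmod (fourier_raw f \<xi>))\<^sup>2)
      = (LINT \<xi>|lborel. LINT p|lborel. ?G \<xi> p)"
    unfolding inner by (rule integral_complex_of_real[symmetric])
  also have "\<dots> = (LINT p|lborel. LINT \<xi>|lborel. ?G \<xi> p)"
    by (rule lborel_pair.Fubini_integral[OF G, symmetric])
  also have "\<dots> = (LINT p|lborel. ?F p * complex_of_real (gaussian_hat \<epsilon> (fst p - snd p)))"
  proof (intro Bochner_Integration.integral_cong refl)
    fix p
    have "(LINT \<xi>|lborel. ?G \<xi> p) = (LINT \<xi>|lborel. ?F p * (cis (- (\<xi> \<bullet> (fst p - snd p))) * ?k \<xi>))"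
      by (simp add: mult_ac)
    also have "\<dots> = ?F p * complex_of_real (gaussian_hat \<epsilon> (fst p - snd p))"
      by (simp only: integral_mult_right_zero integral_cis_gaussian[OF e])
    finally show "(LINT \<xi>|lborel. ?G \<xi> p) = ?F p * complex_of_real (gaussian_hat \<epsilon> (fst p - snd p))" .
  qed
  finally show "complex_of_real (LINT \<xi>|lborel. gaussian \<epsilon> \<xi> * (cmod (fourier_raw f \<xi>))\<^sup>2)
         = (LINT p|lborel. ?F p * complex_of_real (gaussian_hat \<epsilon> (fst p - snd p)))" .
qed

text \<open>A Schur test for a convolution kernel: |f x| |f y| is at most half the sum of the two
  squares, and in each half the kernel integrates to (2 pi)^n in the remaining variable. The bound
  does not depend on \<epsilon>.\<close>

lemma nn_integral_tensor_gaussian_hat_le: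
  fixes f :: "'a::euclidean_space \<Rightarrow> complex"
  assumes [measurable]: "f \<in> borel_measurable borel" and e: "0 < \<epsilon>"
  shows "(\<integral>\<^sup>+p. ennreal (cmod (f (fst p) * cnj (f (snd p)) * complex_of_real (gaussian_hat \<epsilon> (fst p - snd p)))) \<partial>lborel)
    \<le> ennreal ((2 * pi) ^ DIM('a)) * (\<integral>\<^sup>+x. ennreal ((cmod (f x))\<^sup>2) \<partial>lborel)" (is "?L \<le> ?R")
proof -
  let ?g = "\<lambda>p. gaussian_hat \<epsilon> (fst p - snd p :: 'a)"
  let ?A = "\<lambda>p::'a\<times>'a. ennreal ((cmod (f (fst p)))\<^sup>2 / 2) * ennreal (?g p)"
  let ?B = "\<lambda>p::'a\<times>'a. ennreal ((cmod (f (snd p)))\<^sup>2 / 2) * ennreal (?g p)"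
  have sym: "gaussian_hat \<epsilon> (x - y) = gaussian_hat \<epsilon> (y - x :: 'a)" for x y
    by (simp add: gaussian_hat_def normal_density_def inner_diff_left power2_commute)
  have hat: "(\<integral>\<^sup>+y. gaussian_hat \<epsilon> (x - y) \<partial>lborel) = ennreal ((2 * pi) ^ DIM('a))" for x :: 'a
    unfolding sym[of x] by (rule nn_integral_gaussian_hat[OF e])
  have "?L \<le> (\<integral>\<^sup>+p. ?A p + ?B p \<partial>lborel)"
  proof (intro nn_integral_mono)
    fix p :: "'a \<times> 'a"
    have "cmod (f (fst p)) * cmod (f (snd p)) \<le> (cmod (f (fst p)))\<^sup>2 / 2 + (cmod (f (snd p)))\<^sup>2 / 2"
      using sum_squares_bound[of "cmod (f (fst p))" "cmod (f (snd p))"] by simp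
    then have "cmod (f (fst p)) * cmod (f (snd p)) * ?g p \<le> ((cmod (f (fst p)))\<^sup>2 / 2 + (cmod (f (snd p)))\<^sup>2 / 2) * ?g p"
      by (intro mult_right_mono) auto
    then show "ennreal (cmod (f (fst p) * cnj (f (snd p)) * complex_of_real (?g p))) \<le> ?A p + ?B p"
      by (simp add: norm_mult ennreal_mult'[symmetric] ennreal_plus[symmetric] ring_distribs del: ennreal_plus)
  qed
  also have "\<dots> = (\<integral>\<^sup>+p. ?A p \<partial>lborel) + (\<integral>\<^sup>+p. ?B p \<partial>lborel)"
    unfolding lborel_prod[symmetric] by (intro nn_integral_add) measurable
  also have "(\<integral>\<^sup>+p. ?A p \<partial>lborel) = (\<integral>\<^sup>+x. \<integral>\<^sup>+y. ?A (x, y) \<partial>lborel \<partial>lborel)"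
    unfolding lborel_prod[symmetric] by (rule lborel.nn_integral_fst[symmetric]) measurable
  also have "\<dots> = (\<integral>\<^sup>+x. ennreal ((cmod (f x))\<^sup>2 / 2) * ennreal ((2 * pi) ^ DIM('a)) \<partial>lborel)"
    by (intro nn_integral_cong) (simp add: nn_integral_cmult hat)
  also have "(\<integral>\<^sup>+p. ?B p \<partial>lborel) = (\<integral>\<^sup>+y. \<integral>\<^sup>+x. ?B (x, y) \<partial>lborel \<partial>lborel)"
    unfolding lborel_prod[symmetric] by (rule lborel_pair.nn_integral_snd[symmetric]) measurable
  also have "\<dots> = (\<integral>\<^sup>+x. ennreal ((cmod (f x))\<^sup>2 / 2) * ennreal ((2 * pi) ^ DIM('a)) \<partial>lborel)"
    by (intro nn_integral_cong) (simp add: nn_integral_cmult nn_integral_gaussian_hat[OF e])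
  also have "\<dots> + \<dots> = (\<integral>\<^sup>+x. ennreal ((2 * pi) ^ DIM('a)) * ennreal ((cmod (f x))\<^sup>2) \<partial>lborel)"
    by (subst nn_integral_add[symmetric]) (auto intro!: nn_integral_cong simp: ennreal_mult'[symmetric] ennreal_plus[symmetric] simp del: ennreal_plus)
  also have "\<dots> = ?R" by (rule nn_integral_cmult) simp
  finally show ?thesis .
qed

text \<open>Fatou's lemma along \<epsilon> = 1 / (n + 1): the Gaussian factors tend to 1 pointwise,
  while the bound on the regularised integrals is uniform in \<epsilon>.\<close>

lemma nn_integral_fourier_raw_le:
  assumes f: "integrable lborel (f :: 'a::euclidean_space \<Rightarrow> complex)"
  shows "(\<integral>\<^sup>+\<xi>. ennreal ((cmod (fourier_raw f \<xi>))\<^sup>2) \<partial>lborel)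
    \<le> ennreal ((2 * pi) ^ DIM('a)) * (\<integral>\<^sup>+x. ennreal ((cmod (f x))\<^sup>2) \<partial>lborel)" (is "_ \<le> ?R")
proof -
  have [measurable]: "f \<in> borel_measurable borel" using f by auto
  define e where "e n = inverse (real (Suc n))" for n
  have e: "0 < e n" for n by (simp add: e_def)
  let ?u = "\<lambda>n \<xi>. ennreal (gaussian (e n) \<xi> * (cmod (fourier_raw f \<xi>))\<^sup>2)"
  have bound: "(\<integral>\<^sup>+\<xi>. ?u n \<xi> \<partial>lborel) \<le> ?R" for n
  proof -
    let ?H = "\<lambda>p. f (fst p) * cnj (f (snd p)) * complex_of_real (gaussian_hat (e n) (fst p - snd p))"
    have "(\<integral>\<^sup>+\<xi>. ?u n \<xi> \<partial>lborel) = ennreal (LINT \<xi>|lborel. gaussian (e n) \<xi> * (cmod (fourier_raw f \<xi>))\<^sup>2)"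
      by (intro nn_integral_eq_integral integrable_gaussian_fourier_raw f e) simp
    also have "\<dots> = ennreal (cmod (complex_of_real (LINT \<xi>|lborel. gaussian (e n) \<xi> * (cmod (fourier_raw f \<xi>))\<^sup>2)))"
      by (simp add: integral_nonneg_AE)
    also have "\<dots> = ennreal (cmod (LINT p|lborel. ?H p))"
      unfolding integral_gaussian_fourier_raw[OF f e] ..
    also have "\<dots> \<le> (\<integral>\<^sup>+p. ennreal (cmod (?H p)) \<partial>lborel)"
    \<comment> \<open>If \<open>?H\<close> is not integrable, its Bochner integral is 0 by
      convention and the bound is trivial.\<close>
    proof (cases "integrable lborel ?H")
      case True
      then show ?thesis by (rule integral_norm_bound_ennreal)
    qed (simp add: not_integrable_integral_eq)
    also have "\<dots> \<le> ?R"
      by (rule nn_integral_tensor_gaussian_hat_le) (auto intro: e)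
    finally show ?thesis .
  qed
  have lim: "(\<lambda>n. ?u n \<xi>) \<longlonglongrightarrow> ennreal ((cmod (fourier_raw f \<xi>))\<^sup>2)" for \<xi>
  proof -
    have "(\<lambda>n. gaussian (e n) \<xi> * (cmod (fourier_raw f \<xi>))\<^sup>2)
        \<longlonglongrightarrow> (\<Prod>b\<in>(Basis::'a set). exp (- (0 * (\<xi> \<bullet> b))\<^sup>2 / 2)) * (cmod (fourier_raw f \<xi>))\<^sup>2"
      unfolding gaussian_def e_def by (intro tendsto_intros LIMSEQ_inverse_real_of_nat) auto
    then show ?thesis by (intro tendsto_ennrealI) simp
  qed
  have "(\<integral>\<^sup>+\<xi>. ennreal ((cmod (fourier_raw f \<xi>))\<^sup>2) \<partial>lborel) = (\<integral>\<^sup>+\<xi>. liminf (\<lambda>n. ?u n \<xi>) \<partial>lborel)"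
    by (intro nn_integral_cong lim_imp_Liminf[OF _ lim, symmetric]) simp
  also have "\<dots> \<le> liminf (\<lambda>n. \<integral>\<^sup>+\<xi>. ?u n \<xi> \<partial>lborel)"
    by (rule nn_integral_liminf) measurable
  also have "\<dots> \<le> liminf (\<lambda>n::nat. ?R)"
    by (intro Liminf_mono always_eventually allI bound)
  also have "\<dots> = ?R" by (simp add: Liminf_const)
  finally show ?thesis .
qed

lemma fourier_L1_eq_raw:
  "fourier_L1 f \<xi> = complex_of_real ((2 * pi) powr (- real DIM('a) / 2)) * fourier_raw f (\<xi>::'a::euclidean_space)"
  by (simp add: fourier_L1_def fourier_raw_def)

lemma nn_integral_fourier_L1_le:
  assumes f: "integrable lborel (f :: 'a::euclidean_space \<Rightarrow> complex)"
  shows "(\<integral>\<^sup>+\<xi>. ennreal ((cmod (fourier_L1 f \<xi>))\<^sup>2) \<partial>lborel) \<le> (\<integral>\<^sup>+x. ennreal ((cmod (f x))\<^sup>2) \<partial>lborel)"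
proof -
  have [measurable]: "f \<in> borel_measurable borel" using f by auto
  let ?c = "((2 * pi) powr (- real DIM('a) / 2))\<^sup>2"
  have c: "?c * (2 * pi) ^ DIM('a) = 1"
  proof -
    have "?c = (2 * pi) powr (- real DIM('a))" by (simp add: powr_power)
    also have "\<dots> = inverse ((2 * pi) ^ DIM('a))" by (simp add: powr_minus powr_realpow)
    finally have "?c = inverse ((2 * pi) ^ DIM('a))" .
    then show ?thesis by (metis left_inverse power_not_zero mult_eq_0_iff pi_neq_zero zero_neq_numeral)
  qed
  have "(\<integral>\<^sup>+\<xi>. ennreal ((cmod (fourier_L1 f \<xi>))\<^sup>2) \<partial>lborel)
      = (\<integral>\<^sup>+\<xi>. ennreal ?c * ennreal ((cmod (fourier_raw f \<xi>))\<^sup>2) \<partial>lborel)"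
    by (intro nn_integral_cong) (simp add: fourier_L1_eq_raw norm_mult power_mult_distrib ennreal_mult')
  also have "\<dots> = ennreal ?c * (\<integral>\<^sup>+\<xi>. ennreal ((cmod (fourier_raw f \<xi>))\<^sup>2) \<partial>lborel)"
    by (intro nn_integral_cmult) measurable
  also have "\<dots> \<le> ennreal ?c * (ennreal ((2 * pi) ^ DIM('a)) * (\<integral>\<^sup>+x. ennreal ((cmod (f x))\<^sup>2) \<partial>lborel))"
    by (intro mult_left_mono nn_integral_fourier_raw_le f) simp
  also have "\<dots> = (\<integral>\<^sup>+x. ennreal ((cmod (f x))\<^sup>2) \<partial>lborel)"
    using c by (simp add: mult.assoc[symmetric] ennreal_mult'[symmetric] del: ennreal_power)
  finally show ?thesis .
qed

lemma L2_space_integral_fourier_L1: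
  assumes f: "integrable lborel (f :: 'a::euclidean_space \<Rightarrow> complex)" and f2: "f \<in> L2_space lborel"
  shows "fourier_L1 f \<in> L2_space lborel"
    and "(LINT \<xi>|lborel. (cmod (fourier_L1 f \<xi>))\<^sup>2) \<le> (LINT x|lborel. (cmod (f x))\<^sup>2)"
proof -
  have [measurable]: "f \<in> borel_measurable borel" using f by auto
  have fi: "integrable lborel (\<lambda>x. (cmod (f x))\<^sup>2)" using f2 by (simp add: L2_space_def)
  have m [measurable]: "fourier_L1 f \<in> borel_measurable lborel"
    unfolding fourier_L1_eq_raw[abs_def] by measurable
  have le: "(\<integral>\<^sup>+\<xi>. ennreal ((cmod (fourier_L1 f \<xi>))\<^sup>2) \<partial>lborel) \<le> ennreal (LINT x|lborel. (cmod (f x))\<^sup>2)"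
    using nn_integral_fourier_L1_le[OF f] nn_integral_eq_integral[OF fi] by simp
  have i: "integrable lborel (\<lambda>\<xi>. (cmod (fourier_L1 f \<xi>))\<^sup>2)"
    by (rule integrableI_bounded) (use le in \<open>auto intro: le_less_trans\<close>)
  show "fourier_L1 f \<in> L2_space lborel"
    using m i by (simp add: L2_space_def)
  have "ennreal (LINT \<xi>|lborel. (cmod (fourier_L1 f \<xi>))\<^sup>2) \<le> ennreal (LINT x|lborel. (cmod (f x))\<^sup>2)"
    using le nn_integral_eq_integral[OF i] by simp
  then show "(LINT \<xi>|lborel. (cmod (fourier_L1 f \<xi>))\<^sup>2) \<le> (LINT x|lborel. (cmod (f x))\<^sup>2)"
    by (simp add: ennreal_le_iff integral_nonneg_AE)
qed

section \<open>The Fourier transform on \<open>L\<^sub>2\<close>\<close>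

text \<open>A pointwise substitute for Minkowski's inequality; the factor 2 does no harm where only
  finiteness or convergence to 0 matters.\<close>

lemma cmod_add_power2_le: "(cmod (x + y))\<^sup>2 \<le> 2 * (cmod x)\<^sup>2 + 2 * (cmod y)\<^sup>2"
proof -
  have "(cmod (x + y))\<^sup>2 \<le> (cmod x + cmod y)\<^sup>2"
    by (intro power_mono norm_triangle_ineq) simp
  also have "\<dots> \<le> 2 * (cmod x)\<^sup>2 + 2 * (cmod y)\<^sup>2"
    using sum_squares_bound[of "cmod x" "cmod y"] by (simp add: power2_sum)
  finally show ?thesis .
qed

lemma cmod_diff_power2_le: "(cmod (x - y))\<^sup>2 \<le> 2 * (cmod x)\<^sup>2 + 2 * (cmod y)\<^sup>2"
  using cmod_add_power2_le[of x "- y"] by simp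

lemma L2_space_diff:
  assumes f: "f \<in> L2_space \<mu>" and g: "g \<in> L2_space \<mu>"
  shows "(\<lambda>x. f x - g x) \<in> L2_space \<mu>"
proof -
  have [measurable]: "f \<in> borel_measurable \<mu>" "g \<in> borel_measurable \<mu>"
    using f g by (auto simp: L2_space_def)
  have "integrable \<mu> (\<lambda>x. (cmod (f x - g x))\<^sup>2)"
    by (rule Bochner_Integration.integrable_bound[of _ "\<lambda>x. 2 * (cmod (f x))\<^sup>2 + 2 * (cmod (g x))\<^sup>2"])
       (use f g cmod_diff_power2_le in \<open>auto simp: L2_space_def\<close>)
  then show ?thesis by (simp add: L2_space_def)
qed

lemma L2_norm_power2: "(L2_norm \<mu> f)\<^sup>2 = (LINT x|\<mu>. (cmod (f x))\<^sup>2)"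
  by (simp add: L2_norm_def)

lemma L2_norm_nonneg [simp]: "0 \<le> L2_norm \<mu> f"
  by (simp add: L2_norm_def)

lemma AE_eq_if_L2_norm_diff_eq_0:
  assumes f: "f \<in> L2_space \<mu>" and g: "g \<in> L2_space \<mu>" and 0: "L2_norm \<mu> (\<lambda>x. f x - g x) = 0"
  shows "AE x in \<mu>. f x = g x"
proof -
  have "integrable \<mu> (\<lambda>x. (cmod (f x - g x))\<^sup>2)"
    using L2_space_diff[OF f g] by (simp add: L2_space_def)
  moreover have "(LINT x|\<mu>. (cmod (f x - g x))\<^sup>2) = 0"
    using L2_norm_power2[of \<mu> "\<lambda>x. f x - g x"] 0 by simp
  ultimately have "AE x in \<mu>. (cmod (f x - g x))\<^sup>2 = 0"
    by (subst (asm) integral_nonneg_eq_0_iff_AE) auto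
  then show ?thesis by simp
qed

lemma L2_limit_unique_AE:
  assumes f: "\<And>k. f k \<in> L2_space \<mu>"
    and g: "g \<in> L2_space \<mu>" "(\<lambda>k. L2_norm \<mu> (\<lambda>x. f k x - g x)) \<longlonglongrightarrow> 0"
    and h: "h \<in> L2_space \<mu>" "(\<lambda>k. L2_norm \<mu> (\<lambda>x. f k x - h x)) \<longlonglongrightarrow> 0"
  shows "AE x in \<mu>. g x = h x"
proof (rule AE_eq_if_L2_norm_diff_eq_0[OF g(1) h(1)])
  let ?b = "\<lambda>k. 2 * (L2_norm \<mu> (\<lambda>x. f k x - h x))\<^sup>2 + 2 * (L2_norm \<mu> (\<lambda>x. f k x - g x))\<^sup>2"
  have int: "integrable \<mu> (\<lambda>x. (cmod (u x - v x))\<^sup>2)" if "u \<in> L2_space \<mu>" "v \<in> L2_space \<mu>" for u v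
    using L2_space_diff[OF that] by (simp add: L2_space_def)
  have "(L2_norm \<mu> (\<lambda>x. g x - h x))\<^sup>2 \<le> ?b k" for k
  proof -
    have "(cmod (g x - h x))\<^sup>2 \<le> 2 * (cmod (f k x - h x))\<^sup>2 + 2 * (cmod (f k x - g x))\<^sup>2" for x
      using cmod_diff_power2_le[of "f k x - h x" "f k x - g x"] by simp
    then have "(LINT x|\<mu>. (cmod (g x - h x))\<^sup>2)
        \<le> (LINT x|\<mu>. 2 * (cmod (f k x - h x))\<^sup>2 + 2 * (cmod (f k x - g x))\<^sup>2)"
      using int g(1) h(1) f by (intro integral_mono) auto
    then show ?thesis
      using int g(1) h(1) f by (simp add: L2_norm_power2)
  qed
  moreover have "?b \<longlonglongrightarrow> 2 * 0\<^sup>2 + 2 * 0\<^sup>2"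
    by (intro tendsto_intros g h)
  ultimately have "(L2_norm \<mu> (\<lambda>x. g x - h x))\<^sup>2 \<le> 2 * 0\<^sup>2 + 2 * 0\<^sup>2"
    by (intro LIMSEQ_le_const) auto
  then show "L2_norm \<mu> (\<lambda>x. g x - h x) = 0" by simp
qed

lemma fourier_L1_diff:
  assumes "integrable lborel f" "integrable lborel g"
  shows "fourier_L1 (\<lambda>x. f x - g x) \<xi> = fourier_L1 f \<xi> - fourier_L1 g \<xi>"
  using assms by (simp add: fourier_L1_def right_diff_distrib integrable_cis_mult)

text \<open>\<open>is_fourier_L2\<close> admits any approximating sequence. The Plancherel
  inequality for the differences \<open>u k - f\<close> shows that the transforms converge to
  \<open>fourier_L1 f\<close> whichever sequence is taken, and L_2 limits are unique up to null
  sets.\<close>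

lemma is_fourier_L2_unique_AE:
  assumes f: "integrable lborel f" "f \<in> L2_space lborel" and g: "is_fourier_L2 f g"
  shows "AE \<xi> in lborel. g \<xi> = fourier_L1 f \<xi>"
proof -
  obtain u where u: "\<And>k. integrable lborel (u k)" and uf: "L2_tendsto lborel u f"
    and ug: "L2_tendsto lborel (\<lambda>k. fourier_L1 (u k)) g"
    using g unfolding is_fourier_L2_def by blast
  have u2: "u k \<in> L2_space lborel" for k using uf by (simp add: L2_tendsto_def)
  have le: "L2_norm lborel (\<lambda>\<xi>. fourier_L1 (u k) \<xi> - fourier_L1 f \<xi>) \<le> L2_norm lborel (\<lambda>x. u k x - f x)" for k
    unfolding L2_norm_def using L2_space_integral_fourier_L1(2)[of "\<lambda>x. u k x - f x"] u f u2
    by (simp add: L2_space_diff fourier_L1_diff)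
  have "(\<lambda>k. L2_norm lborel (\<lambda>\<xi>. fourier_L1 (u k) \<xi> - fourier_L1 f \<xi>)) \<longlonglongrightarrow> 0"
    by (rule tendsto_sandwich[OF _ _ tendsto_const, of _ _ _ "\<lambda>k. L2_norm lborel (\<lambda>x. u k x - f x)"])
       (use le uf in \<open>auto simp: L2_tendsto_def\<close>)
  then show ?thesis
    using ug L2_space_integral_fourier_L1(1)[OF f]
    by (intro L2_limit_unique_AE[of "\<lambda>k. fourier_L1 (u k)"]) (auto simp: L2_tendsto_def)
qed

text \<open>The constant sequence f shows that the choice defining \<open>fourier_L2\<close> is made
  from a non-empty set.\<close>

lemma is_fourier_L2_fourier_L2:
  assumes f: "integrable lborel f" "f \<in> L2_space lborel"
  shows "is_fourier_L2 f (fourier_L2 f)"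
proof -
  have "is_fourier_L2 f (fourier_L1 f)"
    unfolding is_fourier_L2_def L2_tendsto_def
    using f L2_space_integral_fourier_L1(1)[OF f] by (intro exI[of _ "\<lambda>_. f"]) (simp add: L2_norm_def)
  then show ?thesis
    unfolding fourier_L2_def by (rule someI[of "is_fourier_L2 f"])
qed

lemma fourier_L2_eq_fourier_L1_AE:
  assumes f: "integrable lborel f" "f \<in> L2_space lborel"
  shows "AE \<xi> in lborel. fourier_L2 f \<xi> = fourier_L1 f \<xi>"
  using is_fourier_L2_unique_AE[OF f is_fourier_L2_fourier_L2[OF f]] .

lemma fourier_L2_measurable:
  assumes f: "integrable lborel f" "f \<in> L2_space lborel"
  shows "fourier_L2 f \<in> borel_measurable lborel"
  using is_fourier_L2_fourier_L2[OF f] by (auto simp: is_fourier_L2_def L2_tendsto_def L2_space_def)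

text \<open>A change of the transform on a null set affects neither integrability nor the integral.
  From here on the chosen \<open>fourier_L2\<close> is replaced by the explicit Fourier
  integral.\<close>

lemma
  assumes f: "integrable lborel (f :: 'a::euclidean_space \<Rightarrow> complex)" "f \<in> L2_space lborel"
  shows sobolev_space_iff_fourier_L1:
      "f \<in> sobolev_space s \<longleftrightarrow>
        integrable lborel (\<lambda>\<xi>. (1 + (norm \<xi>)\<^sup>2) powr s * (cmod (fourier_L1 f \<xi>))\<^sup>2)"
    and sobolev_norm_eq_fourier_L1:
      "sobolev_norm s f = sqrt (LINT \<xi>|lborel. (1 + (norm \<xi>)\<^sup>2) powr s * (cmod (fourier_L1 f \<xi>))\<^sup>2)"
proof -
  have [measurable]: "fourier_L2 f \<in> borel_measurable borel"
    using fourier_L2_measurable[OF f] by simp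
  have [measurable]: "fourier_L1 f \<in> borel_measurable borel"
    using L2_space_integral_fourier_L1(1)[OF f] by (simp add: L2_space_def)
  have ae: "AE \<xi> in lborel. (1 + (norm \<xi>)\<^sup>2) powr s * (cmod (fourier_L2 f \<xi>))\<^sup>2
      = (1 + (norm \<xi>)\<^sup>2) powr s * (cmod (fourier_L1 f \<xi>))\<^sup>2"
    using fourier_L2_eq_fourier_L1_AE[OF f] by eventually_elim simp
  show "f \<in> sobolev_space s \<longleftrightarrow>
        integrable lborel (\<lambda>\<xi>. (1 + (norm \<xi>)\<^sup>2) powr s * (cmod (fourier_L1 f \<xi>))\<^sup>2)"
    unfolding sobolev_space_def using f(2) ae
    by (auto intro!: integrable_cong_AE[THEN iffD1, OF _ _ ae] integrable_cong_AE[THEN iffD2, OF _ _ ae])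
  show "sobolev_norm s f = sqrt (LINT \<xi>|lborel. (1 + (norm \<xi>)\<^sup>2) powr s * (cmod (fourier_L1 f \<xi>))\<^sup>2)"
    unfolding sobolev_norm_def by (intro arg_cong[where f=sqrt] integral_cong_AE ae) measurable
qed

section \<open>Smooth functions\<close>

lemma Ck_function_imp_continuous:
  assumes "Ck_function k f"
  shows "continuous_on UNIV f"
proof (cases k)
  case (Suc j)
  then show ?thesis
    using assms by (auto simp: continuous_on_eq_continuous_at intro: differentiable_imp_continuous_within)
qed (use assms in auto)

lemma Ck_function_Suc_D: "Ck_function (Suc k) f \<Longrightarrow> Ck_function k f"
proof (induction k arbitrary: f)
  case 0
  then show ?case using Ck_function_imp_continuous Ck_function.simps(1) by blast
next
  case (Suc k)
  then show ?case by (simp only: Ck_function.simps(2)) blast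
qed

lemma frechet_derivative_eqI: "(f has_derivative f') (at x) \<Longrightarrow> frechet_derivative f (at x) = f'"
  by (rule frechet_derivative_at[symmetric])

text \<open>Trades the chosen \<open>frechet_derivative\<close> for a derivative given by a formula;
  the closure properties below compute such a formula and apply the induction hypothesis to
  it.\<close>

lemma Ck_function_SucI:
  assumes "\<And>x. (f has_derivative f' x) (at x)" "\<And>v. Ck_function k (\<lambda>x. f' x v)"
  shows "Ck_function (Suc k) f"
  using assms by (auto simp: differentiable_def frechet_derivative_eqI[OF assms(1)])

lemma Ck_function_Suc_has_derivative:
  "Ck_function (Suc k) f \<Longrightarrow> (f has_derivative frechet_derivative f (at x)) (at x)"
  by (simp add: frechet_derivative_works)

lemma Ck_function_frechet_derivative:
  "Ck_function (Suc k) f \<Longrightarrow> Ck_function k (\<lambda>x. frechet_derivative f (at x) v)"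
  by simp

lemma Ck_function_const: "Ck_function k (\<lambda>x. c)"
proof (induction k arbitrary: c)
  case (Suc k)
  show ?case by (rule Ck_function_SucI[of _ "\<lambda>_ _. 0"]) (auto intro: Suc)
qed simp

lemma Ck_function_add:
  "Ck_function k f \<Longrightarrow> Ck_function k g \<Longrightarrow> Ck_function k (\<lambda>x. f x + g x)"
proof (induction k arbitrary: f g)
  case (Suc k)
  show ?case
    by (rule Ck_function_SucI[OF has_derivative_add[OF Ck_function_Suc_has_derivative[OF Suc.prems(1)]
            Ck_function_Suc_has_derivative[OF Suc.prems(2)]]])
       (intro Suc.IH Ck_function_frechet_derivative[OF Suc.prems(1)] Ck_function_frechet_derivative[OF Suc.prems(2)])
qed (auto intro: continuous_on_add)

lemma Ck_function_mult:
  "Ck_function k f \<Longrightarrow> Ck_function k g \<Longrightarrow> Ck_function k (\<lambda>x. f x * g x)"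
proof (induction k arbitrary: f g)
  case (Suc k)
  show ?case
    by (rule Ck_function_SucI[OF has_derivative_mult[OF Ck_function_Suc_has_derivative[OF Suc.prems(1)]
            Ck_function_Suc_has_derivative[OF Suc.prems(2)]]])
       (intro Ck_function_add Suc.IH Ck_function_Suc_D[OF Suc.prems(1)] Ck_function_Suc_D[OF Suc.prems(2)]
          Ck_function_frechet_derivative[OF Suc.prems(1)] Ck_function_frechet_derivative[OF Suc.prems(2)])
qed (auto intro: continuous_on_mult)

lemma Ck_function_sum:
  "(\<And>i. i \<in> I \<Longrightarrow> Ck_function k (f i)) \<Longrightarrow> Ck_function k (\<lambda>x. \<Sum>i\<in>I. f i x)"
  by (induction I rule: infinite_finite_induct) (auto intro: Ck_function_const Ck_function_add)

lemma Ck_function_inner: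
  fixes v :: "'a::euclidean_space"
  shows "Ck_function k (\<lambda>x. complex_of_real (x \<bullet> v))"
proof (cases k)
  case (Suc j)
  have "((\<lambda>x. complex_of_real (x \<bullet> v)) has_derivative (\<lambda>h. complex_of_real (h \<bullet> v))) (at x)" for x
    by (auto intro!: derivative_eq_intros)
  then show ?thesis
    unfolding Suc by (rule Ck_function_SucI) (rule Ck_function_const)
qed (auto intro!: continuous_intros)

lemma Ck_function_affine:
  fixes f :: "'a::euclidean_space \<Rightarrow> complex"
  shows "Ck_function k f \<Longrightarrow> Ck_function k (\<lambda>x. f (r *\<^sub>R (x - a)))"
proof (induction k arbitrary: f)
  case 0
  then have "continuous_on UNIV f" by simp
  then show ?case by (auto intro!: continuous_on_compose2[of UNIV f] continuous_intros)
next
  case (Suc k)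
  let ?D = "\<lambda>y. frechet_derivative f (at y)"
  have lin: "linear (?D y)" for y
    using Ck_function_Suc_has_derivative[OF Suc.prems] by (rule has_derivative_linear)
  have "((\<lambda>x. f (r *\<^sub>R (x - a))) has_derivative (\<lambda>v. complex_of_real r * ?D (r *\<^sub>R (x - a)) v)) (at x)" for x
  proof -
    have "((\<lambda>x. r *\<^sub>R (x - a)) has_derivative (\<lambda>v. r *\<^sub>R v)) (at x)"
      by (auto intro!: derivative_eq_intros)
    from has_derivative_compose[OF this Ck_function_Suc_has_derivative[OF Suc.prems]]
    show ?thesis by (simp add: linear_cmul[OF lin] scaleR_conv_of_real)
  qed
  then show ?case
    by (rule Ck_function_SucI)
       (intro Ck_function_mult Ck_function_const Suc.IH Ck_function_frechet_derivative[OF Suc.prems])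
qed

text \<open>The classical smooth function exp (- 1 / t), continued by 0 for t \<le> 0. The
  additional powers of 1 / t make the span of the family closed under differentiation.\<close>

definition flat :: "nat \<Rightarrow> real \<Rightarrow> real" where
  "flat m t = (if t \<le> 0 then 0 else exp (- inverse t) * inverse t ^ m)"

lemma flat_tendsto_0: "(flat m \<longlongrightarrow> 0) (at 0)"
proof (rule filterlim_split_at)
  show "(flat m \<longlongrightarrow> 0) (at_left 0)"
    by (rule Lim_transform_eventually[of "\<lambda>_. 0"])
       (auto simp: flat_def eventually_at_filter)
  have "((\<lambda>x. x ^ m / exp x) \<longlongrightarrow> (0::real)) at_top"
    by (rule tendsto_power_div_exp_0)
  then have "((\<lambda>t. inverse t ^ m / exp (inverse t)) \<longlongrightarrow> (0::real)) (at_right 0)"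
    by (rule filterlim_compose[OF _ filterlim_inverse_at_top_right])
  then show "(flat m \<longlongrightarrow> 0) (at_right 0)"
    by (rule Lim_transform_eventually)
       (auto simp: flat_def eventually_at_filter exp_minus divide_inverse mult.commute)
qed

lemma flat_has_real_derivative:
  "(flat m has_real_derivative (flat (m + 2) t - real m * flat (m + 1) t)) (at t)"
proof (cases t "0::real" rule: linorder_cases)
  case less
  have "((\<lambda>_. 0) has_real_derivative 0) (at t)" by simp
  then have "(flat m has_real_derivative 0) (at t)"
    by (rule has_field_derivative_transform_within_open[where S="{..<0}"]) (use less in \<open>auto simp: flat_def\<close>)
  then show ?thesis using less by (simp add: flat_def)
next
  case greater
  have "((\<lambda>t. exp (- inverse t) * inverse t ^ m) has_real_derivative
      exp (- inverse t) * (inverse t * inverse t) * inverse t ^ m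
        + exp (- inverse t) * (real m * (inverse t ^ (m - 1) * - (inverse t * inverse t)))) (at t)"
    using greater by (auto intro!: derivative_eq_intros simp: power2_eq_square)
  also have "exp (- inverse t) * (inverse t * inverse t) * inverse t ^ m
        + exp (- inverse t) * (real m * (inverse t ^ (m - 1) * - (inverse t * inverse t)))
      = flat (m + 2) t - real m * flat (m + 1) t"
    using greater by (cases m) (auto simp: flat_def algebra_simps)
  finally have "((\<lambda>t. exp (- inverse t) * inverse t ^ m) has_real_derivative
      (flat (m + 2) t - real m * flat (m + 1) t)) (at t)" .
  then show ?thesis
    by (rule has_field_derivative_transform_within_open[where S="{0<..}"]) (use greater in \<open>auto simp: flat_def\<close>)
next
  case equal
  \<comment> \<open>At 0 the difference quotient of \<open>flat m\<close> is
    \<open>flat (Suc m)\<close>, since the division by h contributes one more power of 1 / h; its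
    limit is already known to be 0.\<close>
  have "((\<lambda>h. (flat m (0 + h) - flat m 0) / h) \<longlongrightarrow> 0) (at 0)"
    using flat_tendsto_0[of "Suc m"]
    by (rule Lim_transform_eventually)
       (auto simp: flat_def eventually_at_filter divide_inverse)
  then show ?thesis
    using equal by (simp add: DERIV_def) (simp add: flat_def)
qed

text \<open>The induction covers all m at once because the derivative of \<open>flat m\<close>
  involves \<open>flat (m + 1)\<close> and \<open>flat (m + 2)\<close>. The argument is the
  polynomial 1 - x \<bullet> x, not 1 - |x|, so that smoothness is not lost at the origin.\<close>

lemma Ck_function_flat:
  "Ck_function k (\<lambda>x::'a::euclidean_space. complex_of_real (flat m (1 - x \<bullet> x)))"
proof (induction k arbitrary: m)
  case 0
  have "continuous_on UNIV (flat m)"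
    using DERIV_isCont[OF flat_has_real_derivative[of m]] by (simp add: continuous_at_imp_continuous_on)
  then show ?case by (auto intro!: continuous_intros continuous_on_compose2[of UNIV "flat m"])
next
  case (Suc k)
  let ?D = "\<lambda>x::'a. flat (m + 2) (1 - x \<bullet> x) - real m * flat (m + 1) (1 - x \<bullet> x)"
  have "((\<lambda>x::'a. complex_of_real (flat m (1 - x \<bullet> x))) has_derivative
      (\<lambda>v. (complex_of_real (flat (m + 2) (1 - x \<bullet> x)) + complex_of_real (- real m) * complex_of_real (flat (m + 1) (1 - x \<bullet> x)))
        * (complex_of_real (-2) * complex_of_real (x \<bullet> v)))) (at x)" for x
  proof -
    have "((\<lambda>x::'a. 1 - x \<bullet> x) has_derivative (\<lambda>v. - 2 * (x \<bullet> v))) (at x)"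
      by (auto intro!: derivative_eq_intros simp: inner_commute)
    from has_derivative_compose[OF this has_field_derivative_imp_has_derivative[OF flat_has_real_derivative[of m]]]
    have "((\<lambda>x::'a. flat m (1 - x \<bullet> x)) has_derivative (\<lambda>v. ?D x * (- 2 * (x \<bullet> v)))) (at x)" .
    then have "((\<lambda>x::'a. complex_of_real (flat m (1 - x \<bullet> x))) has_derivative
        (\<lambda>v. complex_of_real (?D x * (- 2 * (x \<bullet> v))))) (at x)"
      by (rule has_derivative_of_real)
    then show ?thesis by (simp add: algebra_simps)
  qed
  then show ?case
    by (rule Ck_function_SucI)
       (intro Ck_function_mult Ck_function_add Ck_function_const Ck_function_inner Suc)
qed

section \<open>Sobolev norms of test functions\<close>

abbreviation dir_deriv :: "'a::euclidean_space \<Rightarrow> ('a \<Rightarrow> complex) \<Rightarrow> 'a \<Rightarrow> complex" where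
  "dir_deriv v f \<equiv> (\<lambda>x. frechet_derivative f (at x) v)"

lemma test_functionI:
  assumes "\<And>k. Ck_function k f" "\<And>x. f x \<noteq> 0 \<Longrightarrow> norm x \<le> R"
  shows "test_function f"
proof -
  have "{x. f x \<noteq> 0} \<subseteq> cball 0 R" using assms(2) by auto
  then have "bounded {x. f x \<noteq> 0}" using bounded_cball bounded_subset by blast
  then show ?thesis using assms(1) by (simp add: test_function_def)
qed

lemma test_function_has_derivative:
  "test_function f \<Longrightarrow> (f has_derivative frechet_derivative f (at x)) (at x)"
  using Ck_function_Suc_has_derivative unfolding test_function_def by blast

lemma test_function_continuous: "test_function f \<Longrightarrow> continuous_on S f"
  using Ck_function_imp_continuous continuous_on_subset unfolding test_function_def by blast

lemma test_function_support:
  assumes "test_function f"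
  obtains R where "0 < R" "\<And>x. R < norm x \<Longrightarrow> f x = 0"
proof -
  have "bounded (closure {x. f x \<noteq> 0})"
    using assms by (simp add: test_function_def compact_imp_bounded)
  then obtain R where R: "0 < R" "\<And>x. x \<in> closure {x. f x \<noteq> 0} \<Longrightarrow> norm x \<le> R"
    by (auto simp: bounded_pos)
  then have "f x = 0" if "R < norm x" for x
    using that closure_subset[of "{x. f x \<noteq> 0}"] by force
  with R(1) show thesis by (rule that)
qed

lemma dir_deriv_support:
  assumes R: "\<And>x. R < norm x \<Longrightarrow> f x = 0" and x: "R < norm x"
  shows "dir_deriv v f x = 0"
proof -
  have "((\<lambda>_. 0) has_derivative (\<lambda>_. 0)) (at x)" by simp
  then have "(f has_derivative (\<lambda>_. 0)) (at x)"
    by (rule has_derivative_transform_within_open[where s="- cball 0 R"]) (use R x in auto)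
  then show ?thesis by (simp add: frechet_derivative_eqI)
qed

lemma dir_deriv_iterate_support:
  "(\<And>x. R < norm x \<Longrightarrow> f x = 0) \<Longrightarrow> R < norm x \<Longrightarrow> (dir_deriv v ^^ k) f x = 0"
proof (induction k arbitrary: x)
  case (Suc k)
  then show ?case using dir_deriv_support[of R "(dir_deriv v ^^ k) f" x v] by simp
qed simp

lemma test_function_dir_deriv:
  assumes f: "test_function f"
  shows "test_function (dir_deriv v f)"
proof -
  obtain R where R: "0 < R" "\<And>x. R < norm x \<Longrightarrow> f x = 0"
    using test_function_support[OF f] by blast
  show ?thesis
    using f Ck_function_frechet_derivative[of _ f v] dir_deriv_support[OF R(2), where v=v]
    by (intro test_functionI[where R=R]) (force simp: test_function_def)+
qed

lemma test_function_dir_deriv_iterate: "test_function f \<Longrightarrow> test_function ((dir_deriv v ^^ k) f)"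
  by (induction k) (auto intro: test_function_dir_deriv)

lemma test_function_bounded:
  assumes f: "test_function f"
  obtains B where "0 < B" "\<And>x. cmod (f x) \<le> B"
proof -
  obtain R where R: "0 < R" "\<And>x. R < norm x \<Longrightarrow> f x = 0"
    using test_function_support[OF f] by blast
  have "bounded (f ` cball 0 R)"
    by (intro compact_imp_bounded compact_continuous_image test_function_continuous f) auto
  then obtain B where B: "0 < B" "\<And>x. norm x \<le> R \<Longrightarrow> cmod (f x) \<le> B"
    by (auto simp: bounded_pos)
  then have "cmod (f x) \<le> B" for x using R(2)[of x] by (cases "norm x \<le> R") auto
  with B(1) show thesis by (rule that)
qed

lemma test_function_measurable: "test_function f \<Longrightarrow> f \<in> borel_measurable borel"
  by (rule borel_measurable_continuous_onI) (rule test_function_continuous)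

lemma integrable_indicator_cball:
  "integrable lborel (indicator (cball (c::'a::euclidean_space) r) :: 'a \<Rightarrow> real)"
  using emeasure_bounded_finite[OF bounded_cball, of c r] by (intro integrable_real_indicator) auto

lemma integrable_bounded_support:
  fixes f :: "'a::euclidean_space \<Rightarrow> complex"
  assumes "f \<in> borel_measurable borel" "\<And>x. cmod (f x) \<le> B" "\<And>x. R < norm x \<Longrightarrow> f x = 0"
  shows "integrable lborel f"
proof -
  have "integrable lborel (\<lambda>x::'a. B * indicator (cball 0 R) x)"
    by (intro integrable_mult_right integrable_indicator_cball)
  then show ?thesis
    by (rule Bochner_Integration.integrable_bound)
       (use assms order_trans[OF norm_ge_zero assms(2)] in \<open>auto simp: indicator_def\<close>)
qed

lemma test_function_integrable: "test_function f \<Longrightarrow> integrable lborel f"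
  by (metis integrable_bounded_support test_function_bounded test_function_measurable test_function_support)

lemma test_function_L2_space:
  assumes f: "test_function f" shows "f \<in> L2_space lborel"
proof -
  have [measurable]: "f \<in> borel_measurable borel" using f by (rule test_function_measurable)
  obtain B where B: "0 < B" "\<And>x. cmod (f x) \<le> B" using test_function_bounded[OF f] by blast
  have "integrable lborel (\<lambda>x. (cmod (f x))\<^sup>2)"
    by (rule Bochner_Integration.integrable_bound[of _ "\<lambda>x. complex_of_real B * f x"])
       (use test_function_integrable[OF f] B in \<open>auto simp: norm_mult power2_eq_square mult_right_mono\<close>)
  then show ?thesis by (simp add: L2_space_def)
qed

section \<open>The Fourier transform of directional derivatives\<close>

lemma integral_lborel_translate:
  fixes g :: "'a::euclidean_space \<Rightarrow> complex"
  assumes "g \<in> borel_measurable borel"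
  shows "(LINT x|lborel. g (a + x)) = (LINT x|lborel. g x)"
proof -
  have "(LINT x|lborel. g x) = (LINT x|distr lborel borel ((+) a). g x)"
    by (simp add: lborel_distr_plus)
  also have "\<dots> = (LINT x|lborel. g (a + x))"
    using assms by (subst integral_distr) auto
  finally show ?thesis ..
qed

lemma fourier_raw_translate:
  assumes f: "f \<in> borel_measurable borel"
  shows "fourier_raw (\<lambda>x. f (x + a)) \<xi> = cis (\<xi> \<bullet> a) * fourier_raw f \<xi>"
proof -
  note f [measurable]
  have "fourier_raw (\<lambda>x. f (x + a)) \<xi> = (LINT x|lborel. cis (\<xi> \<bullet> a) * (cis (- (\<xi> \<bullet> (a + x))) * f (a + x)))"
    unfolding fourier_raw_def
    by (intro Bochner_Integration.integral_cong refl)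
       (simp add: mult.assoc[symmetric] cis_mult inner_add_right add.commute)
  also have "\<dots> = cis (\<xi> \<bullet> a) * (LINT x|lborel. cis (- (\<xi> \<bullet> (a + x))) * f (a + x))"
    by (rule integral_mult_right_zero)
  also have "(LINT x|lborel. cis (- (\<xi> \<bullet> (a + x))) * f (a + x)) = fourier_raw f \<xi>"
    unfolding fourier_raw_def by (rule integral_lborel_translate[of "\<lambda>x. cis (- (\<xi> \<bullet> x)) * f x"]) measurable
  finally show ?thesis .
qed

lemma test_function_line_derivative:
  assumes f: "test_function f"
  shows "((\<lambda>t. f (x + t *\<^sub>R v)) has_derivative (\<lambda>h. h *\<^sub>R dir_deriv v f (x + t *\<^sub>R v))) (at t within S)"
proof -
  have 1: "((\<lambda>t. x + t *\<^sub>R v) has_derivative (\<lambda>h. h *\<^sub>R v)) (at t within S)"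
    by (auto intro!: derivative_eq_intros)
  show ?thesis
    using has_derivative_compose[OF 1 test_function_has_derivative[OF f]]
      linear_cmul[OF has_derivative_linear[OF test_function_has_derivative[OF f]]] by simp
qed

text \<open>The mean value inequality on a line; it supplies the dominating constant for difference
  quotients under the Fourier integral.\<close>

lemma test_function_difference_bound:
  assumes f: "test_function f" and B: "\<And>x. cmod (dir_deriv v f x) \<le> B"
  shows "cmod (f (x + t *\<^sub>R v) - f x) \<le> B * \<bar>t\<bar>"
proof -
  have "norm (f (x + t *\<^sub>R v) - f (x + 0 *\<^sub>R v)) \<le> B * norm (t - 0)"
  proof (rule differentiable_bound[OF convex_UNIV test_function_line_derivative[OF f]])
    show "onorm (\<lambda>h. h *\<^sub>R dir_deriv v f (x + s *\<^sub>R v)) \<le> B" for s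
      by (intro onorm_le, unfold norm_scaleR real_norm_def, subst mult.commute) (intro mult_right_mono B, simp)
  qed auto
  then show ?thesis by simp
qed

lemma test_function_difference_quotient:
  assumes f: "test_function f" and e: "e \<longlonglongrightarrow> 0" "\<And>n. e n \<noteq> (0::real)"
  shows "(\<lambda>n. (f (x + e n *\<^sub>R v) - f x) / complex_of_real (e n)) \<longlonglongrightarrow> dir_deriv v f x"
proof -
  let ?D = "dir_deriv v f x"
  have "((\<lambda>h. norm (f (x + h *\<^sub>R v) - f x - h *\<^sub>R ?D) / norm h) \<longlongrightarrow> 0) (at 0)"
    using test_function_line_derivative[OF f, of x v 0 UNIV] by (simp add: has_derivative_at)
  moreover have "filterlim e (at 0) sequentially"
    using e by (simp add: filterlim_at)
  ultimately have "(\<lambda>n. norm (f (x + e n *\<^sub>R v) - f x - e n *\<^sub>R ?D) / norm (e n)) \<longlonglongrightarrow> 0"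
    by (rule filterlim_compose)
  moreover have "norm (f (x + e n *\<^sub>R v) - f x - e n *\<^sub>R ?D) / norm (e n)
      = norm ((f (x + e n *\<^sub>R v) - f x) / complex_of_real (e n) - ?D)" for n
  proof -
    have "(f (x + e n *\<^sub>R v) - f x) / complex_of_real (e n) - ?D
        = (f (x + e n *\<^sub>R v) - f x - complex_of_real (e n) * ?D) / complex_of_real (e n)"
      using e(2)[of n] by (simp add: diff_divide_distrib[of _ "complex_of_real (e n) * ?D"])
    then show ?thesis by (simp add: norm_divide scaleR_conv_of_real)
  qed
  ultimately show ?thesis
    by (simp add: tendsto_norm_zero_iff LIM_zero_iff)
qed

lemma cis_difference_quotient:
  assumes e: "e \<longlonglongrightarrow> 0" "\<And>n. e n \<noteq> (0::real)"
  shows "(\<lambda>n. (cis (e n * c) - 1) / complex_of_real (e n)) \<longlonglongrightarrow> \<i> * complex_of_real c"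
proof -
  have "((\<lambda>z. exp (z * (\<i> * complex_of_real c))) has_field_derivative \<i> * complex_of_real c) (at 0)"
    by (auto intro!: derivative_eq_intros)
  then have "((\<lambda>z. (exp (z * (\<i> * complex_of_real c)) - 1) / z) \<longlongrightarrow> \<i> * complex_of_real c) (at 0)"
    by (simp add: DERIV_def)
  moreover have "filterlim (\<lambda>n. complex_of_real (e n)) (at 0) sequentially"
    using e tendsto_of_real[OF e(1), where 'a=complex] by (simp add: filterlim_at)
  ultimately have "(\<lambda>n. (exp (complex_of_real (e n) * (\<i> * complex_of_real c)) - 1) / complex_of_real (e n)) \<longlonglongrightarrow> \<i> * complex_of_real c"
    by (rule filterlim_compose)
  then show ?thesis by (simp add: cis_conv_exp mult_ac)
qed

text \<open>A translation multiplies the transform by an exponential, so the transform of a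
  difference quotient is a difference quotient of that exponential times the transform of f. Both
  sides converge as the step tends to 0, one by dominated convergence, the other by differentiating
  the exponential.\<close>

lemma fourier_raw_dir_deriv:
  assumes f: "test_function (f :: 'a::euclidean_space \<Rightarrow> complex)"
  shows "fourier_raw (dir_deriv v f) \<xi> = \<i> * complex_of_real (\<xi> \<bullet> v) * fourier_raw f \<xi>"
proof -
  have [measurable]: "f \<in> borel_measurable borel" "dir_deriv v f \<in> borel_measurable borel"
    using f by (auto intro!: test_function_measurable test_function_dir_deriv)
  obtain B where B: "0 < B" "\<And>x. cmod (dir_deriv v f x) \<le> B"
    using test_function_bounded[OF test_function_dir_deriv[OF f]] by blast
  obtain R where R: "0 < R" "\<And>x. R < norm x \<Longrightarrow> f x = 0"
    using test_function_support[OF f] by blast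
  define e where "e n = inverse (real (Suc n))" for n
  have e: "e \<longlonglongrightarrow> 0" "\<And>n. e n \<noteq> 0" "\<And>n. 0 < e n" "\<And>n. e n \<le> 1"
    unfolding e_def by (rule LIMSEQ_inverse_real_of_nat) (auto simp: inverse_le_1_iff)
  let ?q = "\<lambda>n x. (f (x + e n *\<^sub>R v) - f x) / complex_of_real (e n)"
  have lim: "(\<lambda>n. LINT x|lborel. cis (- (\<xi> \<bullet> x)) * ?q n x) \<longlonglongrightarrow> (LINT x|lborel. cis (- (\<xi> \<bullet> x)) * dir_deriv v f x)"
  proof (rule integral_dominated_convergence)
    \<comment> \<open>Since 0 < e n \<le> 1, all quotients vanish outside the ball of radius R +
      |v|, so one dominating function serves every n.\<close>
    show "integrable lborel (\<lambda>x::'a. B * indicator (cball 0 (R + norm v)) x)"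
      by (intro integrable_mult_right integrable_indicator_cball)
    show "AE x in lborel. (\<lambda>n. cis (- (\<xi> \<bullet> x)) * ?q n x) \<longlonglongrightarrow> cis (- (\<xi> \<bullet> x)) * dir_deriv v f x"
      by (intro AE_I2 tendsto_mult tendsto_const test_function_difference_quotient f e)
    show "AE x in lborel. cmod (cis (- (\<xi> \<bullet> x)) * ?q n x) \<le> B * indicator (cball 0 (R + norm v)) x" for n
    proof (intro AE_I2)
      fix x :: 'a
      show "cmod (cis (- (\<xi> \<bullet> x)) * ?q n x) \<le> B * indicator (cball 0 (R + norm v)) x"
      proof (cases "norm x \<le> R + norm v")
        case True
        have "cmod (?q n x) \<le> B"
          using test_function_difference_bound[OF f B(2), of x "e n"] e(3)[of n]
          by (simp add: norm_divide divide_le_eq)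
        then show ?thesis using True unfolding norm_mult by simp
      next
        case False
        have "norm x \<le> norm (x + e n *\<^sub>R v) + norm (e n *\<^sub>R v)"
          using norm_triangle_ineq4[of "x + e n *\<^sub>R v" "e n *\<^sub>R v"] by simp
        moreover have "norm (e n *\<^sub>R v) \<le> norm v"
          using e(3,4)[of n] by (simp add: mult_left_le_one_le)
        ultimately have "R < norm (x + e n *\<^sub>R v)" "R < norm x" using False norm_ge_zero[of v] by linarith+
        then show ?thesis using R(2) False by simp
      qed
    qed
  qed measurable
  have val: "(LINT x|lborel. cis (- (\<xi> \<bullet> x)) * ?q n x)
      = (cis (e n * (\<xi> \<bullet> v)) - 1) / complex_of_real (e n) * fourier_raw f \<xi>" for n
  proof -
    have i: "integrable lborel f" by (rule test_function_integrable[OF f])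
    have it: "integrable lborel (\<lambda>x. f (x + e n *\<^sub>R v))"
    proof -
      obtain B' where B': "\<And>x. cmod (f x) \<le> B'" using test_function_bounded[OF f] by blast
      show ?thesis
      proof (rule integrable_bounded_support)
      show "cmod (f (x + e n *\<^sub>R v)) \<le> B'" for x by (rule B')
      fix x :: 'a assume "R + norm (e n *\<^sub>R v) < norm x"
      moreover have "norm x \<le> norm (x + e n *\<^sub>R v) + norm (e n *\<^sub>R v)"
        using norm_triangle_ineq4[of "x + e n *\<^sub>R v" "e n *\<^sub>R v"] by simp
      ultimately show "f (x + e n *\<^sub>R v) = 0" by (intro R(2)) simp
      qed measurable
    qed
    have "(LINT x|lborel. cis (- (\<xi> \<bullet> x)) * ?q n x)
       = (LINT x|lborel. (cis (- (\<xi> \<bullet> x)) * f (x + e n *\<^sub>R v) - cis (- (\<xi> \<bullet> x)) * f x) / complex_of_real (e n))"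
      by (simp add: right_diff_distrib diff_divide_distrib)
    also have "\<dots> = (fourier_raw (\<lambda>x. f (x + e n *\<^sub>R v)) \<xi> - fourier_raw f \<xi>) / complex_of_real (e n)"
      unfolding fourier_raw_def
      by (simp add: Bochner_Integration.integral_diff[OF integrable_cis_mult[OF it] integrable_cis_mult[OF i]])
    also have "\<dots> = (cis (e n * (\<xi> \<bullet> v)) - 1) / complex_of_real (e n) * fourier_raw f \<xi>"
      by (simp add: fourier_raw_translate left_diff_distrib)
    finally show ?thesis .
  qed
  have "(\<lambda>n. (cis (e n * (\<xi> \<bullet> v)) - 1) / complex_of_real (e n) * fourier_raw f \<xi>)
      \<longlonglongrightarrow> fourier_raw (dir_deriv v f) \<xi>"
    using lim unfolding val fourier_raw_def[of "dir_deriv v f"] .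
  moreover have "(\<lambda>n. (cis (e n * (\<xi> \<bullet> v)) - 1) / complex_of_real (e n) * fourier_raw f \<xi>)
      \<longlonglongrightarrow> \<i> * complex_of_real (\<xi> \<bullet> v) * fourier_raw f \<xi>"
    by (intro tendsto_mult tendsto_const cis_difference_quotient e)
  ultimately show ?thesis by (rule LIMSEQ_unique)
qed

lemma cmod_fourier_L1_dir_deriv_iterate:
  assumes f: "test_function f"
  shows "cmod (fourier_L1 ((dir_deriv v ^^ k) f) \<xi>) = \<bar>\<xi> \<bullet> v\<bar> ^ k * cmod (fourier_L1 f \<xi>)"
proof -
  have "cmod (fourier_raw ((dir_deriv v ^^ k) f) \<xi>) = \<bar>\<xi> \<bullet> v\<bar> ^ k * cmod (fourier_raw f \<xi>)"
  proof (induction k)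
    case (Suc k)
    then show ?case
      using fourier_raw_dir_deriv[OF test_function_dir_deriv_iterate[OF f, of k v], of v \<xi>]
      by (simp add: norm_mult)
  qed simp
  then show ?thesis by (simp add: fourier_L1_eq_raw norm_mult)
qed

text \<open>Let Y be the largest of the squares of h (\<xi> \<bullet> b). Then h^2 (1 + |\<xi>|^2)
  is at most A times max 1 Y, where A = max 1 (E^2) + n. This base is at least 1, so the exponent s
  may be raised to the integer K, and Y^K is one of the summands on the right. The factor A^K does
  not involve s.\<close>

lemma bessel_weight_le:
  fixes \<xi> :: "'a::euclidean_space"
  assumes s: "0 \<le> s" "s \<le> real K" and h: "0 < h" "h \<le> E"
  shows "(1 + (norm \<xi>)\<^sup>2) powr s
    \<le> (max 1 (E\<^sup>2) + real DIM('a)) ^ K * h powr (- 2 * s) * (1 + (\<Sum>b\<in>Basis. h ^ (2 * K) * (\<bar>\<xi> \<bullet> b\<bar> ^ K)\<^sup>2))"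
proof -
  let ?A = "max 1 (E\<^sup>2) + real DIM('a)"
  let ?X = "(\<lambda>b. (h * (\<xi> \<bullet> b))\<^sup>2) ` (Basis :: 'a set)"
  have "Max ?X \<in> ?X" by (intro Max_in) auto
  then obtain b0 where b0: "b0 \<in> Basis" "Max ?X = (h * (\<xi> \<bullet> b0))\<^sup>2" by blast
  have Yge: "(h * (\<xi> \<bullet> b))\<^sup>2 \<le> (h * (\<xi> \<bullet> b0))\<^sup>2" if "b \<in> Basis" for b
    unfolding b0(2)[symmetric] using that by (intro Max_ge) auto
  define Y where "Y = (h * (\<xi> \<bullet> b0))\<^sup>2"
  have Y: "0 \<le> Y" by (simp add: Y_def)
  have "(norm \<xi>)\<^sup>2 = (\<Sum>b\<in>Basis. (\<xi> \<bullet> b)\<^sup>2)"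
    unfolding power2_norm_eq_inner by (subst euclidean_inner) (simp add: power2_eq_square)
  then have "h\<^sup>2 * (norm \<xi>)\<^sup>2 = (\<Sum>b\<in>Basis. (h * (\<xi> \<bullet> b))\<^sup>2)"
    by (simp add: sum_distrib_left power_mult_distrib)
  also have "\<dots> \<le> (\<Sum>b\<in>(Basis::'a set). Y)" unfolding Y_def by (rule sum_mono) (rule Yge)
  finally have n: "h\<^sup>2 * (norm \<xi>)\<^sup>2 \<le> real DIM('a) * Y" by simp
  have hE: "h\<^sup>2 \<le> E\<^sup>2" using h by (intro power_mono) auto
  have "h\<^sup>2 * (1 + (norm \<xi>)\<^sup>2) \<le> max 1 (E\<^sup>2) * 1 + real DIM('a) * Y"
    using n hE by (simp add: ring_distribs)
  also have "\<dots> \<le> max 1 (E\<^sup>2) * max 1 Y + real DIM('a) * max 1 Y"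
    by (intro add_mono mult_left_mono) auto
  finally have le: "h\<^sup>2 * (1 + (norm \<xi>)\<^sup>2) \<le> ?A * max 1 Y" by (simp add: ring_distribs)
  have A1: "1 \<le> ?A * max 1 Y"
    using mult_mono[of 1 ?A 1 "max 1 Y"] by simp
  have "h powr (2 * s) * (1 + (norm \<xi>)\<^sup>2) powr s = (h\<^sup>2 * (1 + (norm \<xi>)\<^sup>2)) powr s"
    using h by (simp add: powr_mult powr_powr[symmetric] powr_numeral)
  also have "\<dots> \<le> (?A * max 1 Y) powr s"
    using le s by (intro powr_mono2) auto
  also have "\<dots> \<le> (?A * max 1 Y) powr (real K)"
    using A1 s by (intro powr_mono) auto
  also have "\<dots> = ?A ^ K * (max 1 Y) ^ K"
    using A1 by (simp add: powr_realpow power_mult_distrib)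
  also have "\<dots> \<le> ?A ^ K * (1 + (\<Sum>b\<in>(Basis::'a set). h ^ (2 * K) * (\<bar>\<xi> \<bullet> b\<bar> ^ K)\<^sup>2))"
  proof (rule mult_left_mono)
    have YK: "Y ^ K = h ^ (2 * K) * (\<bar>\<xi> \<bullet> b0\<bar> ^ K)\<^sup>2"
      by (simp add: Y_def power_mult_distrib power_mult[symmetric] power_even_abs mult.commute)
    have "(max 1 Y) ^ K \<le> 1 + Y ^ K" using Y by (cases "Y \<le> 1") (auto simp: max_def)
    also have "Y ^ K \<le> (\<Sum>b\<in>(Basis::'a set). h ^ (2 * K) * (\<bar>\<xi> \<bullet> b\<bar> ^ K)\<^sup>2)"
      unfolding YK using b0(1) h by (intro member_le_sum) auto
    finally show "(max 1 Y) ^ K \<le> 1 + (\<Sum>b\<in>(Basis::'a set). h ^ (2 * K) * (\<bar>\<xi> \<bullet> b\<bar> ^ K)\<^sup>2)" by simp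
  qed auto
  finally have le2: "h powr (2 * s) * (1 + (norm \<xi>)\<^sup>2) powr s
    \<le> ?A ^ K * (1 + (\<Sum>b\<in>(Basis::'a set). h ^ (2 * K) * (\<bar>\<xi> \<bullet> b\<bar> ^ K)\<^sup>2))" .
  have hp: "h powr (- 2 * s) * h powr (2 * s) = 1"
    using h by (simp add: powr_add[symmetric])
  have "(1 + (norm \<xi>)\<^sup>2) powr s = h powr (- 2 * s) * (h powr (2 * s) * (1 + (norm \<xi>)\<^sup>2) powr s)"
    unfolding mult.assoc[symmetric] hp by simp
  also have "\<dots> \<le> h powr (- 2 * s) * (?A ^ K * (1 + (\<Sum>b\<in>(Basis::'a set). h ^ (2 * K) * (\<bar>\<xi> \<bullet> b\<bar> ^ K)\<^sup>2)))"
    by (rule mult_left_mono[OF le2]) simp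
  finally show ?thesis by (simp only: mult_ac)
qed

text \<open>Integrating the weight estimate against the squared transform turns each factor |\<xi>
  \<bullet> b|^K into the transform of a K-th directional derivative. \<open>E\<close> is any upper
  bound for h; later it is the diameter of the attractor.\<close>

lemma
  fixes f :: "'a::euclidean_space \<Rightarrow> complex"
  assumes f: "test_function f" and s: "0 \<le> s" "s \<le> real K" and h: "0 < h" "h \<le> E"
  shows test_function_sobolev_space: "f \<in> sobolev_space s"
    and sobolev_norm_test_function_le: "(sobolev_norm s f)\<^sup>2 \<le>
      (max 1 (E\<^sup>2) + real DIM('a)) ^ K * h powr (- 2 * s) *
        ((LINT x|lborel. (cmod (f x))\<^sup>2) + (\<Sum>b\<in>Basis. h ^ (2 * K) * (LINT x|lborel. (cmod ((dir_deriv b ^^ K) f x))\<^sup>2)))"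
proof -
  let ?A = "(max 1 (E\<^sup>2) + real DIM('a)) ^ K * h powr (- 2 * s)"
  let ?D = "\<lambda>b. (dir_deriv b ^^ K) f"
  let ?w = "\<lambda>\<xi>. (1 + (norm \<xi>)\<^sup>2) powr s * (cmod (fourier_L1 f \<xi>))\<^sup>2"
  let ?u = "\<lambda>\<xi>. ?A * ((cmod (fourier_L1 f \<xi>))\<^sup>2 + (\<Sum>b\<in>Basis. h ^ (2 * K) * (cmod (fourier_L1 (?D b) \<xi>))\<^sup>2))"
  note test = test_function_integrable test_function_L2_space
  have D: "test_function (?D b)" for b by (rule test_function_dir_deriv_iterate[OF f])
  have A: "0 \<le> ?A" by simp
  have F: "integrable lborel (\<lambda>\<xi>. (cmod (fourier_L1 g \<xi>))\<^sup>2)"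
      "(LINT \<xi>|lborel. (cmod (fourier_L1 g \<xi>))\<^sup>2) \<le> (LINT x|lborel. (cmod (g x))\<^sup>2)"
    if "test_function g" for g :: "'a \<Rightarrow> complex"
    using L2_space_integral_fourier_L1[of g] test[OF that] by (auto simp: L2_space_def)
  have u: "integrable lborel ?u"
    by (intro integrable_mult_right Bochner_Integration.integrable_add Bochner_Integration.integrable_sum F f D)
  have le: "?w \<xi> \<le> ?u \<xi>" for \<xi>
  proof -
    have "?w \<xi> \<le> ?A * (1 + (\<Sum>b\<in>Basis. h ^ (2 * K) * (\<bar>\<xi> \<bullet> b\<bar> ^ K)\<^sup>2)) * (cmod (fourier_L1 f \<xi>))\<^sup>2"
      by (intro mult_right_mono bessel_weight_le s h) simp
    also have "\<dots> = ?u \<xi>"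
      by (simp add: cmod_fourier_L1_dir_deriv_iterate[OF f] power_mult_distrib ring_distribs sum_distrib_right mult.assoc)
    finally show ?thesis .
  qed
  have [measurable]: "fourier_L1 f \<in> borel_measurable borel"
    using L2_space_integral_fourier_L1(1)[of f] test[OF f] by (simp add: L2_space_def)
  have w: "integrable lborel ?w"
    by (rule Bochner_Integration.integrable_bound[OF u]) (use le in \<open>auto intro: order_trans[OF _ abs_ge_self]\<close>)
  then show "f \<in> sobolev_space s"
    using sobolev_space_iff_fourier_L1[of f s] test[OF f] by simp
  have "(sobolev_norm s f)\<^sup>2 = (LINT \<xi>|lborel. ?w \<xi>)"
    using sobolev_norm_eq_fourier_L1[of f s] test[OF f] by (simp add: integral_nonneg_AE)
  also have "\<dots> \<le> (LINT \<xi>|lborel. ?u \<xi>)"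
    by (rule integral_mono[OF w u le])
  also have "\<dots> = ?A * ((LINT \<xi>|lborel. (cmod (fourier_L1 f \<xi>))\<^sup>2)
      + (\<Sum>b\<in>Basis. h ^ (2 * K) * (LINT \<xi>|lborel. (cmod (fourier_L1 (?D b) \<xi>))\<^sup>2)))"
    using F(1)[OF f] F(1)[OF D] by simp
  also have "\<dots> \<le> ?A * ((LINT x|lborel. (cmod (f x))\<^sup>2)
      + (\<Sum>b\<in>Basis. h ^ (2 * K) * (LINT x|lborel. (cmod (?D b x))\<^sup>2)))"
    using h by (intro mult_left_mono[OF _ A] add_mono sum_mono mult_left_mono F f D) auto
  finally show "(sobolev_norm s f)\<^sup>2 \<le> ?A * ((LINT x|lborel. (cmod (f x))\<^sup>2)
      + (\<Sum>b\<in>Basis. h ^ (2 * K) * (LINT x|lborel. (cmod (?D b x))\<^sup>2)))" .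
qed

section \<open>Hausdorff measure and dimension\<close>

lemma le_ennreal_mult_Inf:
  fixes P :: ennreal
  assumes c: "0 < c" and le: "\<And>S. S \<in> X \<Longrightarrow> P \<le> ennreal c * S"
  shows "P \<le> ennreal c * Inf X"
proof -
  have c1: "ennreal (1 / c) * ennreal c = 1" "ennreal c * ennreal (1 / c) = 1"
    using c by (simp_all flip: ennreal_mult')
  have "ennreal (1 / c) * P \<le> Inf X"
  proof (rule Inf_greatest)
    fix S assume "S \<in> X"
    then have "ennreal (1 / c) * P \<le> ennreal (1 / c) * (ennreal c * S)"
      by (intro mult_left_mono le) auto
    then show "ennreal (1 / c) * P \<le> S" by (simp add: mult.assoc[symmetric] c1)
  qed
  then have "ennreal c * (ennreal (1 / c) * P) \<le> ennreal c * Inf X"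
    by (intro mult_left_mono) auto
  then show ?thesis by (simp add: mult.assoc[symmetric] c1)
qed

lemma hausdorff_weight_nonneg [simp]: "0 \<le> hausdorff_weight d U"
  by (simp add: hausdorff_weight_def)

text \<open>The hypothesis \<open>UV\<close> speaks of pairs of points instead of a map between U
  and V, so that it fits images and preimages under a similarity alike.\<close>

lemma
  fixes U V :: "'a::real_normed_vector set"
  assumes k: "0 < k" and V: "bounded V"
    and UV: "\<And>x y. x \<in> U \<Longrightarrow> y \<in> U \<Longrightarrow> \<exists>x'\<in>V. \<exists>y'\<in>V. dist x y \<le> k * dist x' y'"
  shows bounded_scaled: "bounded U"
    and diameter_scaled_le: "diameter U \<le> k * diameter V"
    and hausdorff_weight_scaled_le: "0 \<le> d \<Longrightarrow> hausdorff_weight d U \<le> k powr d * hausdorff_weight d V"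
proof -
  have dist: "dist x y \<le> k * diameter V" if xy: "x \<in> U" "y \<in> U" for x y
  proof -
    obtain x' y' where "x' \<in> V" "y' \<in> V" "dist x y \<le> k * dist x' y'" using UV[OF xy] by blast
    moreover have "k * dist x' y' \<le> k * diameter V"
      using k diameter_bounded_bound[OF V \<open>x' \<in> V\<close> \<open>y' \<in> V\<close>] by simp
    ultimately show ?thesis by simp
  qed
  then show "bounded U" unfolding bounded_two_points by blast
  show diam: "diameter U \<le> k * diameter V"
    using dist k diameter_ge_0[OF V] by (intro diameter_le) (auto simp: dist_norm)
  show "hausdorff_weight d U \<le> k powr d * hausdorff_weight d V" if d: "0 \<le> d"
  proof (cases "U = {} \<or> d = 0")
    case False
    then have "V \<noteq> {}" using UV by blast
    have "diameter U powr d \<le> (k * diameter V) powr d"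
      using diam d diameter_ge_0[OF \<open>bounded U\<close>] by (intro powr_mono2)
    with False \<open>V \<noteq> {}\<close> show ?thesis
      using k diameter_ge_0[OF V] by (simp add: hausdorff_weight_def powr_mult)
  next
    \<comment> \<open>If U is non-empty, then d = 0 and V is non-empty too, so both weights are
      1.\<close>
    case True
    then show ?thesis using UV k by (cases "U = {}") (auto simp: hausdorff_weight_def)
  qed
qed

lemma hausdorff_pre_le:
  assumes "A \<subseteq> (\<Union>i. C i)" "\<And>i. bounded (C i)" "\<And>i. diameter (C i) \<le> \<delta>"
  shows "hausdorff_pre d \<delta> A \<le> (\<Sum>i. ennreal (hausdorff_weight d (C i)))"
  unfolding hausdorff_pre_def using assms by (intro INF_lower) auto

text \<open>\<open>T\<close> transports covering sets of A to covering sets of A', enlarging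
  distances at most by the factor k. Covers of A at scale \<delta> / k thus yield covers of A' at
  scale \<delta>, and the change of scale disappears in the supremum over \<delta>.\<close>

lemma hausdorff_outer_scaled_le:
  fixes A A' :: "'a::real_normed_vector set"
  assumes k: "0 < k" and d: "0 \<le> d"
    and T: "\<And>V x y. x \<in> T V \<Longrightarrow> y \<in> T V \<Longrightarrow> \<exists>x'\<in>V. \<exists>y'\<in>V. dist x y \<le> k * dist x' y'"
    and cover: "\<And>C :: nat \<Rightarrow> 'a set. A \<subseteq> (\<Union>i. C i) \<Longrightarrow> A' \<subseteq> (\<Union>i. T (C i))"
  shows "hausdorff_outer d A' \<le> ennreal (k powr d) * hausdorff_outer d A"
  unfolding hausdorff_outer_def[of d A']
proof (rule SUP_least)
  fix \<delta> :: real assume "\<delta> \<in> {0<..}"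
  then have \<delta>: "0 < \<delta> / k" using k by simp
  have "hausdorff_pre d \<delta> A' \<le> ennreal (k powr d) * hausdorff_pre d (\<delta> / k) A"
    unfolding hausdorff_pre_def[of d _ A]
  proof (rule le_ennreal_mult_Inf)
    show "0 < k powr d" using k by simp
    fix S assume "S \<in> (\<lambda>C. \<Sum>i. ennreal (hausdorff_weight d (C i))) `
      {C :: nat \<Rightarrow> 'a set. A \<subseteq> (\<Union>i. C i) \<and> (\<forall>i. bounded (C i) \<and> diameter (C i) \<le> \<delta> / k)}"
    then obtain C :: "nat \<Rightarrow> 'a set" where S: "S = (\<Sum>i. ennreal (hausdorff_weight d (C i)))"
      and C: "A \<subseteq> (\<Union>i. C i)" "\<And>i. bounded (C i)" "\<And>i. diameter (C i) \<le> \<delta> / k" by auto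
    have "hausdorff_pre d \<delta> A' \<le> (\<Sum>i. ennreal (hausdorff_weight d (T (C i))))"
    proof (rule hausdorff_pre_le)
      show "A' \<subseteq> (\<Union>i. T (C i))" by (rule cover[OF C(1)])
      show "bounded (T (C i))" for i by (rule bounded_scaled[OF k C(2) T])
      show "diameter (T (C i)) \<le> \<delta>" for i
      proof -
        have "diameter (T (C i)) \<le> k * diameter (C i)" by (rule diameter_scaled_le[OF k C(2) T])
        also have "\<dots> \<le> k * (\<delta> / k)" using k by (intro mult_left_mono C(3)) simp
        finally show ?thesis using k by simp
      qed
    qed
    also have "\<dots> \<le> (\<Sum>i. ennreal (k powr d) * ennreal (hausdorff_weight d (C i)))"
      by (intro suminf_le summableI) (simp add: ennreal_mult'[symmetric] hausdorff_weight_scaled_le[OF k C(2) T d])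
    also have "\<dots> = ennreal (k powr d) * S" unfolding S by simp
    finally show "hausdorff_pre d \<delta> A' \<le> ennreal (k powr d) * S" .
  qed
  also have "\<dots> \<le> ennreal (k powr d) * hausdorff_outer d A"
    unfolding hausdorff_outer_def using \<delta> by (intro mult_left_mono SUP_upper) auto
  finally show "hausdorff_pre d \<delta> A' \<le> ennreal (k powr d) * hausdorff_outer d A" .
qed

lemma image_dist_le:
  fixes f :: "'a::metric_space \<Rightarrow> 'b::metric_space"
  assumes f: "\<And>x y. dist (f x) (f y) = r * dist x y" and xy: "x \<in> f ` V" "y \<in> f ` V"
  shows "\<exists>x'\<in>V. \<exists>y'\<in>V. dist x y \<le> r * dist x' y'"
proof -
  obtain a b where "a \<in> V" "x = f a" "b \<in> V" "y = f b" using xy by blast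
  then show ?thesis by (intro bexI[of _ a] bexI[of _ b]) (simp_all add: f)
qed

lemma hausdorff_outer_similarity:
  fixes f :: "'a::real_normed_vector \<Rightarrow> 'a"
  assumes r: "0 < r" and d: "0 \<le> d" and f: "\<And>x y. dist (f x) (f y) = r * dist x y"
  shows "hausdorff_outer d (f ` A) = ennreal (r powr d) * hausdorff_outer d A"
proof (rule antisym)
  show "hausdorff_outer d (f ` A) \<le> ennreal (r powr d) * hausdorff_outer d A"
  proof (rule hausdorff_outer_scaled_le[where T="(`) f", OF r d image_dist_le[OF f]])
    show "f ` A \<subseteq> (\<Union>i. f ` C i)" if "A \<subseteq> (\<Union>i. C i)" for C :: "nat \<Rightarrow> 'a set"
      using that by blast
  qed
  have "hausdorff_outer d A \<le> ennreal ((1 / r) powr d) * hausdorff_outer d (f ` A)"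
  proof (rule hausdorff_outer_scaled_le[where T="(-`) f"])
    fix V x y assume "x \<in> f -` V" "y \<in> f -` V"
    then show "\<exists>x'\<in>V. \<exists>y'\<in>V. dist x y \<le> 1 / r * dist x' y'"
      using r by (intro bexI[of _ "f x"] bexI[of _ "f y"]) (auto simp: f)
  next
    show "A \<subseteq> (\<Union>i. f -` C i)" if "f ` A \<subseteq> (\<Union>i. C i)" for C :: "nat \<Rightarrow> 'a set"
      using that by blast
  qed (use r d in auto)
  then have "ennreal (r powr d) * hausdorff_outer d A
      \<le> ennreal (r powr d) * (ennreal ((1 / r) powr d) * hausdorff_outer d (f ` A))"
    by (intro mult_left_mono) auto
  also have "\<dots> = hausdorff_outer d (f ` A)"
    using r by (simp add: mult.assoc[symmetric] powr_mult[symmetric] flip: ennreal_mult')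
  finally show "ennreal (r powr d) * hausdorff_outer d A \<le> hausdorff_outer d (f ` A)" .
qed

section \<open>Covering numbers and the upper bound for the Hausdorff dimension\<close>

lemma hausdorff_pre_finite_cover_le:
  assumes P: "finite P" and "A \<subseteq> (\<Union>p\<in>P. F p)" "\<And>p. p \<in> P \<Longrightarrow> bounded (F p)"
    "\<And>p. p \<in> P \<Longrightarrow> diameter (F p) \<le> \<delta>" "0 \<le> \<delta>"
  shows "hausdorff_pre d \<delta> A \<le> ennreal (\<Sum>p\<in>P. hausdorff_weight d (F p))"
proof -
  obtain g where g: "bij_betw g {0..<card P} P" using ex_bij_betw_nat_finite[OF P] by blast
  then have gP: "g i \<in> P" if "i < card P" for i using that by (auto simp: bij_betw_def)
  \<comment> \<open>The finite cover is padded to a sequence by empty sets, whose weight is 0 even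
    for d = 0.\<close>
  define C where "C i = (if i < card P then F (g i) else {})" for i
  have "hausdorff_pre d \<delta> A \<le> (\<Sum>i. ennreal (hausdorff_weight d (C i)))"
  proof (rule hausdorff_pre_le)
    have "P = g ` {0..<card P}" using g by (simp add: bij_betw_def)
    with assms(2) show "A \<subseteq> (\<Union>i. C i)" by (force simp: C_def)
  qed (use assms gP in \<open>auto simp: C_def\<close>)
  also have "\<dots> = (\<Sum>i<card P. ennreal (hausdorff_weight d (F (g i))))"
    by (subst suminf_finite[of "{..<card P}"]) (auto simp: C_def hausdorff_weight_def)
  also have "\<dots> = ennreal (\<Sum>i<card P. hausdorff_weight d (F (g i)))"
    by (rule sum_ennreal) simp
  also have "(\<Sum>i<card P. hausdorff_weight d (F (g i))) = (\<Sum>p\<in>P. hausdorff_weight d (F p))"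
    using g by (intro sum.reindex_bij_betw) (simp add: lessThan_atLeast0)
  finally show ?thesis .
qed

text \<open>Comparison of volumes: the balls of radius h / 2 around the points are disjoint and,
  because h \<le> 1, lie in the ball of radius R + 1.\<close>

lemma card_separated_le:
  fixes P :: "'a::euclidean_space set"
  assumes P: "finite P" "\<And>p. p \<in> P \<Longrightarrow> norm p \<le> R"
    and sep: "\<And>p q. p \<in> P \<Longrightarrow> q \<in> P \<Longrightarrow> p \<noteq> q \<Longrightarrow> h \<le> dist p q" and h: "0 < h" "h \<le> 1" "0 \<le> R"
  shows "real (card P) \<le> (2 * (R + 1) / h) ^ DIM('a)"
proof -
  let ?u = "unit_ball_vol (real DIM('a))"
  have u: "0 < ?u" by simp
  have disj: "disjoint_family_on (\<lambda>p. ball p (h / 2)) P"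
    unfolding disjoint_family_on_def
  proof safe
    fix p q x assume "p \<in> P" "q \<in> P" "p \<noteq> q" and x: "x \<in> ball p (h / 2)" "x \<in> ball q (h / 2)"
    then have "h \<le> dist p q" by (intro sep)
    moreover have "dist p q \<le> dist p x + dist q x" by (rule dist_triangle2)
    ultimately show "x \<in> {}" using x by simp
  qed
  have fm: "ball p (h / 2) \<in> fmeasurable lborel" for p :: 'a
    using emeasure_bounded_finite[OF bounded_ball, of p "h / 2"] by (intro fmeasurableI) auto
  have "real (card P) * (?u * (h / 2) ^ DIM('a)) = (\<Sum>p\<in>P. measure lborel (ball p (h / 2)))"
    using h by (simp add: content_ball)
  also have "\<dots> = measure lborel (\<Union>p\<in>P. ball p (h / 2))"
    using P(1) disj fm by (intro measure_finite_Union[symmetric]) (use fmeasurableD2[OF fm] in auto)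
  also have "\<dots> \<le> measure lborel (ball (0::'a) (R + 1))"
  proof (rule measure_mono_fmeasurable)
    show "(\<Union>p\<in>P. ball p (h / 2)) \<subseteq> ball 0 (R + 1)"
    proof safe
      fix p x assume p: "p \<in> P" and x: "x \<in> ball p (h / 2)"
      have "norm x \<le> norm p + dist p x" using norm_triangle_sub[of x p] by (simp add: dist_norm norm_minus_commute)
      then show "x \<in> ball 0 (R + 1)" using P(2)[OF p] x h by simp
    qed
  qed (use P(1) emeasure_bounded_finite[OF bounded_ball, of "0::'a" "R + 1"] in \<open>auto intro!: fmeasurableI sets.finite_UN\<close>)
  also have "\<dots> = ?u * (R + 1) ^ DIM('a)" using h by (simp add: content_ball)
  finally have "real (card P) * (h / 2) ^ DIM('a) \<le> (R + 1) ^ DIM('a)"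
    using u by (simp add: mult.left_commute)
  then have "real (card P) \<le> (R + 1) ^ DIM('a) / (h / 2) ^ DIM('a)"
    using h by (subst pos_le_divide_eq) auto
  also have "\<dots> = ((R + 1) / (h / 2)) ^ DIM('a)" by (rule power_divide[symmetric])
  also have "(R + 1) / (h / 2) = 2 * (R + 1) / h" by simp
  finally show ?thesis .
qed

text \<open>The volume bound caps the size of h-separated subsets, so one of maximal cardinality
  exists. A point of A at distance more than h from all its members could be added to it, hence it
  is an h-net.\<close>

lemma finite_separated_cover:
  fixes A :: "'a::euclidean_space set"
  assumes A: "A \<subseteq> cball 0 R" and h: "0 < h" "h \<le> 1" "0 \<le> R"
  obtains P where "finite P" "A \<subseteq> (\<Union>p\<in>P. cball p h)" "real (card P) \<le> (2 * (R + 1) / h) ^ DIM('a)"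
proof -
  define Q where "Q P \<longleftrightarrow> finite P \<and> P \<subseteq> A \<and> (\<forall>p\<in>P. \<forall>q\<in>P. p \<noteq> q \<longrightarrow> h \<le> dist p q)" for P
  have card: "real (card P) \<le> (2 * (R + 1) / h) ^ DIM('a)" if "Q P" for P
    using that A h unfolding Q_def by (intro card_separated_le) auto
  have "\<exists>P. Q P \<and> (\<forall>P'. Q P' \<longrightarrow> card P' \<le> card P)"
  proof (rule ex_has_greatest_nat)
    show "Q {}" by (simp add: Q_def)
    show "\<forall>P. Q P \<longrightarrow> card P < Suc (nat \<lfloor>(2 * (R + 1) / h) ^ DIM('a)\<rfloor>)"
      using card by (auto simp: less_Suc_eq_le le_nat_floor)
  qed
  then obtain P where P: "Q P" "\<And>P'. Q P' \<Longrightarrow> card P' \<le> card P" by blast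
  have "A \<subseteq> (\<Union>p\<in>P. cball p h)"
  proof (rule ccontr)
    assume "\<not> A \<subseteq> (\<Union>p\<in>P. cball p h)"
    then obtain x where x: "x \<in> A" "\<And>p. p \<in> P \<Longrightarrow> h < dist p x" by (force simp: not_le)
    then have "x \<notin> P" using h by force
    have "Q (insert x P)" using P(1) x by (force simp: Q_def dist_commute)
    then show False using P(2)[of "insert x P"] \<open>x \<notin> P\<close> P(1) by (simp add: Q_def)
  qed
  with P(1) card[OF P(1)] show thesis by (intro that[of P]) (auto simp: Q_def)
qed

text \<open>A net of about h^(-n) balls of diameter 2h has total weight of order h^(d - n), which
  tends to 0 with h because d > n.\<close>

lemma hausdorff_outer_bounded_eq_0:
  fixes A :: "'a::euclidean_space set"
  assumes A: "bounded A" and d: "real DIM('a) < d"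
  shows "hausdorff_outer d A = 0"
proof -
  obtain R where R: "0 < R" "A \<subseteq> cball 0 R" using A by (auto simp: bounded_pos subset_iff)
  have dpos: "0 < d" using d by linarith
  let ?c = "(2 * (R + 1)) ^ DIM('a) * 2 powr d"
  have "hausdorff_pre d \<delta> A \<le> 0" if \<delta>: "0 < \<delta>" for \<delta>
  proof (rule LIMSEQ_le_const)
    define h where "h n = inverse (real (Suc n))" for n
    have h: "h \<longlonglongrightarrow> 0" "\<And>n. 0 < h n" "\<And>n. h n \<le> 1"
      unfolding h_def by (rule LIMSEQ_inverse_real_of_nat) (auto simp: inverse_le_1_iff)
    have "(\<lambda>n. ?c * h n powr (d - DIM('a))) \<longlonglongrightarrow> ?c * 0"
      using h d by (intro tendsto_mult tendsto_const tendsto_zero_powrI[where b="d - real DIM('a)"]) (auto intro: always_eventually less_imp_le)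
    then have "(\<lambda>n. ennreal (?c * h n powr (d - DIM('a)))) \<longlonglongrightarrow> ennreal (?c * 0)"
      by (rule tendsto_ennrealI)
    then show "(\<lambda>n. ennreal (?c * h n powr (d - DIM('a)))) \<longlonglongrightarrow> 0" by simp
    \<comment> \<open>From some index on, the balls have diameter at most \<delta> and are
      admissible in \<open>hausdorff_pre\<close> at scale \<delta>.\<close>
    have "eventually (\<lambda>n. h n < \<delta> / 2) sequentially"
      using order_tendstoD(2)[OF h(1), of "\<delta> / 2"] \<delta> by simp
    then obtain N where N: "\<And>n. N \<le> n \<Longrightarrow> h n < \<delta> / 2" by (auto simp: eventually_sequentially)
    have "hausdorff_pre d \<delta> A \<le> ennreal (?c * h n powr (d - DIM('a)))" if "N \<le> n" for n
    proof -
      obtain P where P: "finite P" "A \<subseteq> (\<Union>p\<in>P. cball p (h n))" "real (card P) \<le> (2 * (R + 1) / h n) ^ DIM('a)"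
        using finite_separated_cover[OF R(2) h(2)[of n] h(3)[of n]] R(1) by auto
      have "hausdorff_pre d \<delta> A \<le> ennreal (\<Sum>p\<in>P. hausdorff_weight d (cball p (h n)))"
        using N[OF that] h(2)[of n] \<delta> by (intro hausdorff_pre_finite_cover_le P) auto
      also have "\<dots> \<le> ennreal ((2 * (R + 1) / h n) ^ DIM('a) * (2 * h n) powr d)"
      proof (rule ennreal_leI)
        have "(\<Sum>p\<in>P. hausdorff_weight d (cball p (h n))) = real (card P) * (2 * h n) powr d"
          using h(2)[of n] dpos by (simp add: hausdorff_weight_def)
        also have "\<dots> \<le> (2 * (R + 1) / h n) ^ DIM('a) * (2 * h n) powr d"
          by (intro mult_right_mono P) simp
        finally show "(\<Sum>p\<in>P. hausdorff_weight d (cball p (h n))) \<le> (2 * (R + 1) / h n) ^ DIM('a) * (2 * h n) powr d" .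
      qed
      also have "(2 * (R + 1) / h n) ^ DIM('a) * (2 * h n) powr d = ?c * h n powr (d - DIM('a))"
        using h(2)[of n] by (simp add: power_divide powr_mult powr_diff powr_realpow)
      finally show ?thesis .
    qed
    then show "\<exists>N. \<forall>n\<ge>N. hausdorff_pre d \<delta> A \<le> ennreal (?c * h n powr (d - DIM('a)))" by blast
  qed
  then show ?thesis unfolding hausdorff_outer_def by (auto intro!: SUP_eq_const antisym SUP_least)
qed

text \<open>All d > n belong to the set whose infimum defines \<open>hausdorff_dim\<close>, so this
  infimum is taken over a non-empty set. The two bounds later confine \<open>ambient_order\<close>
  to a range in which the Sobolev estimates apply.\<close>

lemma
  fixes A :: "'a::euclidean_space set"
  assumes A: "bounded A"
  shows hausdorff_dim_nonneg: "0 \<le> hausdorff_dim A"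
    and hausdorff_dim_le_DIM: "hausdorff_dim A \<le> real DIM('a)"
proof -
  let ?S = "{d. 0 \<le> d \<and> hausdorff_outer d A = 0}"
  have mem: "d \<in> ?S" if "real DIM('a) < d" for d
    using hausdorff_outer_bounded_eq_0[OF A that] that by simp
  show "0 \<le> hausdorff_dim A"
    unfolding hausdorff_dim_def
  proof (rule cInf_greatest)
    have "real DIM('a) + 1 \<in> ?S" by (rule mem) simp
    then show "?S \<noteq> {}" by blast
  qed simp
  show "hausdorff_dim A \<le> real DIM('a)"
  proof (rule dense_ge)
    fix d assume "real DIM('a) < d"
    then show "hausdorff_dim A \<le> d"
      unfolding hausdorff_dim_def by (intro cInf_lower mem) (auto intro!: bdd_belowI[of _ 0])
  qed
qed

section \<open>The Hausdorff measure restricted to \<Gamma> and its scaling\<close>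

lemma space_hausdorff_measure [simp]: "space (hausdorff_measure d) = UNIV"
  by (simp add: hausdorff_measure_def)

lemma sets_hausdorff_measure [simp]: "sets (hausdorff_measure d) = sets borel"
  unfolding hausdorff_measure_def using sets.sigma_sets_eq[of borel] by simp

lemma space_hausdorff_on [simp]: "space (hausdorff_on \<Gamma>) = \<Gamma>"
  by (simp add: hausdorff_on_def space_restrict_space)

lemma sets_hausdorff_on: "sets (hausdorff_on \<Gamma>) = sets (restrict_space borel \<Gamma>)"
  by (simp add: hausdorff_on_def sets_restrict_space)

lemma measurable_hausdorff_on:
  "f \<in> borel_measurable borel \<Longrightarrow> f \<in> borel_measurable (hausdorff_on \<Gamma>)"
  using measurable_restrict_space1[of f borel borel \<Gamma>] measurable_cong_sets[OF sets_hausdorff_on refl] by blast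

lemma compact_in_sets_hausdorff_on:
  assumes "compact (A :: 'a::real_normed_vector set)" "A \<subseteq> \<Gamma>"
  shows "A \<in> sets (hausdorff_on \<Gamma>)"
  using assms borel_compact[of A] unfolding sets_hausdorff_on sets_restrict_space
  by (auto simp: image_iff intro!: bexI[of _ A])

lemma emeasure_hausdorff_on:
  fixes A :: "'a::real_normed_vector set"
  assumes "compact A" "compact \<Gamma>" "A \<subseteq> \<Gamma>"
  shows "emeasure (hausdorff_on \<Gamma>) A =
    (if measure_space UNIV (sets (borel :: 'a measure)) (hausdorff_outer (hausdorff_dim \<Gamma>))
     then hausdorff_outer (hausdorff_dim \<Gamma>) A else 0)"
proof -
  have "emeasure (hausdorff_on \<Gamma>) A = emeasure (hausdorff_measure (hausdorff_dim \<Gamma>)) A"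
    unfolding hausdorff_on_def using assms by (intro emeasure_restrict_space) (auto intro: borel_compact)
  then show ?thesis
    unfolding hausdorff_measure_def using borel_compact[OF assms(1)]
    by (simp add: emeasure_measure_of_conv sets.sigma_sets_eq[of borel, simplified])
qed

text \<open>If \<open>measure_of\<close> fell back to the null measure, both sides would vanish; so the
  measure property of the Hausdorff outer measure on the Borel sets need not be established.\<close>

lemma measure_hausdorff_on_similarity:
  fixes f :: "'a::euclidean_space \<Rightarrow> 'a"
  assumes r: "0 < r" and f: "\<And>x y. dist (f x) (f y) = r * dist x y"
    and A: "compact A" "compact (f ` A)" "compact \<Gamma>" "A \<subseteq> \<Gamma>" "f ` A \<subseteq> \<Gamma>"
  shows "measure (hausdorff_on \<Gamma>) (f ` A) = r powr hausdorff_dim \<Gamma> * measure (hausdorff_on \<Gamma>) A"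
  using hausdorff_outer_similarity[OF r hausdorff_dim_nonneg[OF compact_imp_bounded[OF A(3)]] f]
  by (simp add: measure_def emeasure_hausdorff_on A enn2real_mult)

section \<open>Disjoint attractors\<close>

locale disjoint_ifs =
  fixes M :: nat and s :: "nat \<Rightarrow> 'a::euclidean_space \<Rightarrow> 'a" and \<rho> :: "nat \<Rightarrow> real" and \<Gamma> :: "'a set"
  assumes M: "2 \<le> M"
    and similarity: "\<And>m. m \<in> {1..M} \<Longrightarrow> contracting_similarity (s m) (\<rho> m)"
    and attractor: "is_attractor M s \<Gamma>"
    and disjoint: "disjoint_family_on (\<lambda>m. s m ` \<Gamma>) {1..M}"
begin

definition ratio :: "nat list \<Rightarrow> real" where
  "ratio w = prod_list (map \<rho> w)"

lemma ratio_simps [simp]: "ratio [] = 1" "ratio (m # w) = \<rho> m * ratio w" "ratio (u @ v) = ratio u * ratio v"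
  by (simp_all add: ratio_def)

lemma similarity_facts: "m \<in> {1..M} \<Longrightarrow> 0 < \<rho> m" "m \<in> {1..M} \<Longrightarrow> \<rho> m < 1"
  "m \<in> {1..M} \<Longrightarrow> dist (s m x) (s m y) = \<rho> m * dist x y"
  using similarity by (auto simp: contracting_similarity_def)

lemma compact_\<Gamma>: "compact \<Gamma>" and \<Gamma>_nonempty: "\<Gamma> \<noteq> {}"
  and \<Gamma>_eq: "\<Gamma> = (\<Union>m\<in>{1..M}. s m ` \<Gamma>)"
  using attractor by (auto simp: is_attractor_def)

lemma bounded_\<Gamma>: "bounded \<Gamma>"
  using compact_\<Gamma> by (rule compact_imp_bounded)

lemma ratio_pos: "set w \<subseteq> {1..M} \<Longrightarrow> 0 < ratio w"
  by (induction w) (auto simp: similarity_facts)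

lemma ratio_le_1: "set w \<subseteq> {1..M} \<Longrightarrow> ratio w \<le> 1"
proof (induction w)
  case (Cons m w)
  then show ?case
    using similarity_facts(1,2)[of m] ratio_pos[of w] by (auto intro!: mult_le_one)
qed simp

lemma dist_word_map:
  "set w \<subseteq> {1..M} \<Longrightarrow> dist (word_map s w x) (word_map s w y) = ratio w * dist x y"
  by (induction w) (auto simp: similarity_facts)

lemma word_map_append: "word_map s (u @ v) = word_map s u \<circ> word_map s v"
  by (induction u) auto

lemma piece_append: "piece s \<Gamma> (u @ v) = word_map s u ` piece s \<Gamma> v"
  by (simp add: piece_def word_map_append image_comp)

lemma piece_Cons: "piece s \<Gamma> (m # w) = s m ` piece s \<Gamma> w"
  by (simp add: piece_def image_comp)

lemma piece_Nil [simp]: "piece s \<Gamma> [] = \<Gamma>"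
  by (simp add: piece_def)

lemma piece_subset: "set w \<subseteq> {1..M} \<Longrightarrow> piece s \<Gamma> w \<subseteq> \<Gamma>"
proof (induction w)
  case (Cons m w)
  then have "s m ` piece s \<Gamma> w \<subseteq> s m ` \<Gamma>" by (intro image_mono) auto
  also have "\<dots> \<subseteq> (\<Union>m\<in>{1..M}. s m ` \<Gamma>)" using Cons.prems by auto
  also have "\<dots> = \<Gamma>" by (rule \<Gamma>_eq[symmetric])
  finally show ?case by (simp add: piece_Cons)
qed simp

lemma piece_append_subset: "set v \<subseteq> {1..M} \<Longrightarrow> piece s \<Gamma> (u @ v) \<subseteq> piece s \<Gamma> u"
  using piece_subset[of v] by (simp add: piece_append) (simp add: piece_def image_mono)

lemma piece_nonempty: "piece s \<Gamma> w \<noteq> {}"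
  using \<Gamma>_nonempty by (simp add: piece_def)

lemma continuous_word_map:
  assumes "set w \<subseteq> {1..M}" shows "continuous_on S (word_map s w)"
proof (rule lipschitz_on_continuous_on)
  show "(ratio w)-lipschitz_on S (word_map s w)"
    using assms ratio_pos[of w] by (auto intro!: lipschitz_onI simp: dist_word_map)
qed

lemma compact_piece: "set w \<subseteq> {1..M} \<Longrightarrow> compact (piece s \<Gamma> w)"
  unfolding piece_def by (intro compact_continuous_image continuous_word_map compact_\<Gamma>)

lemma diameter_piece:
  assumes w: "set w \<subseteq> {1..M}"
  shows "diameter (piece s \<Gamma> w) = ratio w * diameter \<Gamma>"
proof (rule antisym)
  note r = ratio_pos[OF w]
  show "diameter (piece s \<Gamma> w) \<le> ratio w * diameter \<Gamma>"
    unfolding piece_def by (rule diameter_scaled_le[OF r bounded_\<Gamma> image_dist_le[OF dist_word_map[OF w]]])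
  have "diameter \<Gamma> \<le> (1 / ratio w) * diameter (piece s \<Gamma> w)"
  proof (rule diameter_scaled_le)
    fix x y assume "x \<in> \<Gamma>" "y \<in> \<Gamma>"
    then show "\<exists>x'\<in>piece s \<Gamma> w. \<exists>y'\<in>piece s \<Gamma> w. dist x y \<le> 1 / ratio w * dist x' y'"
      using r by (intro bexI[of _ "word_map s w x"] bexI[of _ "word_map s w y"])
        (auto simp: piece_def dist_word_map[OF w])
  qed (use r compact_piece[OF w] in \<open>auto intro: compact_imp_bounded\<close>)
  then show "ratio w * diameter \<Gamma> \<le> diameter (piece s \<Gamma> w)"
    using r by (simp add: field_simps)
qed

lemma measure_piece_append:
  assumes "set u \<subseteq> {1..M}" "set v \<subseteq> {1..M}"
  shows "measure (hausdorff_on \<Gamma>) (piece s \<Gamma> (u @ v))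
    = ratio u powr hausdorff_dim \<Gamma> * measure (hausdorff_on \<Gamma>) (piece s \<Gamma> v)"
  unfolding piece_append
proof (rule measure_hausdorff_on_similarity[OF ratio_pos[OF assms(1)] dist_word_map[OF assms(1)]])
  show "compact (word_map s u ` piece s \<Gamma> v)" "word_map s u ` piece s \<Gamma> v \<subseteq> \<Gamma>"
    using compact_piece[of "u @ v"] piece_subset[of "u @ v"] assms by (auto simp: piece_append)
qed (use assms compact_\<Gamma> compact_piece piece_subset in auto)

lemma measure_piece:
  "set w \<subseteq> {1..M} \<Longrightarrow> measure (hausdorff_on \<Gamma>) (piece s \<Gamma> w)
    = ratio w powr hausdorff_dim \<Gamma> * measure (hausdorff_on \<Gamma>) \<Gamma>"
  using measure_piece_append[of w "[]"] by simp

section \<open>Separation and nesting of pieces\<close>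

lemma first_level_separation:
  obtains \<delta> where "0 < \<delta>"
    "\<And>m m' x y. m \<in> {1..M} \<Longrightarrow> m' \<in> {1..M} \<Longrightarrow> m \<noteq> m' \<Longrightarrow> x \<in> s m ` \<Gamma> \<Longrightarrow> y \<in> s m' ` \<Gamma> \<Longrightarrow> \<delta> \<le> dist x y"
proof -
  have comp: "compact (s m ` \<Gamma>)" if "m \<in> {1..M}" for m
    using compact_piece[of "[m]"] that by (simp add: piece_def)
  have "\<exists>\<delta>>0. \<forall>x\<in>s m ` \<Gamma>. \<forall>y\<in>(\<Union>m'\<in>{1..M} - {m}. s m' ` \<Gamma>). \<delta> \<le> dist x y" if m: "m \<in> {1..M}" for m
  proof (rule separate_compact_closed)
    show "closed (\<Union>m'\<in>{1..M} - {m}. s m' ` \<Gamma>)"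
      using comp by (intro closed_UN) (auto intro: compact_imp_closed)
    show "s m ` \<Gamma> \<inter> (\<Union>m'\<in>{1..M} - {m}. s m' ` \<Gamma>) = {}"
      using disjoint m unfolding disjoint_family_on_def by blast
  qed (use comp m in auto)
  then obtain \<delta> where \<delta>: "\<And>m. m \<in> {1..M} \<Longrightarrow> 0 < \<delta> m"
    "\<And>m x y. m \<in> {1..M} \<Longrightarrow> x \<in> s m ` \<Gamma> \<Longrightarrow> y \<in> (\<Union>m'\<in>{1..M} - {m}. s m' ` \<Gamma>) \<Longrightarrow> \<delta> m \<le> dist x y"
    by metis
  \<comment> \<open>A minimum over the finitely many first-level pieces makes the gap
    uniform.\<close>
  show thesis
  proof (rule that[of "Min (\<delta> ` {1..M})"])
    show "0 < Min (\<delta> ` {1..M})" using M \<delta>(1) by (subst Min_gr_iff) auto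
    fix m m' x y
    assume m: "m \<in> {1..M}" "m' \<in> {1..M}" "m \<noteq> m'" and xy: "x \<in> s m ` \<Gamma>" "y \<in> s m' ` \<Gamma>"
    have "Min (\<delta> ` {1..M}) \<le> \<delta> m" using m by simp
    also have "\<dots> \<le> dist x y" using m xy by (intro \<delta>(2)) auto
    finally show "Min (\<delta> ` {1..M}) \<le> dist x y" .
  qed
qed

lemma piece_separation:
  obtains \<delta> where "0 < \<delta>"
    "\<And>w x y. set w \<subseteq> {1..M} \<Longrightarrow> x \<in> piece s \<Gamma> w \<Longrightarrow> y \<in> \<Gamma> - piece s \<Gamma> w \<Longrightarrow> ratio w * \<delta> \<le> dist x y"
proof -
  obtain \<delta> where \<delta>: "0 < \<delta>"
    "\<And>m m' x y. m \<in> {1..M} \<Longrightarrow> m' \<in> {1..M} \<Longrightarrow> m \<noteq> m' \<Longrightarrow> x \<in> s m ` \<Gamma> \<Longrightarrow> y \<in> s m' ` \<Gamma> \<Longrightarrow> \<delta> \<le> dist x y"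
    using first_level_separation by blast
  have "ratio w * \<delta> \<le> dist x y"
    if "set w \<subseteq> {1..M}" "x \<in> piece s \<Gamma> w" "y \<in> \<Gamma> - piece s \<Gamma> w" for w x y
    using that
  proof (induction w arbitrary: x y)
    case (Cons m w)
    then have m: "m \<in> {1..M}" and w: "set w \<subseteq> {1..M}" by auto
    obtain x' where x': "x = s m x'" "x' \<in> piece s \<Gamma> w" using Cons.prems(2) by (auto simp: piece_Cons)
    obtain m' y' where y': "m' \<in> {1..M}" "y = s m' y'" "y' \<in> \<Gamma>" using Cons.prems(3) \<Gamma>_eq by blast
    show ?case
    proof (cases "m' = m")
      case True
      then have "y' \<notin> piece s \<Gamma> w" using Cons.prems(3) y' by (auto simp: piece_Cons)
      then have "ratio w * \<delta> \<le> dist x' y'" using Cons.IH[OF w x'(2)] y' by auto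
      then have "\<rho> m * (ratio w * \<delta>) \<le> \<rho> m * dist x' y'" using similarity_facts(1)[OF m] by simp
      then show ?thesis using True x' y' similarity_facts(3)[OF m] by (simp add: mult.assoc)
    next
      case False
      have "x' \<in> \<Gamma>" using x' piece_subset[OF w] by auto
      then have "\<delta> \<le> dist x y" using False x' y' m by (intro \<delta>(2)[of m m']) auto
      moreover have "ratio (m # w) * \<delta> \<le> 1 * \<delta>"
        using \<delta>(1) ratio_le_1[OF Cons.prems(1)] by (intro mult_right_mono) auto
      ultimately show ?thesis by simp
    qed
  qed simp
  with \<delta>(1) show thesis by (rule that)
qed

text \<open>The words are compared letter by letter: different letters give disjoint first-level
  pieces, and a common letter is removed because \<open>s m\<close> is injective.\<close>

lemma piece_disjoint_or_prefix:
  assumes "set u \<subseteq> {1..M}" "set v \<subseteq> {1..M}"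
  shows "piece s \<Gamma> u \<inter> piece s \<Gamma> v = {} \<or> (\<exists>w. v = u @ w) \<or> (\<exists>w. u = v @ w)"
  using assms
proof (induction u arbitrary: v)
  case (Cons m u)
  show ?case
  proof (cases v)
    case [simp]: (Cons m' v')
    have sub: "piece s \<Gamma> (m # u) \<subseteq> s m ` \<Gamma>" "piece s \<Gamma> (m' # v') \<subseteq> s m' ` \<Gamma>"
      using Cons.prems piece_subset[of u] piece_subset[of v'] by (auto simp: piece_Cons)
    show ?thesis
    proof (cases "m = m'")
      case True
      have "inj (s m)" using similarity_facts(1,3)[of m] Cons.prems by (intro injI) (metis dist_eq_0_iff mult_eq_0_iff less_irrefl list.set_intros(1) subsetD)
      then show ?thesis
        using Cons.IH[of v'] Cons.prems True by (auto simp: piece_Cons image_Int[symmetric])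
    next
      case False
      then have "s m ` \<Gamma> \<inter> s m' ` \<Gamma> = {}"
        using disjoint Cons.prems by (auto simp: disjoint_family_on_def)
      then show ?thesis using sub by auto
    qed
  qed simp
qed simp

section \<open>Words of mesh size h\<close>

lemma mesh_words_valid: "w \<in> mesh_words M s \<Gamma> h \<Longrightarrow> set w \<subseteq> {1..M}"
  by (auto simp: mesh_words_def split: if_splits)

lemma mesh_words_ratio_le: "w \<in> mesh_words M s \<Gamma> h \<Longrightarrow> ratio w * diameter \<Gamma> \<le> h"
  using diameter_piece[of w] by (auto simp: mesh_words_def split: if_splits)

text \<open>By the comparison of words, only a proper prefix u of v could be in the way. Then u is
  still a prefix of \<open>butlast v\<close>, whose piece has diameter above h, while the piece of u
  has diameter at most h. For h = diameter \<Gamma> there is just one mesh word, and u \<noteq> v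
  cannot occur.\<close>

lemma mesh_words_disjoint:
  assumes u: "u \<in> mesh_words M s \<Gamma> h" and v: "v \<in> mesh_words M s \<Gamma> h" and "u \<noteq> v"
  shows "piece s \<Gamma> u \<inter> piece s \<Gamma> v = {}"
proof -
  have False if u: "u \<in> mesh_words M s \<Gamma> h" and v: "v \<in> mesh_words M s \<Gamma> h" and "u \<noteq> v" and w: "v = u @ w" for u v w
  proof -
    have "w \<noteq> []" using \<open>u \<noteq> v\<close> w by auto
    then have b: "butlast v = u @ butlast w" using w by (simp add: butlast_append)
    have "h \<noteq> diameter \<Gamma>" using u v \<open>u \<noteq> v\<close> by (auto simp: mesh_words_def)
    then have "h < diameter (piece s \<Gamma> (u @ butlast w))" using v b by (simp add: mesh_words_def)
    also have "\<dots> \<le> diameter (piece s \<Gamma> u)"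
      using mesh_words_valid[OF u] mesh_words_valid[OF v] w
      by (intro diameter_subset piece_append_subset compact_imp_bounded compact_piece) (auto dest: in_set_butlastD)
    also have "\<dots> \<le> h" using u \<open>h \<noteq> diameter \<Gamma>\<close> by (simp add: mesh_words_def)
    finally show False by simp
  qed
  then show ?thesis
    using piece_disjoint_or_prefix[of u v] mesh_words_valid assms by metis
qed

text \<open>The constant is the smallest contraction ratio: the parent piece has diameter above h,
  and one more letter shrinks it at most by that factor. For the empty word the claim reduces to the
  constant being at most 1.\<close>

lemma mesh_words_ratio_ge:
  obtains c where "0 < c" "\<And>h w. h \<le> diameter \<Gamma> \<Longrightarrow> w \<in> mesh_words M s \<Gamma> h \<Longrightarrow> c * h \<le> ratio w * diameter \<Gamma>"
proof
  let ?c = "Min (\<rho> ` {1..M})"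
  show c: "0 < ?c" using M similarity_facts(1) by (subst Min_gr_iff) auto
  have "?c \<le> \<rho> 1" using M by (intro Min_le) auto
  also have "\<dots> \<le> 1" using M similarity_facts(2)[of 1] by simp
  finally have c1: "?c \<le> 1" .
  fix h w assume h: "h \<le> diameter \<Gamma>" and w: "w \<in> mesh_words M s \<Gamma> h"
  have D: "0 \<le> diameter \<Gamma>" using bounded_\<Gamma> by (rule diameter_ge_0)
  show "?c * h \<le> ratio w * diameter \<Gamma>"
  proof (cases "h = diameter \<Gamma>")
    case True
    then show ?thesis using w c c1 D by (simp add: mesh_words_def mult_left_le_one_le)
  next
    case False
    then have w': "w \<noteq> []" "set w \<subseteq> {1..M}" "h < diameter (piece s \<Gamma> (butlast w))"
      using w by (auto simp: mesh_words_def)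
    have bv: "set (butlast w) \<subseteq> {1..M}" using w'(2) by (auto dest: in_set_butlastD)
    have "last w \<in> {1..M}" using w' last_in_set[of w] by blast
    then have cl: "?c \<le> \<rho> (last w)" by simp
    have "?c * h \<le> ?c * (ratio (butlast w) * diameter \<Gamma>)"
      using w'(3) c diameter_piece[OF bv] by simp
    also have "\<dots> \<le> \<rho> (last w) * (ratio (butlast w) * diameter \<Gamma>)"
      using cl ratio_pos[OF bv] D by (intro mult_right_mono) auto
    also have "\<dots> = ratio (butlast w @ [last w]) * diameter \<Gamma>" by (simp only: ratio_simps) simp
    finally show ?thesis using w'(1) by simp
  qed
qed

end

section \<open>Sobolev norms of sums of bumps\<close>

definition bump :: "'a::euclidean_space \<Rightarrow> complex" where
  "bump x = complex_of_real (flat 0 (1 - x \<bullet> x))"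

lemma bump_support: "1 < norm x \<Longrightarrow> bump x = 0"
  by (simp add: bump_def flat_def norm_eq_sqrt_inner)

lemma test_function_bump: "test_function bump"
  by (rule test_functionI[where R=1])
     (use bump_support in \<open>auto simp: bump_def[abs_def] Ck_function_flat not_less[symmetric]\<close>)

lemma flat_0_bounds: "0 \<le> flat 0 t" "flat 0 t \<le> 1"
  by (auto simp: flat_def)

text \<open>The number is the value of the bump on the sphere of radius 1 / 2, since 1 - 1 / 4 = 3 /
  4 has the inverse 4 / 3.\<close>

lemma flat_0_inner_ge:
  assumes "norm x \<le> 1 / 2"
  shows "exp (- 4 / 3) \<le> flat 0 (1 - x \<bullet> x)"
proof -
  have "x \<bullet> x \<le> (1 / 2)\<^sup>2"
    using assms unfolding power2_norm_eq_inner[symmetric] by (intro power_mono) auto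
  then have "3 / 4 \<le> 1 - x \<bullet> x" by (simp add: power2_eq_square)
  then have "inverse (1 - x \<bullet> x) \<le> inverse (3 / 4)" by (intro le_imp_inverse_le) auto
  then show ?thesis using \<open>3 / 4 \<le> 1 - x \<bullet> x\<close> by (simp add: flat_def)
qed

lemma test_function_lincomb:
  assumes f: "test_function f" and r: "0 < r"
  shows "test_function (\<lambda>x. \<Sum>i\<in>I. a i * f ((1 / r) *\<^sub>R (x - c i)))"
proof (cases "finite I")
  case True
  obtain R where R: "0 < R" "\<And>x. R < norm x \<Longrightarrow> f x = 0"
    using test_function_support[OF f] by blast
  show ?thesis
  proof (rule test_functionI)
    show "Ck_function k (\<lambda>x. \<Sum>i\<in>I. a i * f ((1 / r) *\<^sub>R (x - c i)))" for k
      using f by (intro Ck_function_sum Ck_function_mult Ck_function_const Ck_function_affine)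
        (simp add: test_function_def)
    fix x assume "(\<Sum>i\<in>I. a i * f ((1 / r) *\<^sub>R (x - c i))) \<noteq> 0"
    then obtain i where i: "i \<in> I" "a i * f ((1 / r) *\<^sub>R (x - c i)) \<noteq> 0"
      by (rule sum.not_neutral_contains_not_neutral)
    then have "f ((1 / r) *\<^sub>R (x - c i)) \<noteq> 0" by simp
    then have "norm ((1 / r) *\<^sub>R (x - c i)) \<le> R" using R(2) not_le by blast
    then have "norm (x - c i) \<le> R * r" using r by (simp add: divide_le_eq)
    moreover have "norm x \<le> norm (x - c i) + norm (c i)"
      using norm_triangle_ineq[of "x - c i" "c i"] by simp
    moreover have "norm (c i) \<le> (\<Sum>i\<in>I. norm (c i))"
      using True i(1) by (intro member_le_sum) auto
    ultimately show "norm x \<le> R * r + (\<Sum>i\<in>I. norm (c i))" by linarith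
  qed
next
  case False
  then show ?thesis by (auto intro!: test_functionI[where R=0] Ck_function_const)
qed

lemma dir_deriv_lincomb:
  assumes f: "test_function f"
  shows "dir_deriv v (\<lambda>x. \<Sum>i\<in>I. a i * f (q *\<^sub>R (x - c i)))
    = (\<lambda>x. \<Sum>i\<in>I. (a i * complex_of_real q) * dir_deriv v f (q *\<^sub>R (x - c i)))"
proof
  fix x
  have lin: "linear (frechet_derivative f (at y))" for y
    using test_function_has_derivative[OF f] by (rule has_derivative_linear)
  have "((\<lambda>x. q *\<^sub>R (x - c i)) has_derivative (\<lambda>v. q *\<^sub>R v)) (at x)" for i
    by (auto intro!: derivative_eq_intros)
  from has_derivative_compose[OF this test_function_has_derivative[OF f]]
  have "((\<lambda>x. \<Sum>i\<in>I. a i * f (q *\<^sub>R (x - c i))) has_derivative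
      (\<lambda>v. \<Sum>i\<in>I. a i * frechet_derivative f (at (q *\<^sub>R (x - c i))) (q *\<^sub>R v))) (at x)"
    by (intro has_derivative_sum has_derivative_mult_right)
  then show "dir_deriv v (\<lambda>x. \<Sum>i\<in>I. a i * f (q *\<^sub>R (x - c i))) x
    = (\<Sum>i\<in>I. (a i * complex_of_real q) * dir_deriv v f (q *\<^sub>R (x - c i)))"
    by (simp add: frechet_derivative_eqI linear_cmul[OF lin] scaleR_conv_of_real mult.assoc)
qed

lemma dir_deriv_iterate_lincomb:
  assumes f: "test_function f"
  shows "(dir_deriv v ^^ k) (\<lambda>x. \<Sum>i\<in>I. a i * f (q *\<^sub>R (x - c i)))
    = (\<lambda>x. \<Sum>i\<in>I. (a i * complex_of_real (q ^ k)) * (dir_deriv v ^^ k) f (q *\<^sub>R (x - c i)))"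
proof (induction k)
  case (Suc k)
  show ?case
    unfolding funpow.simps o_apply Suc dir_deriv_lincomb[OF test_function_dir_deriv_iterate[OF f]]
    by (simp add: mult_ac)
qed simp

lemma cmod_sum_power2_disjoint:
  assumes "finite I" "\<And>i j. i \<in> I \<Longrightarrow> j \<in> I \<Longrightarrow> i \<noteq> j \<Longrightarrow> z i = 0 \<or> z j = 0"
  shows "(cmod (\<Sum>i\<in>I. z i))\<^sup>2 = (\<Sum>i\<in>I. (cmod (z i))\<^sup>2)"
  using assms
proof (induction I)
  case (insert i I)
  then have IH: "(cmod (\<Sum>i\<in>I. z i))\<^sup>2 = (\<Sum>i\<in>I. (cmod (z i))\<^sup>2)" by blast
  show ?case
  proof (cases "z i = 0")
    case False
    then have "\<forall>j\<in>I. z j = 0" using insert.prems[of i] insert.hyps by blast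
    then show ?thesis using insert.hyps by simp
  qed (use insert.hyps IH in simp)
qed simp

text \<open>The closed balls of radius r around the centres are disjoint, so the cross terms vanish
  pointwise and each index contributes at most the volume of one ball. The profile f is kept general
  because the estimate is needed for the bump and for its derivatives.\<close>

lemma integral_lincomb_power2_le:
  fixes f :: "'a::euclidean_space \<Rightarrow> complex"
  assumes f [measurable]: "f \<in> borel_measurable borel" and B: "\<And>x. cmod (f x) \<le> B"
    and supp: "\<And>x. 1 < norm x \<Longrightarrow> f x = 0" and r: "0 < r" and I: "finite I"
    and sep: "\<And>i j. i \<in> I \<Longrightarrow> j \<in> I \<Longrightarrow> i \<noteq> j \<Longrightarrow> 2 * r < dist (c i) (c j)"
  shows "(LINT x|lborel. (cmod (\<Sum>i\<in>I. a i * f ((1 / r) *\<^sub>R (x - c i))))\<^sup>2)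
    \<le> B\<^sup>2 * unit_ball_vol (real DIM('a)) * r ^ DIM('a) * (\<Sum>i\<in>I. (cmod (a i))\<^sup>2)"
proof -
  let ?z = "\<lambda>x i. a i * f ((1 / r) *\<^sub>R (x - c i))"
  have z0: "?z x i = 0" if "x \<notin> cball (c i) r" for x i
    using that r supp[of "(1 / r) *\<^sub>R (x - c i)"] by (simp add: dist_norm norm_minus_commute)
  have le: "(cmod (\<Sum>i\<in>I. ?z x i))\<^sup>2 \<le> (\<Sum>i\<in>I. (cmod (a i))\<^sup>2 * B\<^sup>2 * indicator (cball (c i) r) x)" for x
  proof -
    have "?z x i = 0 \<or> ?z x j = 0" if ij: "i \<in> I" "j \<in> I" "i \<noteq> j" for i j
    proof (rule ccontr)
      assume "\<not> ?thesis"
      then have "dist (c i) x \<le> r" "dist (c j) x \<le> r" using z0 by auto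
      then show False using sep[OF ij] dist_triangle2[of "c i" "c j" x] by linarith
    qed
    then have "(cmod (\<Sum>i\<in>I. ?z x i))\<^sup>2 = (\<Sum>i\<in>I. (cmod (?z x i))\<^sup>2)"
      by (intro cmod_sum_power2_disjoint I)
    also have "\<dots> \<le> (\<Sum>i\<in>I. (cmod (a i))\<^sup>2 * B\<^sup>2 * indicator (cball (c i) r) x)"
    proof (rule sum_mono)
      fix i
      show "(cmod (?z x i))\<^sup>2 \<le> (cmod (a i))\<^sup>2 * B\<^sup>2 * indicator (cball (c i) r) x"
      proof (cases "x \<in> cball (c i) r")
        case True
        have "(cmod (?z x i))\<^sup>2 \<le> (cmod (a i))\<^sup>2 * B\<^sup>2"
          unfolding norm_mult power_mult_distrib by (intro mult_left_mono power_mono B) auto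
        then show ?thesis using True by simp
      qed (use z0 in simp)
    qed
    finally show ?thesis .
  qed
  have int: "integrable lborel (\<lambda>x. \<Sum>i\<in>I. (cmod (a i))\<^sup>2 * B\<^sup>2 * indicator (cball (c i) r) x)"
    by (intro Bochner_Integration.integrable_sum integrable_mult_right integrable_indicator_cball)
  have "(LINT x|lborel. (cmod (\<Sum>i\<in>I. ?z x i))\<^sup>2)
      \<le> (LINT x|lborel. (\<Sum>i\<in>I. (cmod (a i))\<^sup>2 * B\<^sup>2 * indicator (cball (c i) r) x))"
    by (rule integral_mono[OF Bochner_Integration.integrable_bound[OF int] int le])
       (use le in \<open>auto intro: order_trans[OF _ abs_ge_self]\<close>)
  also have "\<dots> = (\<Sum>i\<in>I. (cmod (a i))\<^sup>2 * B\<^sup>2 * measure lborel (cball (c i) r))"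
    by (subst Bochner_Integration.integral_sum)
       (auto intro!: integrable_mult_right integrable_indicator_cball)
  also have "\<dots> = B\<^sup>2 * unit_ball_vol (real DIM('a)) * r ^ DIM('a) * (\<Sum>i\<in>I. (cmod (a i))\<^sup>2)"
    using r by (simp add: content_cball sum_distrib_left mult_ac)
  finally show ?thesis .
qed

text \<open>The order of the quantifiers is the point: C depends on \<kappa>, E and K, but neither
  on h and \<sigma> nor on the number, position or size of the bumps. Every derivative of a rescaled
  bump costs a factor 1 / (\<kappa> h), and the powers of h in the weight estimate compensate
  it.\<close>

lemma sobolev_norm_bump_sum_le:
  assumes \<kappa>: "0 < \<kappa>"
  shows "\<exists>C>0. \<forall>(I :: 'i set) a c h \<sigma>. finite I \<longrightarrow> 0 < h \<longrightarrow> h \<le> E \<longrightarrow> 0 \<le> \<sigma> \<longrightarrow> \<sigma> \<le> real K \<longrightarrow>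
    (\<forall>i\<in>I. \<forall>j\<in>I. i \<noteq> j \<longrightarrow> 2 * (\<kappa> * h) < dist (c i) (c j)) \<longrightarrow>
    (sobolev_norm \<sigma> (\<lambda>x. \<Sum>i\<in>I. a i * bump ((1 / (\<kappa> * h)) *\<^sub>R (x - c i :: 'a::euclidean_space))))\<^sup>2
      \<le> C * h powr (- 2 * \<sigma>) * h ^ DIM('a) * (\<Sum>i\<in>I. (cmod (a i))\<^sup>2)"
proof -
  let ?n = "DIM('a)" and ?u = "unit_ball_vol (real DIM('a))"
  let ?D = "\<lambda>b::'a. (dir_deriv b ^^ K) bump"
  note f = test_function_bump[where 'a='a] and supp = bump_support[where 'a='a]
  have D: "test_function (?D b)" for b by (rule test_function_dir_deriv_iterate[OF f])
  obtain B0 where B0: "0 < B0" "\<And>x::'a. cmod (bump x) \<le> B0" using test_function_bounded[OF f] by blast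
  have "\<forall>b. \<exists>B. 0 < B \<and> (\<forall>x. cmod (?D b x) \<le> B)"
  proof
    fix b
    obtain B where "0 < B" "\<And>x. cmod (?D b x) \<le> B" using test_function_bounded[OF D[of b]] by blast
    then show "\<exists>B. 0 < B \<and> (\<forall>x. cmod (?D b x) \<le> B)" by blast
  qed
  from choice[OF this] obtain B where B: "\<And>b. 0 < B b" "\<And>b x. cmod (?D b x) \<le> B b" by blast
  let ?A = "(max 1 (E\<^sup>2) + real ?n) ^ K"
  let ?S = "B0\<^sup>2 + (\<Sum>b\<in>(Basis::'a set). (1 / \<kappa>) ^ (2 * K) * (B b)\<^sup>2)"
  have S: "0 < ?S" using B0(1) \<kappa> by (intro add_pos_nonneg sum_nonneg) auto
  have A: "0 < ?A" by (intro zero_less_power add_pos_nonneg) auto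
  show ?thesis
  proof (intro exI[of _ "?A * ?u * \<kappa> ^ ?n * ?S"] conjI allI impI)
    show "0 < ?A * ?u * \<kappa> ^ ?n * ?S"
      by (intro mult_pos_pos zero_less_power \<kappa> S A) simp
    fix I :: "'i set" and a and c :: "'i \<Rightarrow> 'a" and h \<sigma> :: real
    assume I: "finite I" and h: "0 < h" "h \<le> E" and \<sigma>: "0 \<le> \<sigma>" "\<sigma> \<le> real K"
      and "\<forall>i\<in>I. \<forall>j\<in>I. i \<noteq> j \<longrightarrow> 2 * (\<kappa> * h) < dist (c i) (c j)"
    then have sep: "\<And>i j. i \<in> I \<Longrightarrow> j \<in> I \<Longrightarrow> i \<noteq> j \<Longrightarrow> 2 * (\<kappa> * h) < dist (c i) (c j)" by blast
    let ?r = "\<kappa> * h"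
    let ?\<phi> = "\<lambda>x. \<Sum>i\<in>I. a i * bump ((1 / ?r) *\<^sub>R (x - c i))"
    let ?a2 = "\<Sum>i\<in>I. (cmod (a i))\<^sup>2"
    have r: "0 < ?r" using \<kappa> h by simp
    have 0: "(LINT x|lborel. (cmod (?\<phi> x))\<^sup>2) \<le> B0\<^sup>2 * ?u * ?r ^ ?n * ?a2"
      by (rule integral_lincomb_power2_le[OF test_function_measurable[OF f] B0(2) supp r I sep])
    have 1: "h ^ (2 * K) * (LINT x|lborel. (cmod ((dir_deriv b ^^ K) ?\<phi> x))\<^sup>2)
        \<le> (1 / \<kappa>) ^ (2 * K) * (B b)\<^sup>2 * ?u * ?r ^ ?n * ?a2" for b
    proof -
      have "(LINT x|lborel. (cmod ((dir_deriv b ^^ K) ?\<phi> x))\<^sup>2)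
          \<le> (B b)\<^sup>2 * ?u * ?r ^ ?n * (\<Sum>i\<in>I. (cmod (a i * complex_of_real ((1 / ?r) ^ K)))\<^sup>2)"
        unfolding dir_deriv_iterate_lincomb[OF f]
        by (rule integral_lincomb_power2_le[OF test_function_measurable[OF D] B(2) dir_deriv_iterate_support[OF supp] r I sep])
      also have "(\<Sum>i\<in>I. (cmod (a i * complex_of_real ((1 / ?r) ^ K)))\<^sup>2) = (1 / ?r) ^ (2 * K) * ?a2"
        unfolding norm_mult power_mult_distrib norm_of_real sum_distrib_left
        by (intro sum.cong refl) (simp add: power_mult[symmetric] mult.commute)
      finally have "h ^ (2 * K) * (LINT x|lborel. (cmod ((dir_deriv b ^^ K) ?\<phi> x))\<^sup>2)
          \<le> h ^ (2 * K) * ((B b)\<^sup>2 * ?u * ?r ^ ?n * ((1 / ?r) ^ (2 * K) * ?a2))"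
        using h by (intro mult_left_mono) auto
      also have "\<dots> = (h ^ (2 * K) * (1 / ?r) ^ (2 * K)) * (B b)\<^sup>2 * ?u * ?r ^ ?n * ?a2"
        by (simp only: mult_ac)
      \<comment> \<open>Here the dependence on h cancels, so that the derivatives are as harmless as
        the function itself.\<close>
      also have "h ^ (2 * K) * (1 / ?r) ^ (2 * K) = (1 / \<kappa>) ^ (2 * K)"
        using h \<kappa> by (simp flip: power_mult_distrib)
      finally show ?thesis .
    qed
    have "(sobolev_norm \<sigma> ?\<phi>)\<^sup>2 \<le> ?A * h powr (- 2 * \<sigma>) *
        ((LINT x|lborel. (cmod (?\<phi> x))\<^sup>2) + (\<Sum>b\<in>Basis. h ^ (2 * K) * (LINT x|lborel. (cmod ((dir_deriv b ^^ K) ?\<phi> x))\<^sup>2)))"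
      by (rule sobolev_norm_test_function_le[OF test_function_lincomb[OF f r] \<sigma> h])
    also have "\<dots> \<le> ?A * h powr (- 2 * \<sigma>) *
        (B0\<^sup>2 * ?u * ?r ^ ?n * ?a2 + (\<Sum>b\<in>(Basis::'a set). (1 / \<kappa>) ^ (2 * K) * (B b)\<^sup>2 * ?u * ?r ^ ?n * ?a2))"
      using A by (intro mult_left_mono add_mono sum_mono 0 1) auto
    also have "\<dots> = ?A * h powr (- 2 * \<sigma>) * (?S * (?u * ?r ^ ?n * ?a2))"
      by (simp only: distrib_right sum_distrib_right mult.assoc)
    also have "\<dots> = ?A * ?u * \<kappa> ^ ?n * ?S * h powr (- 2 * \<sigma>) * h ^ ?n * ?a2"
      by (simp only: power_mult_distrib mult_ac)
    finally show "(sobolev_norm \<sigma> ?\<phi>)\<^sup>2 \<le> ?A * ?u * \<kappa> ^ ?n * ?S * h powr (- 2 * \<sigma>) * h ^ ?n * ?a2" .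
  qed
qed

section \<open>Test functions as elements of the trace space\<close>

lemma bounded_measurable_L2_space:
  assumes "finite_measure \<mu>" "f \<in> borel_measurable \<mu>" "\<And>x. cmod (f x) \<le> B"
  shows "f \<in> L2_space \<mu>"
proof -
  interpret finite_measure \<mu> by fact
  have "integrable \<mu> (\<lambda>x. (cmod (f x))\<^sup>2)"
    using assms(2,3) by (intro integrable_const_bound[of _ "B\<^sup>2"]) (auto intro!: AE_I2 power_mono)
  then show ?thesis using assms(2) by (simp add: L2_space_def)
qed

text \<open>\<open>fourier_L2\<close> of the zero function is a chosen representative, known to
  vanish only almost everywhere; the passage to \<open>fourier_L1\<close> removes the
  choice.\<close>

lemma sobolev_norm_zero: "sobolev_norm s (\<lambda>x. 0) = 0"
  by (subst sobolev_norm_eq_fourier_L1) (auto simp: L2_space_def fourier_L1_def)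

text \<open>The constant sequence f approximates f in both norms; finiteness of the measure puts the
  bounded function f into the L_2 space on \<Gamma>.\<close>

lemma is_trace_test_function:
  assumes f: "test_function f" "f \<in> sobolev_space s" and fin: "finite_measure (hausdorff_on \<Gamma>)"
  shows "is_trace \<Gamma> s f f"
proof -
  have "f \<in> L2_space (hausdorff_on \<Gamma>)"
    using test_function_bounded[OF f(1)]
    by (metis bounded_measurable_L2_space[OF fin measurable_hausdorff_on[OF test_function_measurable[OF f(1)]]])
  then show ?thesis
    unfolding is_trace_def L2_tendsto_def
    using f by (intro conjI exI[of _ "\<lambda>_. f"]) (auto simp: sobolev_norm_zero L2_norm_def)
qed

text \<open>A test function is an extension of its own trace, so its trace norm is at most its
  Sobolev norm and it competes in the supremum. This is the only access to the dual norm that the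
  estimate requires.\<close>

lemma dual_trace_norm_ge:
  assumes f: "test_function f" "f \<in> sobolev_space (ambient_order \<Gamma> t)"
    and 1: "sobolev_norm (ambient_order \<Gamma> t) f \<le> 1" and fin: "finite_measure (hausdorff_on \<Gamma>)"
  shows "ennreal (cmod (F f)) \<le> dual_trace_norm \<Gamma> t F"
proof -
  note tr = is_trace_test_function[OF f fin]
  have "trace_space_norm \<Gamma> t f \<le> sobolev_norm (ambient_order \<Gamma> t) f"
    unfolding trace_space_norm_def using tr
    by (intro cInf_lower) (auto intro!: bdd_belowI[of _ 0] simp: sobolev_norm_def integral_nonneg_AE)
  with tr 1 show ?thesis
    unfolding dual_trace_norm_def trace_space_def by (intro SUP_upper) auto
qed

section \<open>The inverse estimate\<close>

context disjoint_ifs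
begin

abbreviation \<mu> :: "'a measure" where "\<mu> \<equiv> hausdorff_on \<Gamma>"

abbreviation dimH :: real where "dimH \<equiv> hausdorff_dim \<Gamma>"

lemma dimH_nonneg: "0 \<le> dimH"
  by (rule hausdorff_dim_nonneg[OF bounded_\<Gamma>])

lemma piece_sets: "set w \<subseteq> {1..M} \<Longrightarrow> piece s \<Gamma> w \<in> sets \<mu>"
  by (intro compact_in_sets_hausdorff_on compact_piece piece_subset)

text \<open>For \<open>measure \<mu> \<Gamma> = 0\<close> (which includes the junk case of infinite measure) the basis functions
  vanish because \<open>0 powr (- 1 / 2) = 0\<close>.\<close>

lemma approx_space_trivial:
  assumes "measure \<mu> \<Gamma> = 0" "\<psi> \<in> approx_space M s \<Gamma> h"
  shows "\<psi> = (\<lambda>x. 0)"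
proof -
  obtain W c where W: "W \<subseteq> mesh_words M s \<Gamma> h" "\<psi> = (\<lambda>x. \<Sum>w\<in>W. c w * word_chi s \<Gamma> w x)"
    using assms(2) by (auto simp: approx_space_def)
  have "word_chi s \<Gamma> w x = 0" if "w \<in> W" for w x
    using measure_piece[of w] mesh_words_valid[of w h] W(1) that assms(1)
    by (auto simp: word_chi_def)
  then show ?thesis unfolding W(2) by (intro ext sum.neutral) auto
qed

text \<open>\<open>measure\<close> maps the value infinity to 0, so a positive value already entails
  finiteness.\<close>

lemma finite_measure_if_measure_pos:
  assumes "0 < measure \<mu> \<Gamma>" shows "finite_measure \<mu>"
proof (rule finite_measureI)
  show "emeasure \<mu> (space \<mu>) \<noteq> \<infinity>"
    using assms by (auto simp: measure_def)
qed

lemma measure_piece_pos: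
  "0 < measure \<mu> \<Gamma> \<Longrightarrow> set w \<subseteq> {1..M} \<Longrightarrow> 0 < measure \<mu> (piece s \<Gamma> w)"
  using measure_piece[of w] ratio_pos[of w] by simp

lemma word_chi_disjoint:
  assumes "u \<in> mesh_words M s \<Gamma> h" "v \<in> mesh_words M s \<Gamma> h" "u \<noteq> v"
  shows "word_chi s \<Gamma> u x = 0 \<or> word_chi s \<Gamma> v x = 0"
  using mesh_words_disjoint[OF assms] by (auto simp: word_chi_def)

lemma powr_minus_half_power2:
  "0 < y \<Longrightarrow> (y powr (- 1 / 2))\<^sup>2 = 1 / (y :: real)"
  by (simp add: power2_eq_square powr_add[symmetric] powr_neg_one)

text \<open>The functions \<open>word_chi\<close> for the words of one mesh are orthonormal: their
  supports are disjoint, and the factor \<open>powr (- 1 / 2)\<close> normalises each of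
  them.\<close>

lemma L2_norm_power2_approx:
  assumes pos: "0 < measure \<mu> \<Gamma>" and W: "finite W" "W \<subseteq> mesh_words M s \<Gamma> h"
  shows "(L2_norm \<mu> (\<lambda>x. \<Sum>w\<in>W. c w * word_chi s \<Gamma> w x))\<^sup>2 = (\<Sum>w\<in>W. (cmod (c w))\<^sup>2)"
proof -
  interpret finite_measure \<mu> by (rule finite_measure_if_measure_pos[OF pos])
  have valid: "set w \<subseteq> {1..M}" if "w \<in> W" for w using mesh_words_valid that W(2) by blast
  have pt: "(cmod (\<Sum>w\<in>W. c w * word_chi s \<Gamma> w x))\<^sup>2
      = (\<Sum>w\<in>W. (cmod (c w))\<^sup>2 / measure \<mu> (piece s \<Gamma> w) * indicator (piece s \<Gamma> w) x)" for x
  proof -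
    have "(cmod (\<Sum>w\<in>W. c w * word_chi s \<Gamma> w x))\<^sup>2 = (\<Sum>w\<in>W. (cmod (c w * word_chi s \<Gamma> w x))\<^sup>2)"
    proof (rule cmod_sum_power2_disjoint[OF W(1)])
      fix u v assume "u \<in> W" "v \<in> W" "u \<noteq> v"
      then show "c u * word_chi s \<Gamma> u x = 0 \<or> c v * word_chi s \<Gamma> v x = 0"
        using word_chi_disjoint[of u h v x] W(2) by auto
    qed
    also have "\<dots> = (\<Sum>w\<in>W. (cmod (c w))\<^sup>2 / measure \<mu> (piece s \<Gamma> w) * indicator (piece s \<Gamma> w) x)"
      using powr_minus_half_power2[OF measure_piece_pos[OF pos valid]]
      by (intro sum.cong refl) (simp add: word_chi_def norm_mult power_mult_distrib)
    finally show ?thesis .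
  qed
  have int: "integrable \<mu> (\<lambda>x. (cmod (c w))\<^sup>2 / measure \<mu> (piece s \<Gamma> w) * indicator (piece s \<Gamma> w) x)" if "w \<in> W" for w
    using piece_sets[OF valid[OF that]]
    by (intro integrable_mult_right integrable_real_indicator) (auto simp: less_top[symmetric] emeasure_finite)
  have "(L2_norm \<mu> (\<lambda>x. \<Sum>w\<in>W. c w * word_chi s \<Gamma> w x))\<^sup>2
      = (\<Sum>w\<in>W. LINT x|\<mu>. (cmod (c w))\<^sup>2 / measure \<mu> (piece s \<Gamma> w) * indicator (piece s \<Gamma> w) x)"
    unfolding L2_norm_power2 pt by (rule Bochner_Integration.integral_sum[OF int])
  also have "\<dots> = (\<Sum>w\<in>W. (cmod (c w))\<^sup>2)"
  proof (intro sum.cong refl)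
    fix w assume w: "w \<in> W"
    have "piece s \<Gamma> w \<inter> \<Gamma> = piece s \<Gamma> w" using piece_subset[OF valid[OF w]] by blast
    then show "(LINT x|\<mu>. (cmod (c w))\<^sup>2 / measure \<mu> (piece s \<Gamma> w) * indicator (piece s \<Gamma> w) x) = (cmod (c w))\<^sup>2"
      using measure_piece_pos[OF pos valid[OF w]] by simp
  qed
  finally show ?thesis .
qed

text \<open>The word 1...1 is long enough when \<rho> 1 to the power of its length is below e. The
  same v and x0 are used inside every mesh piece, so the size of the subpiece relative to its mesh
  piece is fixed once and for all.\<close>

lemma base_point:
  assumes e: "0 < e"
  obtains v x0 where "set v \<subseteq> {1..M}" "x0 \<in> piece s \<Gamma> v" "ratio v \<le> e"
proof -
  have 1: "1 \<in> {1..M}" using M by simp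
  have "(\<lambda>l. \<rho> 1 ^ l) \<longlonglongrightarrow> 0"
    using similarity_facts(1,2)[OF 1] by (intro LIMSEQ_power_zero) simp
  then have "eventually (\<lambda>l. \<rho> 1 ^ l < e) sequentially"
    using e by (rule order_tendstoD(2))
  then obtain l where l: "\<rho> 1 ^ l < e" by (auto simp: eventually_sequentially)
  have "ratio (replicate l 1) = \<rho> 1 ^ l" by (induction l) auto
  moreover obtain x0 where "x0 \<in> piece s \<Gamma> (replicate l 1)" using piece_nonempty by blast
  ultimately show thesis using l 1 by (intro that[of "replicate l 1" x0]) auto
qed

lemma inverse_estimate:
  assumes pos: "0 < measure \<mu> \<Gamma>"
  shows "\<exists>c::real. 0 < c \<and>
    (\<forall>h \<psi> t. 0 < h \<longrightarrow> h \<le> diameter \<Gamma> \<longrightarrow> \<psi> \<in> approx_space M s \<Gamma> h \<longrightarrow>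
       0 < t \<longrightarrow> t \<le> real J \<longrightarrow>
       ennreal (L2_norm \<mu> \<psi>) \<le> ennreal (c * h powr (- t)) * dual_trace_norm \<Gamma> t (L2_embedding \<Gamma> \<psi>))"
proof (cases "0 < diameter \<Gamma>")
  \<comment> \<open>No h satisfies 0 < h \<le> diameter \<Gamma>, so any constant will do.\<close>
  case False
  then show ?thesis by (intro exI[of _ 1]) auto
next
  case D: True
  interpret finite_measure \<mu> by (rule finite_measure_if_measure_pos[OF pos])
  let ?D = "diameter \<Gamma>" and ?m = "measure \<mu> \<Gamma>" and ?n = "DIM('a)"
  obtain \<delta> where \<delta>: "0 < \<delta>" "\<And>w x y. set w \<subseteq> {1..M} \<Longrightarrow> x \<in> piece s \<Gamma> w \<Longrightarrow> y \<in> \<Gamma> - piece s \<Gamma> w \<Longrightarrow> ratio w * \<delta> \<le> dist x y"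
    using piece_separation by blast
  obtain c0 where c0: "0 < c0" "\<And>h w. h \<le> ?D \<Longrightarrow> w \<in> mesh_words M s \<Gamma> h \<Longrightarrow> c0 * h \<le> ratio w * ?D"
    using mesh_words_ratio_ge by blast
  \<comment> \<open>A mesh word has ratio at least c0 h / \<open>?D\<close>, so its piece is
    separated from the rest of \<Gamma> by at least c0 h \<delta> / \<open>?D\<close> = 4 \<kappa>
    h, which is four bump radii.\<close>
  define \<kappa> where "\<kappa> = c0 * \<delta> / (4 * ?D)"
  have \<kappa>: "0 < \<kappa>" using c0 \<delta> D by (simp add: \<kappa>_def)
  \<comment> \<open>The bound \<kappa> / 2 keeps the subpiece for \<open>w @ v\<close> within half a
    bump radius of the centre, for every mesh word w.\<close>
  obtain v x0 where v: "set v \<subseteq> {1..M}" "x0 \<in> piece s \<Gamma> v" "ratio v \<le> \<kappa> / 2"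
    using base_point[of "\<kappa> / 2"] \<kappa> by auto
  \<comment> \<open>The order \<sigma> = t + (n - d) / 2 is at most J + n for all t in question, so
    C can be fixed before h, \<psi> and t.\<close>
  obtain C where C: "0 < C" "\<forall>(I :: nat list set) a (c :: nat list \<Rightarrow> 'a) h \<sigma>.
      finite I \<longrightarrow> 0 < h \<longrightarrow> h \<le> ?D \<longrightarrow> 0 \<le> \<sigma> \<longrightarrow> \<sigma> \<le> real (J + ?n) \<longrightarrow>
      (\<forall>i\<in>I. \<forall>j\<in>I. i \<noteq> j \<longrightarrow> 2 * (\<kappa> * h) < dist (c i) (c j)) \<longrightarrow>
      (sobolev_norm \<sigma> (\<lambda>x. \<Sum>i\<in>I. a i * bump ((1 / (\<kappa> * h)) *\<^sub>R (x - c i))))\<^sup>2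
        \<le> C * h powr (- 2 * \<sigma>) * h ^ ?n * (\<Sum>i\<in>I. (cmod (a i))\<^sup>2)"
    using sobolev_norm_bump_sum_le[OF \<kappa>, where E="?D" and K="J + ?n" and 'i="nat list" and 'a='a]
    by (elim exE conjE) (rule that)
  \<comment> \<open>A mesh piece has measure at least (c0 h / \<open>?D\<close>)^d times
    \<open>?m\<close>; the reciprocal of this bound, without its power of h, is the factor that
    turns C into \<open>C2\<close>.\<close>
  define C2 where "C2 = C / ?m * (?D / c0) powr dimH"
  \<comment> \<open>The bump of w is at least exp (- 4 / 3) on the subpiece for
    \<open>w @ v\<close>, which carries the share \<open>ratio v powr dimH\<close> of the measure of
    the piece of w. So \<open>q\<close> times that measure bounds the integral of the bump from
    below.\<close>
  define q where "q = exp (- 4 / 3) * ratio v powr dimH"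
  have C2: "0 < C2" using C(1) pos D c0 by (simp add: C2_def)
  have q: "0 < q" using ratio_pos[OF v(1)] by (simp add: q_def)
  show ?thesis
  proof (intro exI[of _ "sqrt C2 / q"] conjI allI impI)
    show "0 < sqrt C2 / q" using C2 q by simp
    fix h \<psi> t
    assume h: "0 < h" "h \<le> ?D" and \<psi>: "\<psi> \<in> approx_space M s \<Gamma> h" and t: "0 < t" "t \<le> real J"
    obtain W c where W: "finite W" "W \<subseteq> mesh_words M s \<Gamma> h" and \<psi>_eq: "\<psi> = (\<lambda>x. \<Sum>w\<in>W. c w * word_chi s \<Gamma> w x)"
      using \<psi> by (auto simp: approx_space_def)
    let ?S = "\<Sum>w\<in>W. (cmod (c w))\<^sup>2" and ?\<mu>w = "\<lambda>w. measure \<mu> (piece s \<Gamma> w)"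
    let ?x = "\<lambda>w. word_map s w x0"
    have S: "0 \<le> ?S" by (intro sum_nonneg) simp
    have L2: "L2_norm \<mu> \<psi> = sqrt ?S"
      unfolding \<psi>_eq using L2_norm_power2_approx[OF pos W, of c] by (intro real_sqrt_unique[symmetric]) auto
    have mesh: "w \<in> mesh_words M s \<Gamma> h" and valid: "set w \<subseteq> {1..M}" if "w \<in> W" for w
      using mesh_words_valid that W(2) by blast+
    have \<mu>w: "0 < ?\<mu>w w" if "w \<in> W" for w by (rule measure_piece_pos[OF pos valid[OF that]])
    have x: "?x w \<in> piece s \<Gamma> w" if "w \<in> W" for w
      using piece_append_subset[OF v(1), of w] v(2) by (auto simp: piece_append)
    have sep: "4 * (\<kappa> * h) \<le> dist (?x w) y" if w: "w \<in> W" and y: "y \<in> \<Gamma>" "y \<notin> piece s \<Gamma> w" for w y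
    proof -
      have "4 * (\<kappa> * h) = c0 * h / ?D * \<delta>" using D by (simp add: \<kappa>_def)
      also have "\<dots> \<le> ratio w * \<delta>"
        using c0(2)[OF h(2) mesh[OF w]] D \<delta>(1) by (intro mult_right_mono) (auto simp: divide_le_eq)
      also have "\<dots> \<le> dist (?x w) y" using w y x by (intro \<delta>(2)[OF valid]) auto
      finally show ?thesis .
    qed
    have r: "0 < \<kappa> * h" using \<kappa> h by simp
    have centers: "2 * (\<kappa> * h) < dist (?x u) (?x w)" if uw: "u \<in> W" "w \<in> W" "u \<noteq> w" for u w
    proof -
      have "?x w \<notin> piece s \<Gamma> u"
        using mesh_words_disjoint[OF mesh[OF uw(1)] mesh[OF uw(2)] uw(3)] x[OF uw(2)] by blast
      moreover have "?x w \<in> \<Gamma>" using x[OF uw(2)] piece_subset[OF valid[OF uw(2)]] by blast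
      ultimately show ?thesis using sep[OF uw(1)] r by fastforce
    qed
    show "ennreal (L2_norm \<mu> \<psi>) \<le> ennreal (sqrt C2 / q * h powr (- t)) * dual_trace_norm \<Gamma> t (L2_embedding \<Gamma> \<psi>)"
    proof (cases "?S = 0")
      case True
      then show ?thesis using L2 by simp
    next
      case False
      then have S: "0 < ?S" using S by simp
      \<comment> \<open>\<open>?N\<close> bounds the Sobolev norm of the sum of bumps before
        scaling; the division by it makes g admissible in the supremum that defines the dual norm.
        It is nonzero because \<open>?S\<close> is.\<close>
      let ?N = "sqrt C2 * h powr (- t) * sqrt ?S"
      have N: "0 < ?N" using C2 h S by simp
      let ?\<sigma> = "ambient_order \<Gamma> t"
      let ?a = "\<lambda>w. c w * complex_of_real (?\<mu>w w powr (- 1 / 2) / ?N)"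
      let ?b = "\<lambda>w x. bump ((1 / (\<kappa> * h)) *\<^sub>R (x - ?x w))"
      let ?\<beta> = "\<lambda>w x. flat 0 (1 - ((1 / (\<kappa> * h)) *\<^sub>R (x - ?x w)) \<bullet> ((1 / (\<kappa> * h)) *\<^sub>R (x - ?x w)))"
      define g where "g = (\<lambda>x. \<Sum>w\<in>W. ?a w * ?b w x)"
      have \<sigma>0: "0 \<le> ?\<sigma>"
        using hausdorff_dim_le_DIM[OF bounded_\<Gamma>] t by (simp add: ambient_order_def)
      have "(real ?n - dimH) / 2 \<le> real ?n" using dimH_nonneg by simp
      then have "?\<sigma> \<le> real (J + ?n)" using t unfolding ambient_order_def of_nat_add by linarith
      with \<sigma>0 have \<sigma>: "0 \<le> ?\<sigma>" "?\<sigma> \<le> real (J + ?n)" by blast+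
      have g: "test_function g"
        unfolding g_def by (rule test_function_lincomb[OF test_function_bump r])
      have "(sobolev_norm ?\<sigma> g)\<^sup>2 \<le> C * h powr (- 2 * ?\<sigma>) * h ^ ?n * (\<Sum>w\<in>W. (cmod (?a w))\<^sup>2)"
        unfolding g_def by (rule C(2)[rule_format, OF W(1) h \<sigma> centers])
      also have "\<dots> \<le> C * h powr (- 2 * ?\<sigma>) * h ^ ?n * (\<Sum>w\<in>W. (cmod (c w))\<^sup>2 * ((?D / c0) powr dimH * h powr (- dimH) / ?m / ?N\<^sup>2))"
      proof (intro mult_left_mono sum_mono)
        fix w assume w: "w \<in> W"
        have "(c0 * h / ?D) powr dimH \<le> ratio w powr dimH"
          using c0 h D dimH_nonneg c0(2)[OF h(2) mesh[OF w]] by (intro powr_mono2) (auto simp: divide_le_eq)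
        then have "(c0 * h / ?D) powr dimH * ?m \<le> ?\<mu>w w"
          using pos by (simp add: measure_piece[OF valid[OF w]])
        then have "1 / ?\<mu>w w \<le> 1 / ((c0 * h / ?D) powr dimH * ?m)"
          using pos c0 h D by (intro divide_left_mono) (auto intro!: mult_pos_pos \<mu>w[OF w])
        also have "\<dots> = (?D / c0) powr dimH * h powr (- dimH) / ?m"
          using c0 h D by (simp add: powr_mult powr_divide powr_minus_divide)
        finally have le: "1 / ?\<mu>w w \<le> (?D / c0) powr dimH * h powr (- dimH) / ?m" .
        have "(cmod (?a w))\<^sup>2 = (cmod (c w))\<^sup>2 * (1 / ?\<mu>w w / ?N\<^sup>2)"
          unfolding norm_mult power_mult_distrib norm_of_real power2_abs power_divide
            powr_minus_half_power2[OF \<mu>w[OF w]] ..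
        also have "\<dots> \<le> (cmod (c w))\<^sup>2 * ((?D / c0) powr dimH * h powr (- dimH) / ?m / ?N\<^sup>2)"
          by (intro mult_left_mono divide_right_mono le) auto
        finally show "(cmod (?a w))\<^sup>2 \<le> (cmod (c w))\<^sup>2 * ((?D / c0) powr dimH * h powr (- dimH) / ?m / ?N\<^sup>2)" .
      qed (use C h in auto)
      also have "\<dots> = C2 * (h powr (- 2 * ?\<sigma>) * h ^ ?n * h powr (- dimH)) * ?S / ?N\<^sup>2"
      proof -
        have alg: "C * a * b * (S * (X * e / m / N2)) = C / m * X * (a * b * e) * S / N2" for a b S X e m N2 :: real
          by (simp add: mult_ac)
        show ?thesis unfolding sum_distrib_right[symmetric] alg C2_def[symmetric] ..
      qed
      also have "h powr (- 2 * ?\<sigma>) * h ^ ?n * h powr (- dimH) = h powr (- 2 * t)"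
        using h by (simp add: powr_realpow[symmetric] powr_add[symmetric] ambient_order_def field_simps)
      also have "C2 * h powr (- 2 * t) * ?S = ?N\<^sup>2"
        using C2 S h by (simp add: power_mult_distrib powr_power)
      also have "?N\<^sup>2 / ?N\<^sup>2 = 1" using N by (intro divide_self) (metis less_irrefl zero_eq_power2)
      finally have "(sobolev_norm ?\<sigma> g)\<^sup>2 \<le> 1\<^sup>2" by simp
      then have g1: "sobolev_norm ?\<sigma> g \<le> 1" by (rule power2_le_imp_le) simp
      have gs: "g \<in> sobolev_space ?\<sigma>" by (rule test_function_sobolev_space[OF g \<sigma> h])
      let ?F = "\<lambda>x. \<Sum>w\<in>W. (cmod (c w))\<^sup>2 / (?\<mu>w w * ?N) * ?\<beta> w x"
      have pt: "\<psi> x * cnj (g x) = complex_of_real (?F x)" if x\<Gamma>: "x \<in> \<Gamma>" for x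
      proof -
        have bz: "?b w x = 0" if "w \<in> W" "x \<notin> piece s \<Gamma> w" for w
        proof (rule bump_support)
          have "4 * (\<kappa> * h) \<le> norm (x - ?x w)"
            using sep[OF that(1) x\<Gamma> that(2)] by (simp add: dist_norm norm_minus_commute)
          then show "1 < norm ((1 / (\<kappa> * h)) *\<^sub>R (x - ?x w))" using r by (simp add: less_divide_eq)
        qed
        have "\<psi> x * cnj (g x) = (\<Sum>u\<in>W. \<Sum>w\<in>W. (c u * word_chi s \<Gamma> u x) * cnj (?a w * ?b w x))"
          by (simp add: \<psi>_eq g_def sum_product)
        \<comment> \<open>Off the diagonal, \<open>word_chi\<close> of u and the bump of w live at
          points of \<Gamma> in disjoint pieces. On the diagonal, the factor
          \<open>?\<mu>w u powr (- 1 / 2)\<close> occurs twice, in \<open>word_chi\<close> and in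
          \<open>?a\<close>, and yields the reciprocal of the measure.\<close>
        also have "\<dots> = (\<Sum>u\<in>W. \<Sum>w\<in>W. if w = u then complex_of_real ((cmod (c u))\<^sup>2 / (?\<mu>w u * ?N) * ?\<beta> u x) else 0)"
        proof (intro sum.cong refl)
          fix u w assume uw: "u \<in> W" "w \<in> W"
          show "(c u * word_chi s \<Gamma> u x) * cnj (?a w * ?b w x)
            = (if w = u then complex_of_real ((cmod (c u))\<^sup>2 / (?\<mu>w u * ?N) * ?\<beta> u x) else 0)"
          proof (cases "w = u")
            case False
            then show ?thesis
              using bz[OF uw(2)] mesh_words_disjoint[OF mesh[OF uw(1)] mesh[OF uw(2)]] by (auto simp: word_chi_def)
          next
            case [simp]: True
            show ?thesis
            proof (cases "x \<in> piece s \<Gamma> u")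
              case True
              have "(c u * word_chi s \<Gamma> u x) * cnj (?a u * ?b u x)
                = (c u * cnj (c u)) * complex_of_real ((?\<mu>w u powr (- 1 / 2))\<^sup>2 / ?N * ?\<beta> u x)"
                using True by (simp add: word_chi_def bump_def power2_eq_square mult_ac)
              also have "\<dots> = complex_of_real ((cmod (c u))\<^sup>2 * (1 / ?\<mu>w u / ?N * ?\<beta> u x))"
                unfolding powr_minus_half_power2[OF \<mu>w[OF uw(1)]] of_real_mult complex_norm_square[symmetric] ..
              finally show ?thesis by simp
            next
              case False
              then have "?\<beta> u x = 0" using bz[OF uw(1)] by (simp add: bump_def)
              then show ?thesis using bz[OF uw(1) False] by simp
            qed
          qed
        qed
        also have "\<dots> = complex_of_real (?F x)" using W(1) by simp
        finally show ?thesis .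
      qed
      have \<beta>m [measurable]: "?\<beta> w \<in> borel_measurable \<mu>" for w
      proof (rule measurable_hausdorff_on)
        have "flat 0 \<in> borel_measurable borel"
          using DERIV_isCont[OF flat_has_real_derivative[of 0]]
          by (intro borel_measurable_continuous_onI) (simp add: continuous_at_imp_continuous_on)
        then show "?\<beta> w \<in> borel_measurable borel" by measurable
      qed
      have \<beta>i: "integrable \<mu> (?\<beta> w)" for w
      proof (rule integrable_const_bound[OF AE_I2 \<beta>m])
        show "norm (?\<beta> w x) \<le> 1" for x
          unfolding real_norm_def abs_of_nonneg[OF flat_0_bounds(1)] by (rule flat_0_bounds)
      qed
      \<comment> \<open>On the subpiece the rescaled distance from the centre is at most 1 / 2;
        elsewhere the bump is at least nonnegative.\<close>
      have ge: "exp (- 4 / 3) * measure \<mu> (piece s \<Gamma> (w @ v)) \<le> (LINT x|\<mu>. ?\<beta> w x)" if w: "w \<in> W" for w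
      proof -
        have wv: "set (w @ v) \<subseteq> {1..M}" using valid[OF w] v(1) by simp
        have "piece s \<Gamma> (w @ v) \<inter> \<Gamma> = piece s \<Gamma> (w @ v)" using piece_subset[OF wv] by blast
        then have "exp (- 4 / 3) * measure \<mu> (piece s \<Gamma> (w @ v)) = (LINT x|\<mu>. exp (- 4 / 3) * indicator (piece s \<Gamma> (w @ v)) x)"
          by simp
        also have "\<dots> \<le> (LINT x|\<mu>. ?\<beta> w x)"
        proof (rule integral_mono[OF _ \<beta>i])
          show "integrable \<mu> (\<lambda>x. exp (- 4 / 3) * indicator (piece s \<Gamma> (w @ v)) x :: real)"
            using piece_sets[OF wv]
            by (intro integrable_mult_right integrable_real_indicator) (auto simp: less_top[symmetric] emeasure_finite)
          fix y
          show "exp (- 4 / 3) * indicator (piece s \<Gamma> (w @ v)) y \<le> ?\<beta> w y"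
          proof (cases "y \<in> piece s \<Gamma> (w @ v)")
            case True
            then obtain z where z: "y = word_map s w z" "z \<in> piece s \<Gamma> v" by (auto simp: piece_append)
            have "dist z x0 \<le> diameter (piece s \<Gamma> v)"
              using z(2) v compact_piece[OF v(1)] by (intro diameter_bounded_bound compact_imp_bounded) auto
            then have "dist y (?x w) \<le> ratio w * (ratio v * ?D)"
              unfolding z(1) dist_word_map[OF valid[OF w]] diameter_piece[OF v(1)]
              using ratio_pos[OF valid[OF w]] by (intro mult_left_mono) auto
            also have "\<dots> = (ratio w * ?D) * ratio v" by simp
            also have "\<dots> \<le> h * (\<kappa> / 2)"
              using mesh_words_ratio_le[OF mesh[OF w]] v(3) ratio_pos[OF v(1)] h by (intro mult_mono) auto
            finally have "norm ((1 / (\<kappa> * h)) *\<^sub>R (y - ?x w)) \<le> 1 / 2"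
              using r by (simp add: dist_norm divide_le_eq mult.commute)
            from flat_0_inner_ge[OF this] True show ?thesis by (simp only: indicator_simps mult_1_right)
          qed (use flat_0_bounds in simp)
        qed
        finally show ?thesis .
      qed
      have mm: "measure \<mu> (piece s \<Gamma> (w @ v)) = ratio v powr dimH * ?\<mu>w w" if "w \<in> W" for w
        using measure_piece_append[OF valid[OF that] v(1)] measure_piece[OF v(1)] measure_piece[OF valid[OF that]] by simp
      have \<beta>ge: "q * ?\<mu>w w \<le> (LINT x|\<mu>. ?\<beta> w x)" if "w \<in> W" for w
        using ge[OF that] unfolding mm[OF that] q_def mult.assoc .
      \<comment> \<open>The measures \<open>?\<mu>w w\<close> cancel between the coefficients and
        the lower bounds for the bump integrals, which leaves the sum of the squares of the
        coefficients.\<close>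
      have "q / ?N * ?S = (\<Sum>w\<in>W. (cmod (c w))\<^sup>2 / (?\<mu>w w * ?N) * (q * ?\<mu>w w))"
        unfolding sum_distrib_left
      proof (intro sum.cong refl)
        fix w assume w: "w \<in> W"
        have "q / N * S = S / (m * N) * (q * m)" if "0 < m" for N S m :: real
          using that by (simp add: mult.commute)
        from this[OF \<mu>w[OF w]] show "q / ?N * (cmod (c w))\<^sup>2 = (cmod (c w))\<^sup>2 / (?\<mu>w w * ?N) * (q * ?\<mu>w w)" .
      qed
      also have "\<dots> \<le> (\<Sum>w\<in>W. (cmod (c w))\<^sup>2 / (?\<mu>w w * ?N) * (LINT x|\<mu>. ?\<beta> w x))"
        using N \<mu>w by (intro sum_mono mult_left_mono \<beta>ge) (auto intro!: divide_nonneg_nonneg mult_nonneg_nonneg less_imp_le)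
      also have "\<dots> = (LINT x|\<mu>. ?F x)"
        using \<beta>i by (subst Bochner_Integration.integral_sum) auto
      also have "\<dots> \<le> cmod (complex_of_real (LINT x|\<mu>. ?F x))" by simp
      also have "complex_of_real (LINT x|\<mu>. ?F x) = L2_embedding \<Gamma> \<psi> g"
        unfolding L2_embedding_def L2_inner_def integral_complex_of_real[symmetric]
        by (intro Bochner_Integration.integral_cong refl pt[symmetric]) simp
      finally have "q / ?N * ?S \<le> cmod (L2_embedding \<Gamma> \<psi> g)" .
      then have "sqrt C2 / q * h powr (- t) * (q / ?N * ?S) \<le> sqrt C2 / q * h powr (- t) * cmod (L2_embedding \<Gamma> \<psi> g)"
        using C2 q by (intro mult_left_mono) auto
      \<comment> \<open>The constant sqrt C2 / q is made for this cancellation: \<open>?N\<close>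
        contains the factors sqrt C2 and h^(-t), and what remains is \<open>?S\<close> / sqrt
        \<open>?S\<close>.\<close>
      moreover have "sqrt C2 / q * h powr (- t) * (q / ?N * ?S) = sqrt ?S"
      proof -
        have "sqrt C2 / q * h powr (- t) * (q / ?N * ?S) = ?S / sqrt ?S"
          using C2 q h by (simp add: field_simps)
        also have "\<dots> = sqrt ?S" using S by (simp add: real_div_sqrt)
        finally show ?thesis .
      qed
      ultimately have "ennreal (L2_norm \<mu> \<psi>) \<le> ennreal (sqrt C2 / q * h powr (- t)) * ennreal (cmod (L2_embedding \<Gamma> \<psi> g))"
        unfolding L2 using C2 q by (subst ennreal_mult'[symmetric]) (auto intro!: ennreal_leI)
      also have "\<dots> \<le> ennreal (sqrt C2 / q * h powr (- t)) * dual_trace_norm \<Gamma> t (L2_embedding \<Gamma> \<psi>)"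
        by (intro mult_left_mono dual_trace_norm_ge g gs g1 finite_measure_axioms) simp
      finally show ?thesis .
    qed
  qed
qed

end

theorem theoremB1:
  fixes M J :: nat
    and s :: "nat \<Rightarrow> 'a::euclidean_space \<Rightarrow> 'a"
    and \<rho> :: "nat \<Rightarrow> real"
    and \<Gamma> :: "'a set"
  assumes "2 \<le> M"
    and "\<And>m. m \<in> {1..M} \<Longrightarrow> contracting_similarity (s m) (\<rho> m)"
    and "is_attractor M s \<Gamma>"
    and "disjoint_family_on (\<lambda>m. s m ` \<Gamma>) {1..M}"
  shows "\<exists>c::real. 0 < c \<and>
    (\<forall>h \<psi> t. 0 < h \<longrightarrow> h \<le> diameter \<Gamma> \<longrightarrow> \<psi> \<in> approx_space M s \<Gamma> h \<longrightarrow>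
       0 < t \<longrightarrow> t \<le> real J \<longrightarrow>
       ennreal (L2_norm (hausdorff_on \<Gamma>) \<psi>)
         \<le> ennreal (c * h powr (- t)) * dual_trace_norm \<Gamma> t (L2_embedding \<Gamma> \<psi>))"
proof -
  interpret disjoint_ifs M s \<rho> \<Gamma>
    using assms by unfold_locales
  show ?thesis
  proof (cases "measure (hausdorff_on \<Gamma>) \<Gamma> = 0")
    case True
    then have "L2_norm (hausdorff_on \<Gamma>) \<psi> = 0" if "\<psi> \<in> approx_space M s \<Gamma> h" for \<psi> h
      using approx_space_trivial[OF True that] by (simp add: L2_norm_def)
    then show ?thesis by (intro exI[of _ 1]) auto
  next
    case False
    then have "0 < measure (hausdorff_on \<Gamma>) \<Gamma>" by (simp add: zero_less_measure_iff)
    then show ?thesis by (rule inverse_estimate)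
  qed
qed

end
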